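(* The Extended Courant property is false for the equilateral rhombus $\mathcal{R}h_e$ with Neumann boundary condition. More precisely, let $\nu_1\le\nu_2\le\nu_3\le\cdots$ be the Neumann eigenvalues of $-\Delta$ in $\mathcal{R}h_e$; then there exists a linear combination of eigenfunctions in $\mathcal{E}(\nu_1)\oplus\mathcal{E}(\nu_3)$ with four nodal domains.
   Context: $\mathcal{R}h_e\subset\mathbb{R}^2$ is the interior of the equilateral rhombus with sides of length $1$ and vertices $(\pm\frac{\sqrt3}{2},0)$, $(0,\pm\frac12)$. Eigenvalues are listed in non-decreasing order, with multiplicities, starting from index $1$; $\mathcal{E}(\nu)$ is the (real) eigenspace of the eigenvalue $\nu$. For an eigenvalue problem $(\Omega,\mathfrak{b})$ for $-\Delta$ in a bounded domain $\Omega$ with boundary condition $\mathfrak{b}$ and eigenvalues $\mu_1<\mu_2\le\mu_3\le\cdots$, the min-index of an eigenvalue $\mu$ is $\kappa(\mu)=\min\{m : \mu=\mu_m\}$. For a function $v$ on $\Omega$, its nodal set is $\mathcal{Z}(v)=\overline{\{x\in\Omega : v(x)=0\}}$, its nodal domains are the connected components of $\Omega\setminus\mathcal{Z}(v)$, and $\beta_0(v)$ is the number of its nodal domains. The Extended Courant property is true for $(\Omega,\mathfrak{b})$ if, for any $m\ge1$ and any linear combination $v=\sum_{\mu_j\le\mu_m}u_{\mu_j}$ with $u_{\mu_j}\in\mathcal{E}(\mu_j(\Omega,\mathfrak{b}))$, one has $\beta_0(v)\le\kappa(\mu_m)\le m$; it is false otherwise. *)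

theory Defs
  imports "HOL-Analysis.Analysis" "HOL-Library.Extended_Nat" "HOL-Library.Function_Algebras"
begin

section \<open>The space of real functions\<close>

global_interpretation funs: vector_space "\<lambda>(c::real) (f::'a \<Rightarrow> real) x. c * f x"
  by unfold_locales (auto simp: algebra_simps fun_eq_iff)


section \<open>Weak gradients and the Sobolev space $H^1$\<close>

text \<open>Test functions are taken in $C^1_c(\Omega)$, extended by zero; by mollification this gives
  the same weak gradients as $C^\infty_c(\Omega)$.\<close>

definition test_function ::
  "'a::euclidean_space set \<Rightarrow> ('a \<Rightarrow> real) \<Rightarrow> ('a \<Rightarrow> 'a) \<Rightarrow> bool" where
  "test_function \<Omega> \<phi> D\<phi> \<longleftrightarrow>
     (\<forall>x. GDERIV \<phi> x :> D\<phi> x) \<and> continuous_on UNIV D\<phi> \<and>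
     (\<exists>K. compact K \<and> K \<subseteq> \<Omega> \<and> (\<forall>x. x \<notin> K \<longrightarrow> \<phi> x = 0))"

definition square_integrable ::
  "'a::euclidean_space set \<Rightarrow> ('a \<Rightarrow> 'b::euclidean_space) \<Rightarrow> bool" where
  "square_integrable \<Omega> f \<longleftrightarrow>
     f \<in> borel_measurable (lebesgue_on \<Omega>) \<and> integrable (lebesgue_on \<Omega>) (\<lambda>x. (norm (f x))\<^sup>2)"

text \<open>\<open>H1 \<Omega> u g\<close>: \<open>u\<close> belongs to $H^1(\Omega)$ and \<open>g\<close> is a version of its weak gradient.\<close>

definition H1 :: "'a::euclidean_space set \<Rightarrow> ('a \<Rightarrow> real) \<Rightarrow> ('a \<Rightarrow> 'a) \<Rightarrow> bool" where
  "H1 \<Omega> u g \<longleftrightarrow> square_integrable \<Omega> u \<and> square_integrable \<Omega> g \<and>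
     (\<forall>\<phi> D\<phi>. test_function \<Omega> \<phi> D\<phi> \<longrightarrow>
        (LINT x|lebesgue_on \<Omega>. u x *\<^sub>R D\<phi> x) = - (LINT x|lebesgue_on \<Omega>. \<phi> x *\<^sub>R g x))"


section \<open>Neumann eigenspaces\<close>

text \<open>The variational Neumann problem: $\int_\Omega \nabla u\cdot\nabla\phi = \nu\int_\Omega u\phi$
  for all $\phi\in H^1(\Omega)$. An element of $H^1(\Omega)$ is only determined almost everywhere,
  so \<open>u\<close> is required to be the continuous representative (it exists by interior regularity), which
  is needed for nodal sets to make sense. The value \<open>0\<close> off \<open>\<Omega>\<close> is a normalisation: functions on
  \<open>\<Omega>\<close> are represented by total functions, and linear independence must not see values
  outside \<open>\<Omega>\<close>.\<close>

definition neumann_eigenspace :: "'a::euclidean_space set \<Rightarrow> real \<Rightarrow> ('a \<Rightarrow> real) set" where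
  "neumann_eigenspace \<Omega> \<nu> =
     {u. continuous_on \<Omega> u \<and> (\<forall>x. x \<notin> \<Omega> \<longrightarrow> u x = 0) \<and>
         (\<exists>g. H1 \<Omega> u g \<and>
            (\<forall>\<phi> h. H1 \<Omega> \<phi> h \<longrightarrow>
               (LINT x|lebesgue_on \<Omega>. g x \<bullet> h x) = \<nu> * (LINT x|lebesgue_on \<Omega>. u x * \<phi> x)))}"


section \<open>Listing eigenvalues with multiplicities\<close>

text \<open>An eigenvalue problem on \<open>\<Omega>\<close> enters through its family \<open>E\<close> of eigenspaces. Since distinct
  eigenspaces of a self-adjoint problem are linearly independent, the number of eigenvalues
  \<open>\<le> \<xi>\<close>, counted with multiplicities, is at least \<open>m\<close> iff the eigenspaces up to \<open>\<xi>\<close>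
  contain \<open>m\<close> linearly independent eigenfunctions; the \<open>m\<close>-th eigenvalue in the non-decreasing list
  (starting from index 1) is the least such \<open>\<xi>\<close>. The lemma below shows that this is the
  usual list; in this way the list is a total function and no spectral theorem is presupposed.\<close>

definition nth_eigenvalue :: "(real \<Rightarrow> ('a \<Rightarrow> real) set) \<Rightarrow> nat \<Rightarrow> real" where
  "nth_eigenvalue E m =
     Inf {\<xi>. \<exists>B. finite B \<and> card B = m \<and> funs.independent B \<and> B \<subseteq> (\<Union>\<mu>\<in>{..\<xi>}. E \<mu>)}"

lemma nth_eigenvalue_of_eigenbasis:
  fixes \<mu> :: "nat \<Rightarrow> real" and b :: "nat \<Rightarrow> 'a \<Rightarrow> real"
  assumes mono: "\<And>i j. 1 \<le> i \<Longrightarrow> i \<le> j \<Longrightarrow> \<mu> i \<le> \<mu> j"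
    and inj: "inj_on b {1..}" and ind: "funs.independent (b ` {1..})"
    and E: "\<And>\<xi>. E \<xi> = funs.span (b ` {j. 1 \<le> j \<and> \<mu> j = \<xi>})"
    and m: "1 \<le> m"
  shows "nth_eigenvalue E m = \<mu> m"
  unfolding nth_eigenvalue_def
proof (rule cInf_eq_minimum)
  have "finite (b ` {1..m})" "card (b ` {1..m}) = m"
    by (auto intro!: card_image[THEN trans] inj_on_subset[OF inj])
  moreover have "funs.independent (b ` {1..m})"
    by (rule funs.independent_mono[OF ind]) auto
  moreover have "b ` {1..m} \<subseteq> (\<Union>\<xi>\<in>{..\<mu> m}. E \<xi>)"
    using mono by (fastforce simp: E intro: funs.span_base)
  ultimately show "\<mu> m \<in> {\<xi>. \<exists>B. finite B \<and> card B = m \<and> funs.independent B \<and>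
      B \<subseteq> (\<Union>\<mu>\<in>{..\<xi>}. E \<mu>)}" by blast
next
  fix \<xi>
  assume "\<xi> \<in> {\<xi>. \<exists>B. finite B \<and> card B = m \<and> funs.independent B \<and>
      B \<subseteq> (\<Union>\<mu>\<in>{..\<xi>}. E \<mu>)}"
  then obtain B where B: "card B = m" "funs.independent B" "B \<subseteq> (\<Union>\<mu>\<in>{..\<xi>}. E \<mu>)"
    by blast
  show "\<mu> m \<le> \<xi>"
  proof (rule ccontr)
    assume "\<not> \<mu> m \<le> \<xi>"
    then have less: "j \<in> {1..<m}" if "1 \<le> j" "\<mu> j \<le> \<xi>" for j
      using mono[OF m, of j] that by force
    have "E \<kappa> \<subseteq> funs.span (b ` {1..<m})" if "\<kappa> \<le> \<xi>" for \<kappa>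
      unfolding E using less that by (intro funs.span_mono image_mono) auto
    with B(3) have "B \<subseteq> funs.span (b ` {1..<m})" by blast
    from funs.independent_span_bound[OF _ B(2) this]
    have "card B \<le> card (b ` {1..<m})" by simp
    also have "\<dots> \<le> m - 1" using card_image_le[of "{1..<m}" b] by simp
    finally show False using B(1) m by simp
  qed
qed

abbreviation neumann_eigenvalue :: "'a::euclidean_space set \<Rightarrow> nat \<Rightarrow> real" where
  "neumann_eigenvalue \<Omega> \<equiv> nth_eigenvalue (neumann_eigenspace \<Omega>)"

definition min_index :: "(real \<Rightarrow> ('a \<Rightarrow> real) set) \<Rightarrow> real \<Rightarrow> nat" where
  "min_index E \<mu> = (LEAST m. 1 \<le> m \<and> \<mu> = nth_eigenvalue E m)"


section \<open>Nodal domains and the Extended Courant property\<close>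

definition nodal_set :: "'a::topological_space set \<Rightarrow> ('a \<Rightarrow> real) \<Rightarrow> 'a set" where
  "nodal_set \<Omega> v = closure {x \<in> \<Omega>. v x = 0}"

definition nodal_domains :: "'a::topological_space set \<Rightarrow> ('a \<Rightarrow> real) \<Rightarrow> 'a set set" where
  "nodal_domains \<Omega> v = components (\<Omega> - nodal_set \<Omega> v)"

definition nodal_count :: "'a::topological_space set \<Rightarrow> ('a \<Rightarrow> real) \<Rightarrow> enat" where
  "nodal_count \<Omega> v =
     (if finite (nodal_domains \<Omega> v) then enat (card (nodal_domains \<Omega> v)) else \<infinity>)"

definition extended_courant ::
  "'a::topological_space set \<Rightarrow> (real \<Rightarrow> ('a \<Rightarrow> real) set) \<Rightarrow> bool" where
  "extended_courant \<Omega> E \<longleftrightarrow>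
     (\<forall>m\<ge>1. \<forall>u.
        let \<mu> = nth_eigenvalue E; S = {\<mu> j | j. 1 \<le> j \<and> \<mu> j \<le> \<mu> m}
        in (\<forall>\<xi>\<in>S. u \<xi> \<in> E \<xi>) \<longrightarrow>
           nodal_count \<Omega> (\<Sum>\<xi>\<in>S. u \<xi>) \<le> enat (min_index E (\<mu> m)) \<and> min_index E (\<mu> m) \<le> m)"


section \<open>The equilateral rhombus\<close>

definition equilateral_rhombus :: "(real^2) set" where
  "equilateral_rhombus = interior (convex hull
     {vector [sqrt 3 / 2, 0], vector [- (sqrt 3 / 2), 0], vector [0, 1 / 2], vector [0, - (1 / 2)]})"

end

theory Submission
  imports Defs "HOL-Real_Asymp.Real_Asymp"
begin

text \<open>The eigenfunction \<open>\<phi> = cos (4 \<pi> y / 3) - 2 cos (2 \<pi> x / \<surd>3) cos (2 \<pi> y / 3)\<close> for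
  \<open>16 \<pi>\<^sup>2 / 9\<close> satisfies \<open>1 + \<phi> = 2 cos p (cos p - cos q)\<close> with \<open>p = 2 \<pi> y / 3\<close>, \<open>q = 2 \<pi> x / \<surd>3\<close>,
  so inside the rhombus \<open>1 + \<phi>\<close> vanishes exactly on the lines \<open>y = \<plusminus>\<surd>3 x\<close>, which cut the rhombus into
  four convex sectors. The third eigenvalue is at most \<open>16 \<pi>\<^sup>2 / 9\<close> because that eigenspace contains
  \<open>\<phi>\<close> and a second, odd eigenfunction. For the lower bound, a combination of three eigenfunctions can
  be chosen with mean zero on both equilateral triangles \<open>\<plusminus>x > 0\<close>, where the sharp Poincare constant is
  \<open>16 \<pi>\<^sup>2 / 9\<close>. This constant comes from Lame's modes, the orbit sums of plane waves under the affine
  reflection group of the triangle: they form an algebra separating the points of the closed triangle, so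
  by Stone-Weierstrass they are dense.\<close>

section \<open>Square-integrable functions and weak gradients\<close>

text \<open>The rhombus has angles 2 pi / 3, so unlike the triangle it is not the alcove of a
  reflection group and its Neumann spectrum is not explicit. Its third eigenvalue is nevertheless
  caught from both sides. Cutting along the short diagonal enlarges \<open>H1\<close> (Neumann
  bracketing); the two triangles carry the eigenvalue 0 twice, so the third eigenvalue is at least
  the first positive one of the triangle. The rhombus attains this value because the triangle modes
  are even across the cut, hence symmetric about all four sides of the rhombus. An \<open>H1\<close>
  function here carries no boundary values. Integration by parts therefore pairs an arbitrary
  \<open>H1\<close> function with an explicit smooth field whose normal component decays linearly at
  each side; for the gradient of a mode this decay comes from reflection symmetry. The Poincare
  inequality then rests on Green's formula and density of the modes, without a spectral
  decomposition.\<close>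

lemma integrable_lebesgue_on_continuous:
  fixes f :: "'a::euclidean_space \<Rightarrow> 'b::euclidean_space"
  assumes "bounded \<Omega>" "\<Omega> \<in> sets lebesgue" "continuous_on UNIV f"
  shows "integrable (lebesgue_on \<Omega>) f"
proof -
  have "integrable lborel (\<lambda>x. indicator (closure \<Omega>) x *\<^sub>R f x)"
    using assms by (intro borel_integrable_compact) (auto intro: continuous_on_subset)
  then have "integrable lebesgue (\<lambda>x. indicator (closure \<Omega>) x *\<^sub>R f x)"
    using borel_measurable_integrable integrable_completion by blast
  then have "integrable lebesgue (\<lambda>x. indicator \<Omega> x *\<^sub>R (indicator (closure \<Omega>) x *\<^sub>R f x))"
    using assms(2) by (rule integrable_mult_indicator[rotated])
  also have "(\<lambda>x. indicator \<Omega> x *\<^sub>R (indicator (closure \<Omega>) x *\<^sub>R f x)) = (\<lambda>x. indicator \<Omega> x *\<^sub>R f x)"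
    using closure_subset by (fastforce simp: indicator_def)
  finally show ?thesis
    using assms by (subst integrable_restrict_space) auto
qed

lemma square_integrable_continuous:
  fixes f :: "'a::euclidean_space \<Rightarrow> 'b::euclidean_space"
  assumes "bounded \<Omega>" "\<Omega> \<in> sets lebesgue" "continuous_on UNIV f"
  shows "square_integrable \<Omega> f"
  unfolding square_integrable_def
  using assms integrable_lebesgue_on_continuous[OF assms]
  by (auto intro!: integrable_lebesgue_on_continuous continuous_intros)

lemma square_integrable_mono:
  assumes f: "square_integrable \<Omega> f" and "A \<subseteq> \<Omega>" "A \<in> sets lebesgue" "\<Omega> \<in> sets lebesgue"
  shows "square_integrable A f"
proof -
  have "integrable (lebesgue_on A) (\<lambda>x. (norm (f x))\<^sup>2)"
    using f assms(2-) set_integrable_subset[of lebesgue \<Omega> "\<lambda>x. (norm (f x))\<^sup>2" A]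
    unfolding square_integrable_def set_integrable_def
    by (simp add: integrable_restrict_space)
  moreover have "f \<in> borel_measurable (lebesgue_on A)"
    using f assms(2-) measurable_restrict_mono unfolding square_integrable_def by blast
  ultimately show ?thesis
    by (auto simp: square_integrable_def)
qed

lemma square_integrable_inner:
  assumes "square_integrable \<Omega> f" "square_integrable \<Omega> g"
  shows "integrable (lebesgue_on \<Omega>) (\<lambda>x. f x \<bullet> g x)"
proof (rule Bochner_Integration.integrable_bound)
  show "integrable (lebesgue_on \<Omega>) (\<lambda>x. (norm (f x))\<^sup>2 + (norm (g x))\<^sup>2)"
    using assms by (auto simp: square_integrable_def)
  show "(\<lambda>x. f x \<bullet> g x) \<in> borel_measurable (lebesgue_on \<Omega>)"
    using assms by (auto simp: square_integrable_def)
  have "\<bar>f x \<bullet> g x\<bar> \<le> (norm (f x))\<^sup>2 + (norm (g x))\<^sup>2" for x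
    using Cauchy_Schwarz_ineq2[of "f x" "g x"] sum_squares_bound[of "norm (f x)" "norm (g x)"]
      mult_nonneg_nonneg[OF norm_ge_zero[of "f x"] norm_ge_zero[of "g x"]] by linarith
  then show "AE x in lebesgue_on \<Omega>. norm (f x \<bullet> g x) \<le> norm ((norm (f x))\<^sup>2 + (norm (g x))\<^sup>2)"
    by simp
qed

lemma square_integrable_mult:
  fixes f g :: "'a::euclidean_space \<Rightarrow> real"
  assumes "square_integrable \<Omega> f" "square_integrable \<Omega> g"
  shows "integrable (lebesgue_on \<Omega>) (\<lambda>x. f x * g x)"
  using square_integrable_inner[OF assms] by simp

lemma square_integrable_scaleR_integrable:
  fixes u :: "'a::euclidean_space \<Rightarrow> real" and g :: "'a \<Rightarrow> 'b::euclidean_space"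
  assumes "square_integrable \<Omega> u" "square_integrable \<Omega> g"
  shows "integrable (lebesgue_on \<Omega>) (\<lambda>x. u x *\<^sub>R g x)"
proof (rule Bochner_Integration.integrable_bound)
  show "integrable (lebesgue_on \<Omega>) (\<lambda>x. (norm (u x))\<^sup>2 + (norm (g x))\<^sup>2)"
    using assms by (auto simp: square_integrable_def)
  show "(\<lambda>x. u x *\<^sub>R g x) \<in> borel_measurable (lebesgue_on \<Omega>)"
    using assms by (auto simp: square_integrable_def)
  have "norm (u x *\<^sub>R g x) \<le> (norm (u x))\<^sup>2 + (norm (g x))\<^sup>2" for x
    using sum_squares_bound[of "norm (u x)" "norm (g x)"]
      mult_nonneg_nonneg[OF norm_ge_zero[of "u x"] norm_ge_zero[of "g x"]] unfolding norm_scaleR real_norm_def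
    by linarith
  then show "AE x in lebesgue_on \<Omega>. norm (u x *\<^sub>R g x) \<le> norm ((norm (u x))\<^sup>2 + (norm (g x))\<^sup>2)"
    by simp
qed

lemma square_integrable_add:
  assumes "square_integrable \<Omega> f" "square_integrable \<Omega> g"
  shows "square_integrable \<Omega> (\<lambda>x. f x + g x)"
proof -
  have "(norm (f x + g x))\<^sup>2 = (norm (f x))\<^sup>2 + (norm (g x))\<^sup>2 + 2 * (f x \<bullet> g x)" for x
    by (simp add: power2_norm_eq_inner algebra_simps inner_commute)
  then show ?thesis
    using assms square_integrable_inner[OF assms] unfolding square_integrable_def
    by (auto intro!: borel_measurable_add)
qed

lemma square_integrable_scaleR:
  assumes "square_integrable \<Omega> f"
  shows "square_integrable \<Omega> (\<lambda>x. c *\<^sub>R f x)"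
  using assms unfolding square_integrable_def by (auto simp: power_mult_distrib)

lemma square_integrable_cmult:
  fixes f :: "'a::euclidean_space \<Rightarrow> real"
  assumes "square_integrable \<Omega> f"
  shows "square_integrable \<Omega> (\<lambda>x. c * f x)"
  using square_integrable_scaleR[OF assms, of c] by simp

lemma square_integrable_diff:
  assumes "square_integrable \<Omega> f" "square_integrable \<Omega> g"
  shows "square_integrable \<Omega> (\<lambda>x. f x - g x)"
  using square_integrable_add[OF assms(1) square_integrable_scaleR[OF assms(2), of "-1"]] by simp

lemma square_integrable_sum:
  assumes "finite I" "\<And>i. i \<in> I \<Longrightarrow> square_integrable \<Omega> (f i)"
  shows "square_integrable \<Omega> (\<lambda>x. \<Sum>i\<in>I. f i x)"
  using assms
proof (induction I rule: finite_induct)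
  case empty
  then show ?case by (simp add: square_integrable_def)
next
  case (insert i I)
  then show ?case using square_integrable_add[of \<Omega> "f i" "\<lambda>x. \<Sum>i\<in>I. f i x"] by simp
qed

lemma square_integrable_cong:
  assumes "square_integrable \<Omega> f" "\<And>x. x \<in> \<Omega> \<Longrightarrow> f x = g x"
  shows "square_integrable \<Omega> g"
proof -
  have "f \<in> borel_measurable (lebesgue_on \<Omega>) \<longleftrightarrow> g \<in> borel_measurable (lebesgue_on \<Omega>)"
    using assms by (intro measurable_cong) auto
  moreover have "integrable (lebesgue_on \<Omega>) (\<lambda>x. (norm (f x))\<^sup>2) \<longleftrightarrow>
    integrable (lebesgue_on \<Omega>) (\<lambda>x. (norm (g x))\<^sup>2)"
    using assms by (intro Bochner_Integration.integrable_cong) auto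
  ultimately show ?thesis
    using assms by (simp add: square_integrable_def)
qed

lemma H1_cong:
  fixes u :: "'a::euclidean_space \<Rightarrow> real"
  assumes "H1 \<Omega> u g" "\<And>x. x \<in> \<Omega> \<Longrightarrow> u x = v x"
  shows "H1 \<Omega> v g"
proof -
  have "(LINT x|lebesgue_on \<Omega>. u x *\<^sub>R D x) = (LINT x|lebesgue_on \<Omega>. v x *\<^sub>R D x)"
    for D :: "'a \<Rightarrow> 'a"
    using assms(2) by (intro Bochner_Integration.integral_cong) auto
  then show ?thesis
    using assms square_integrable_cong[of \<Omega> u v] by (auto simp: H1_def)
qed

section \<open>Test functions and the vanishing integral of their gradients\<close>

lemma continuous_on_GDERIV:
  assumes "\<And>x. GDERIV f x :> D x"
  shows "continuous_on A f"
  using assms unfolding gderiv_def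
  by (blast intro: continuous_at_imp_continuous_on has_derivative_continuous)

lemma test_function_gradient_zero:
  assumes "test_function \<Omega> \<phi> D" "compact K" "\<And>x. x \<notin> K \<Longrightarrow> \<phi> x = 0" "x \<notin> K"
  shows "D x = 0"
proof -
  have "open (- K)" "x \<in> - K"
    using assms(2,4) compact_imp_closed by auto
  moreover have "(\<phi> has_derivative (\<lambda>h. h \<bullet> D x)) (at x)"
    using assms(1) unfolding test_function_def gderiv_def by blast
  ultimately have "((\<lambda>_. 0) has_derivative (\<lambda>h. h \<bullet> D x)) (at x)"
    using assms(3) by (elim has_derivative_transform_within_open) auto
  then have "(\<lambda>h. h \<bullet> D x) = (\<lambda>h. 0)"
    using has_derivative_unique[OF _ has_derivative_const] by blast
  then show ?thesis
    by (metis inner_eq_zero_iff)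
qed

text \<open>The difference quotients of \<open>\<phi>\<close> in direction \<open>b\<close>
  integrate to zero by translation invariance. They are bounded uniformly through the Lipschitz
  constant and supported in one compact set, so dominated convergence carries the zero to the
  limit.\<close>

lemma integral_gradient_test_function:
  fixes \<phi> :: "'a::euclidean_space \<Rightarrow> real"
  assumes T: "test_function \<Omega> \<phi> D"
  shows "(LINT x|lborel. D x \<bullet> b) = 0"
proof -
  obtain K where K: "compact K" "\<And>x. x \<notin> K \<Longrightarrow> \<phi> x = 0"
    using T by (auto simp: test_function_def)
  have G: "GDERIV \<phi> x :> D x" and contD: "continuous_on UNIV D" for x
    using T by (auto simp: test_function_def)
  have cont\<phi>: "continuous_on UNIV \<phi>"
    using G by (rule continuous_on_GDERIV)
  have "compact (D ` K)"
    using K contD by (intro compact_continuous_image) (auto intro: continuous_on_subset)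
  then obtain C where C: "\<And>x. x \<in> K \<Longrightarrow> norm (D x) \<le> C"
    by (metis compact_imp_bounded bounded_pos imageI)
  define C' where "C' = max C 0"
  have C': "norm (D x) \<le> C'" for x
    using C[of x] test_function_gradient_zero[OF T K, of x] by (cases "x \<in> K") (auto simp: C'_def)
  have lip: "\<bar>\<phi> (x + h) - \<phi> x\<bar> \<le> C' * norm h" for x h
  proof -
    have "onorm (\<lambda>h. h \<bullet> D y) \<le> C'" for y
    proof (rule onorm_le)
      fix h show "norm (h \<bullet> D y) \<le> C' * norm h"
        using Cauchy_Schwarz_ineq2[of h "D y"] mult_right_mono[OF C'[of y] norm_ge_zero[of h]]
        by (simp add: mult.commute)
    qed
    then have "norm (\<phi> (x + h) - \<phi> x) \<le> C' * norm (x + h - x)"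
      using G unfolding gderiv_def
      by (intro differentiable_bound[of UNIV \<phi> "\<lambda>y h. h \<bullet> D y"]) auto
    then show ?thesis by simp
  qed
  \<comment> \<open>\<open>K'\<close> contains the support of every shifted function, since the
    shifts have length at most \<open>norm b\<close>.\<close>
  define K' where "K' = {x + y | x y. x \<in> K \<and> y \<in> cball 0 (norm b)}"
  have K': "compact K'"
    unfolding K'_def by (intro compact_sums K) auto
  define F where "F n x = real (Suc n) * (\<phi> (x + b /\<^sub>R real (Suc n)) - \<phi> x)" for n x
  have out: "F n x = 0" if "x \<notin> K'" for n x
  proof -
    have "x \<notin> K"
      using that unfolding K'_def by (auto dest: spec[of _ x] intro: exI[of _ 0])
    moreover have "x + b /\<^sub>R real (Suc n) \<notin> K"
    proof
      assume "x + b /\<^sub>R real (Suc n) \<in> K"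
      moreover have "- (b /\<^sub>R real (Suc n)) \<in> cball 0 (norm b)"
        using mult_left_le[of "inverse (real (Suc n))" "norm b"]
          by (simp add: inverse_le_1_iff mult.commute)
      moreover have "x = (x + b /\<^sub>R real (Suc n)) + - (b /\<^sub>R real (Suc n))" by simp
      ultimately have "x \<in> K'" unfolding K'_def by blast
      then show False using that by simp
    qed
    ultimately show ?thesis using K(2) by (simp add: F_def)
  qed
  have int\<phi>: "integrable lborel \<phi>"
  proof -
    have "integrable lborel (\<lambda>x. indicator K x *\<^sub>R \<phi> x)"
      using K cont\<phi> by (intro borel_integrable_compact) (auto intro: continuous_on_subset)
    also have "(\<lambda>x. indicator K x *\<^sub>R \<phi> x) = \<phi>"
      using K(2) by (fastforce simp: indicator_def)
    finally show ?thesis .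
  qed
  have F0: "(LINT x|lborel. F n x) = 0" for n
  proof -
    have d: "distr lborel borel (\<lambda>x. x + b /\<^sub>R real (Suc n)) = lborel"
    proof -
      have "(\<lambda>x. x + b /\<^sub>R real (Suc n)) = (+) (b /\<^sub>R real (Suc n))"
        by (auto simp: add.commute)
      then show ?thesis by (simp only: lborel_distr_plus)
    qed
    have "integrable (distr lborel borel (\<lambda>x. x + b /\<^sub>R real (Suc n))) \<phi>"
      using int\<phi> by (subst d)
    then have 1: "integrable lborel (\<lambda>x. \<phi> (x + b /\<^sub>R real (Suc n)))"
      using int\<phi> by (subst (asm) integrable_distr_eq) auto
    have "(LINT x|distr lborel borel (\<lambda>x. x + b /\<^sub>R real (Suc n)). \<phi> x) =
        (LINT x|lborel. \<phi> (x + b /\<^sub>R real (Suc n)))"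
      using int\<phi> by (subst integral_distr) auto
    then have 2: "(LINT x|lborel. \<phi> (x + b /\<^sub>R real (Suc n))) = (LINT x|lborel. \<phi> x)"
      by (subst (asm) d) simp
    show ?thesis
      unfolding F_def using 1 2 int\<phi> by simp
  qed
  have "(\<lambda>n. LINT x|lborel. F n x) \<longlonglongrightarrow> (LINT x|lborel. D x \<bullet> b)"
  proof (rule integral_dominated_convergence[where w = "\<lambda>x. indicator K' x *\<^sub>R (C' * norm b)"])
    show "(\<lambda>x. D x \<bullet> b) \<in> borel_measurable lborel"
      using contD by (auto intro!: borel_measurable_continuous_onI continuous_intros)
    show "F n \<in> borel_measurable lborel" for n
      unfolding F_def
      by (simp, intro borel_measurable_continuous_onI continuous_intros continuous_on_compose2[OF cont\<phi>]) auto
    show "integrable lborel (\<lambda>x. indicator K' x *\<^sub>R (C' * norm b))"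
      using K' by (intro borel_integrable_compact) auto
    have "(\<lambda>n. F n x) \<longlonglongrightarrow> D x \<bullet> b" for x
    proof -
      have "((\<lambda>t. x + t *\<^sub>R b) has_derivative (\<lambda>t. t *\<^sub>R b)) (at 0)"
        by (auto intro!: derivative_eq_intros)
      from diff_chain_at[OF this, of \<phi> "\<lambda>h. h \<bullet> D x"]
      have "((\<lambda>t. \<phi> (x + t *\<^sub>R b)) has_derivative (\<lambda>t. (t *\<^sub>R b) \<bullet> D x)) (at 0)"
        using G[of x] by (simp add: gderiv_def o_def)
      then have "((\<lambda>t. \<phi> (x + t *\<^sub>R b)) has_field_derivative (D x \<bullet> b)) (at 0)"
        by (simp add: has_field_derivative_def inner_commute mult.commute[of _ "D x \<bullet> b"])
           (simp add: mult_commute_abs)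
      then have "((\<lambda>t. (\<phi> (x + t *\<^sub>R b) - \<phi> x) / t) \<longlongrightarrow> D x \<bullet> b) (at 0)"
        by (simp add: has_field_derivative_iff)
      then have "(\<lambda>n. (\<phi> (x + inverse (real (Suc n)) *\<^sub>R b) - \<phi> x) / inverse (real (Suc n))) \<longlonglongrightarrow> D x \<bullet> b"
        by (rule filterlim_compose)
           (use LIMSEQ_inverse_real_of_nat in \<open>auto simp: filterlim_at\<close>)
      then show ?thesis
        by (simp add: F_def field_simps)
    qed
    then show "AE x in lborel. (\<lambda>n. F n x) \<longlonglongrightarrow> D x \<bullet> b" by simp
    have "norm (F n x) \<le> indicator K' x *\<^sub>R (C' * norm b)" for n x
    proof (cases "x \<in> K'")
      case True
      have "\<bar>F n x\<bar> = real (Suc n) * \<bar>\<phi> (x + b /\<^sub>R real (Suc n)) - \<phi> x\<bar>"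
        by (simp add: F_def abs_mult)
      also have "\<dots> \<le> real (Suc n) * (C' * norm (b /\<^sub>R real (Suc n)))"
        by (intro mult_left_mono lip) auto
      also have "\<dots> = C' * norm b" by (simp add: divide_simps)
      finally show ?thesis using True by simp
    qed (simp add: out)
    then show "AE x in lborel. norm (F n x) \<le> indicator K' x *\<^sub>R (C' * norm b)" for n by simp
  qed
  then show ?thesis
    unfolding F0 by (simp add: LIMSEQ_const_iff)
qed

section \<open>Integration by parts on convex polygons\<close>

lemma test_function_mult:
  assumes "test_function \<Omega> \<phi> D\<phi>" "\<And>x. GDERIV f x :> D x" "continuous_on UNIV D"
  shows "test_function \<Omega> (\<lambda>x. f x * \<phi> x) (\<lambda>x. f x *\<^sub>R D\<phi> x + \<phi> x *\<^sub>R D x)"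
proof -
  have "continuous_on UNIV f" "continuous_on UNIV \<phi>"
    using assms continuous_on_GDERIV unfolding test_function_def by blast+
  then have "continuous_on UNIV (\<lambda>x. f x *\<^sub>R D\<phi> x + \<phi> x *\<^sub>R D x)"
    using assms unfolding test_function_def by (auto intro!: continuous_intros)
  moreover have "GDERIV (\<lambda>x. f x * \<phi> x) x :> f x *\<^sub>R D\<phi> x + \<phi> x *\<^sub>R D x" for x
    using assms unfolding test_function_def by (intro GDERIV_mult) auto
  moreover have "\<exists>K. compact K \<and> K \<subseteq> \<Omega> \<and> (\<forall>x. x \<notin> K \<longrightarrow> f x * \<phi> x = 0)"
    using assms(1) unfolding test_function_def by (metis mult_zero_right)
  ultimately show ?thesis
    by (simp add: test_function_def)
qed

text \<open>The product of \<open>f\<close> with a test function is again a test function, so the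
  integral of its gradient vanishes; the product rule splits this into the weak gradient
  identity.\<close>

lemma H1_smooth:
  fixes f :: "'a::euclidean_space \<Rightarrow> real"
  assumes \<Omega>: "open \<Omega>" "bounded \<Omega>" and f: "\<And>x. GDERIV f x :> D x" "continuous_on UNIV D"
  shows "H1 \<Omega> f D"
  unfolding H1_def
proof (intro conjI allI impI)
  have leb: "\<Omega> \<in> sets lebesgue" using \<Omega> by auto
  have cf: "continuous_on UNIV f" using f(1) by (rule continuous_on_GDERIV)
  show "square_integrable \<Omega> f" "square_integrable \<Omega> D"
    using \<Omega> leb cf f by (auto intro: square_integrable_continuous)
  fix \<phi> D\<phi> assume T: "test_function \<Omega> \<phi> D\<phi>"
  then have c: "continuous_on UNIV \<phi>" "continuous_on UNIV D\<phi>"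
    using continuous_on_GDERIV unfolding test_function_def by blast+
  define v where "v x = f x *\<^sub>R D\<phi> x + \<phi> x *\<^sub>R D x" for x
  have T': "test_function \<Omega> (\<lambda>x. f x * \<phi> x) v"
    unfolding v_def by (rule test_function_mult[OF T f])
  then obtain K where K: "compact K" "K \<subseteq> \<Omega>" "\<And>x. x \<notin> K \<Longrightarrow> f x * \<phi> x = 0"
    unfolding test_function_def by blast
  have cv: "continuous_on UNIV v"
    using T' by (simp add: test_function_def)
  have i1: "integrable (lebesgue_on \<Omega>) (\<lambda>x. f x *\<^sub>R D\<phi> x)"
    and i2: "integrable (lebesgue_on \<Omega>) (\<lambda>x. \<phi> x *\<^sub>R D x)"
    using c cf f \<Omega> leb by (auto intro!: integrable_lebesgue_on_continuous continuous_intros)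
  then have iv: "integrable (lebesgue_on \<Omega>) v"
    by (simp add: v_def[abs_def])
  have "(LINT x|lebesgue_on \<Omega>. v x) \<bullet> b = 0" for b
  proof -
    have "(LINT x|lebesgue_on \<Omega>. v x) \<bullet> b = (LINT x|lebesgue_on \<Omega>. v x \<bullet> b)"
      using iv by simp
    also have "\<dots> = (LINT x|lebesgue. indicator \<Omega> x *\<^sub>R (v x \<bullet> b))"
      using leb by (subst integral_restrict_space) auto
    also have "(\<lambda>x. indicator \<Omega> x *\<^sub>R (v x \<bullet> b)) = (\<lambda>x. v x \<bullet> b)"
      using test_function_gradient_zero[OF T' K(1,3)] K(2) by (fastforce simp: indicator_def)
    also have "(LINT x|lebesgue. v x \<bullet> b) = (LINT x|lborel. v x \<bullet> b)"
      using cv by (intro integral_completion) (auto intro!: borel_measurable_continuous_onI continuous_intros)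
    also have "\<dots> = 0"
      by (rule integral_gradient_test_function[OF T'])
    finally show ?thesis .
  qed
  then have "(LINT x|lebesgue_on \<Omega>. v x) = 0"
    by (metis inner_eq_zero_iff)
  then have "(LINT x|lebesgue_on \<Omega>. f x *\<^sub>R D\<phi> x) + (LINT x|lebesgue_on \<Omega>. \<phi> x *\<^sub>R D x) = 0"
    unfolding v_def using i1 i2 by simp
  then show "(LINT x|lebesgue_on \<Omega>. f x *\<^sub>R D\<phi> x) = - (LINT x|lebesgue_on \<Omega>. \<phi> x *\<^sub>R D x)"
    by (simp add: add_eq_0_iff)
qed

text \<open>A test function supported in \<open>A\<close> is one for \<open>\<Omega>\<close>. This
  is the bracketing step: functions on the rhombus restrict to each half, with no condition along
  the cut.\<close>

lemma H1_mono:
  assumes "H1 \<Omega> u g" "A \<subseteq> \<Omega>" "A \<in> sets lebesgue" "\<Omega> \<in> sets lebesgue"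
  shows "H1 A u g"
  unfolding H1_def
proof (intro conjI allI impI)
  show "square_integrable A u" "square_integrable A g"
    using assms square_integrable_mono unfolding H1_def by blast+
  fix \<phi> D\<phi> assume T: "test_function A \<phi> D\<phi>"
  then obtain K where K: "compact K" "K \<subseteq> A" "\<And>x. x \<notin> K \<Longrightarrow> \<phi> x = 0"
    unfolding test_function_def by blast
  have eq: "(LINT x|lebesgue_on A. F x) = (LINT x|lebesgue_on \<Omega>. F x)"
    if "\<And>x. x \<notin> K \<Longrightarrow> F x = 0" for F :: "'a \<Rightarrow> 'a"
  proof -
    have "(\<lambda>x. indicat_real A x *\<^sub>R F x) = (\<lambda>x. indicat_real \<Omega> x *\<^sub>R F x)"
      using that K(2) assms(2) by (fastforce simp: indicator_def)
    then show ?thesis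
      using assms(3,4) by (simp add: integral_restrict_space)
  qed
  have "test_function \<Omega> \<phi> D\<phi>"
    using T assms(2) unfolding test_function_def by blast
  then have "(LINT x|lebesgue_on \<Omega>. u x *\<^sub>R D\<phi> x) = - (LINT x|lebesgue_on \<Omega>. \<phi> x *\<^sub>R g x)"
    using assms(1) unfolding H1_def by blast
  then show "(LINT x|lebesgue_on A. u x *\<^sub>R D\<phi> x) = - (LINT x|lebesgue_on A. \<phi> x *\<^sub>R g x)"
    using test_function_gradient_zero[OF T K(1,3)] K(3) by (subst (1 2) eq) auto
qed

text \<open>Any \<open>C\<^sup>1\<close> profile vanishing up to \<open>1\<close> and tending to \<open>1\<close> works, provided \<open>t \<cdot> cutoff' t\<close> is bounded
  and tends to \<open>0\<close>; a plateau at \<open>1\<close> is not needed.\<close>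

definition cutoff :: "real \<Rightarrow> real" where
  "cutoff t = (max 0 (t - 1))\<^sup>2 / (1 + (max 0 (t - 1))\<^sup>2)"

definition cutoff_deriv :: "real \<Rightarrow> real" where
  "cutoff_deriv t = 2 * max 0 (t - 1) / (1 + (max 0 (t - 1))\<^sup>2)\<^sup>2"

lemma cutoff_bounds: "0 \<le> cutoff t" "cutoff t \<le> 1"
  and cutoff_zero: "t \<le> 1 \<Longrightarrow> cutoff t = 0"
  by (auto simp: cutoff_def divide_simps add_pos_nonneg)

text \<open>Squaring removes the kink at 0, where the difference quotient is at most
  \<open>\<bar>h\<bar>\<close>.\<close>

lemma DERIV_max_square: "((\<lambda>t. (max 0 t)\<^sup>2) has_real_derivative 2 * max 0 t) (at t)" for t :: real
proof (cases t "0::real" rule: linorder_cases)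
  case less
  have "((\<lambda>t. 0) has_real_derivative 0) (at t)" by simp
  then have "((\<lambda>t. (max 0 t)\<^sup>2) has_real_derivative 0) (at t)"
    by (rule has_field_derivative_transform_within_open[of _ _ _ "{..<0}"]) (use less in auto)
  then show ?thesis using less by simp
next
  case greater
  have "((\<lambda>t. t\<^sup>2) has_real_derivative 2 * t) (at t)" by (auto intro!: derivative_eq_intros)
  then have "((\<lambda>t. (max 0 t)\<^sup>2) has_real_derivative 2 * t) (at t)"
    by (rule has_field_derivative_transform_within_open[of _ _ _ "{0<..}"]) (use greater in auto)
  then show ?thesis using greater by simp
next
  case equal
  have "((\<lambda>h. (max 0 h)\<^sup>2 / h) \<longlongrightarrow> 0) (at (0::real))"
  proof (rule Lim_null_comparison)
    show "\<forall>\<^sub>F h in at (0::real). norm ((max 0 h)\<^sup>2 / h) \<le> \<bar>h\<bar>"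
      by (auto simp: eventually_at_filter max_def power2_eq_square abs_mult)
    show "((\<lambda>h. \<bar>h\<bar>) \<longlongrightarrow> 0) (at (0::real))"
      by (auto intro!: tendsto_eq_intros)
  qed
  then show ?thesis
    using equal by (simp add: DERIV_def)
qed

lemma DERIV_cutoff: "(cutoff has_real_derivative cutoff_deriv t) (at t)"
proof -
  define r where "r t = (max 0 (t - 1))\<^sup>2" for t :: real
  have r: "(r has_real_derivative 2 * max 0 (t - 1)) (at t)"
  proof -
    have "((\<lambda>t. t - 1) has_real_derivative 1) (at t)" by (auto intro!: derivative_eq_intros)
    from DERIV_chain2[where f = "\<lambda>t. (max 0 t)\<^sup>2", OF DERIV_max_square this]
    show ?thesis by (simp add: r_def[abs_def])
  qed
  have "1 + r t \<noteq> 0"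
    by (metis add_pos_nonneg less_irrefl r_def zero_le_power2 zero_less_one)
  then have "((\<lambda>t. r t / (1 + r t)) has_real_derivative cutoff_deriv t) (at t)"
    by (auto intro!: derivative_eq_intros r simp: cutoff_deriv_def r_def[symmetric])
       (simp add: field_simps power2_eq_square)
  then show ?thesis
    by (simp add: cutoff_def[abs_def] r_def)
qed

lemma continuous_cutoff_deriv: "continuous_on A cutoff_deriv"
  unfolding cutoff_deriv_def[abs_def]
  by (intro continuous_intros) (metis add_pos_nonneg less_irrefl power_not_zero zero_le_power2 zero_less_one)

lemma cutoff_deriv_nonneg: "0 \<le> cutoff_deriv t"
  by (auto simp: cutoff_deriv_def)

lemma cutoff_deriv_bound: "t * cutoff_deriv t \<le> 4"
proof (cases "t \<le> 1")
  case False
  define r where "r = t - 1"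
  have "0 < r" "t = r + 1" using False by (auto simp: r_def)
  then have eq: "t * cutoff_deriv t = 2 * (r + 1) * r / (1 + r\<^sup>2)\<^sup>2"
    by (simp add: cutoff_deriv_def)
  \<comment> \<open>Any bound independent of \<open>t\<close> serves;
    \<open>2 * r \<le> 1 + r\<^sup>2\<close> bounds the left side by
    \<open>1 + 3 * r\<^sup>2\<close>.\<close>
  have "2 * (r + 1) * r \<le> 4 * (1 + r\<^sup>2)\<^sup>2"
  proof -
    have "2 * r \<le> 1 + r\<^sup>2" using sum_squares_bound[of r 1] by simp
    moreover have "4 * (1 + r\<^sup>2)\<^sup>2 = 4 + 8 * r\<^sup>2 + 4 * (r\<^sup>2)\<^sup>2"
      by (simp add: power2_eq_square algebra_simps)
    moreover have "2 * (r + 1) * r = 2 * r\<^sup>2 + 2 * r"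
      by (simp add: power2_eq_square algebra_simps)
    ultimately show ?thesis
      using zero_le_power2[of r] zero_le_power2[of "r\<^sup>2"] by linarith
  qed
  then show ?thesis
    unfolding eq by (simp add: divide_simps add_pos_nonneg)
qed (simp add: cutoff_deriv_def)

lemma cutoff_tendsto: "((\<lambda>t. cutoff t) \<longlongrightarrow> 1) at_top"
proof -
  have "((\<lambda>t::real. (t - 1)\<^sup>2 / (1 + (t - 1)\<^sup>2)) \<longlongrightarrow> 1) at_top" by real_asymp
  then show ?thesis
    by (rule Lim_transform_eventually)
       (rule eventually_mono[OF eventually_ge_at_top[of 1]], simp add: cutoff_def)
qed

lemma cutoff_deriv_tendsto: "((\<lambda>t. t * cutoff_deriv t) \<longlongrightarrow> 0) at_top"
proof -
  have "((\<lambda>t::real. t * (2 * (t - 1) / (1 + (t - 1)\<^sup>2)\<^sup>2)) \<longlongrightarrow> 0) at_top" by real_asymp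
  then show ?thesis
    by (rule Lim_transform_eventually)
       (rule eventually_mono[OF eventually_ge_at_top[of 1]], simp add: cutoff_deriv_def)
qed

section \<open>Convex polygons and their boundary cutoffs\<close>

definition polygon :: "'i set \<Rightarrow> ('i \<Rightarrow> 'a) \<Rightarrow> ('i \<Rightarrow> real) \<Rightarrow> 'a::euclidean_space set" where
  "polygon I n c = {x. \<forall>i\<in>I. n i \<bullet> x < c i}"

lemma open_polygon: "finite I \<Longrightarrow> open (polygon I n c)"
proof -
  assume "finite I"
  moreover have "polygon I n c = (\<Inter>i\<in>I. {x. n i \<bullet> x < c i})"
    by (auto simp: polygon_def)
  ultimately show ?thesis
    by (auto intro!: open_INT open_halfspace_lt)
qed

lemma polygon_sets: "finite I \<Longrightarrow> polygon I n c \<in> sets lebesgue"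
  using open_polygon by (metis borel_open sets_completionI_sets sets_lborel)

text \<open>Inside, \<open>c i - n i \<bullet> x\<close> is a multiple of the distance to side
  \<open>i\<close>. Increasing \<open>N\<close> squeezes the boundary layer, at the price of a
  gradient of size \<open>N\<close>.\<close>

definition polygon_cutoff :: "'i set \<Rightarrow> ('i \<Rightarrow> 'a) \<Rightarrow> ('i \<Rightarrow> real) \<Rightarrow> real \<Rightarrow> 'a::euclidean_space \<Rightarrow> real" where
  "polygon_cutoff I n c N x = (\<Prod>i\<in>I. cutoff (N * (c i - n i \<bullet> x)))"

definition polygon_cutoff_grad :: "'i set \<Rightarrow> ('i \<Rightarrow> 'a) \<Rightarrow> ('i \<Rightarrow> real) \<Rightarrow> real \<Rightarrow> 'a::euclidean_space \<Rightarrow> 'a" where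
  "polygon_cutoff_grad I n c N x =
     (\<Sum>i\<in>I. ((\<Prod>j\<in>I - {i}. cutoff (N * (c j - n j \<bullet> x))) * (N * cutoff_deriv (N * (c i - n i \<bullet> x)))) *\<^sub>R (- n i))"

lemma GDERIV_polygon_cutoff:
  assumes "finite I"
  shows "GDERIV (polygon_cutoff I n c N) x :> polygon_cutoff_grad I n c N x"
  unfolding gderiv_def
proof -
  have "((\<lambda>x. cutoff (N * (c i - n i \<bullet> x))) has_derivative
      (\<lambda>h. N * cutoff_deriv (N * (c i - n i \<bullet> x)) * (- (n i \<bullet> h)))) (at x)" for i
  proof -
    have "((\<lambda>x. N * (c i - n i \<bullet> x)) has_derivative (\<lambda>h. N * (- (n i \<bullet> h)))) (at x)"
      by (auto intro!: derivative_eq_intros)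
    from has_derivative_compose[OF this DERIV_cutoff[of "N * (c i - n i \<bullet> x)",
          unfolded has_field_derivative_def]]
    show ?thesis by (simp add: mult_ac)
  qed
  from has_derivative_prod[of I, OF this]
  have "(polygon_cutoff I n c N has_derivative (\<lambda>h. \<Sum>i\<in>I. N * cutoff_deriv (N * (c i - n i \<bullet> x)) * (- (n i \<bullet> h)) *
      (\<Prod>j\<in>I - {i}. cutoff (N * (c j - n j \<bullet> x))))) (at x)"
    by (simp add: polygon_cutoff_def[abs_def])
  also have "(\<lambda>h. \<Sum>i\<in>I. N * cutoff_deriv (N * (c i - n i \<bullet> x)) * (- (n i \<bullet> h)) *
      (\<Prod>j\<in>I - {i}. cutoff (N * (c j - n j \<bullet> x)))) = (\<lambda>h. h \<bullet> polygon_cutoff_grad I n c N x)"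
    unfolding polygon_cutoff_grad_def inner_sum_right inner_scaleR_right inner_minus_right
    by (intro ext sum.cong refl) (simp add: inner_commute mult_ac)
  finally show "(polygon_cutoff I n c N has_derivative (\<lambda>h. h \<bullet> polygon_cutoff_grad I n c N x)) (at x)" .
qed

lemma continuous_cutoff: "continuous_on A cutoff"
  using DERIV_cutoff by (blast intro: DERIV_continuous continuous_at_imp_continuous_on)

lemma continuous_polygon_cutoff_grad: "continuous_on A (polygon_cutoff_grad I n c N)"
  unfolding polygon_cutoff_grad_def[abs_def]
  by (intro continuous_intros continuous_on_compose2[OF continuous_cutoff[of UNIV]]
      continuous_on_compose2[OF continuous_cutoff_deriv[of UNIV]]) auto

lemma polygon_cutoff_bounds: "0 \<le> polygon_cutoff I n c N x" "polygon_cutoff I n c N x \<le> 1"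
  unfolding polygon_cutoff_def by (auto intro!: prod_nonneg prod_le_1 cutoff_bounds)

lemma polygon_cutoff_tendsto:
  assumes "x \<in> polygon I n c"
  shows "(\<lambda>N. polygon_cutoff I n c (real N) x) \<longlonglongrightarrow> 1"
proof -
  have "(\<lambda>N. cutoff (real N * (c i - n i \<bullet> x))) \<longlonglongrightarrow> 1" if "i \<in> I" for i
  proof (rule filterlim_compose[OF cutoff_tendsto])
    have "c i - n i \<bullet> x > 0" using assms that by (auto simp: polygon_def)
    then show "filterlim (\<lambda>N. real N * (c i - n i \<bullet> x)) at_top sequentially" by real_asymp
  qed
  then have "(\<lambda>N. polygon_cutoff I n c (real N) x) \<longlonglongrightarrow> (\<Prod>i\<in>I. 1)"
    unfolding polygon_cutoff_def by (intro tendsto_prod)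
  then show ?thesis by simp
qed

text \<open>\<open>cutoff\<close> vanishes up to 1, so the product is 0 once some side has
  \<open>c i - n i \<bullet> x \<le> 1 / N\<close>. This includes every point outside the
  polygon.\<close>

lemma polygon_cutoff_support:
  assumes "finite I" "bounded (polygon I n c)" "I \<noteq> {}" "N > 0"
  obtains K where "compact K" "K \<subseteq> polygon I n c" "\<And>x. x \<notin> K \<Longrightarrow> polygon_cutoff I n c N x = 0"
proof
  define K where "K = {x. \<forall>i\<in>I. n i \<bullet> x \<le> c i - 1 / N}"
  have "K = (\<Inter>i\<in>I. {x. n i \<bullet> x \<le> c i - 1 / N})" by (auto simp: K_def)
  then have "closed K" by (auto simp: closed_halfspace_le)
  show "K \<subseteq> polygon I n c"
  proof
    fix x assume "x \<in> K"
    then have "n i \<bullet> x \<le> c i - 1 / N" if "i \<in> I" for i using that by (simp add: K_def)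
    then show "x \<in> polygon I n c"
      using \<open>N > 0\<close> by (fastforce simp: polygon_def intro: le_less_trans)
  qed
  then show "compact K"
    using \<open>closed K\<close> assms(2) bounded_subset by (auto simp: compact_eq_bounded_closed)
  fix x assume "x \<notin> K"
  then obtain i where i: "i \<in> I" "N * (c i - n i \<bullet> x) \<le> 1"
    using \<open>N > 0\<close> by (auto simp: K_def not_le field_simps)
  then show "polygon_cutoff I n c N x = 0"
    unfolding polygon_cutoff_def using assms(1) cutoff_zero by auto
qed

text \<open>With \<open>t = N * (c i - n i \<bullet> x)\<close> the term of side \<open>i\<close> is
  at most \<open>C * (t * cutoff_deriv t)\<close> in modulus: the distance to the side absorbs the
  factor \<open>N\<close>. This is at most \<open>4 * C\<close>, and it tends to 0 because
  \<open>t\<close> tends to infinity at an interior point.\<close>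

lemma polygon_cutoff_grad_tangent:
  assumes "finite I" "x \<in> polygon I n c" "0 \<le> C" and tang: "\<And>i. i \<in> I \<Longrightarrow> \<bar>n i \<bullet> v\<bar> \<le> C * (c i - n i \<bullet> x)"
  shows "\<bar>polygon_cutoff_grad I n c (real N) x \<bullet> v\<bar> \<le> real (card I) * (4 * C)"
    and "(\<lambda>N. polygon_cutoff_grad I n c (real N) x \<bullet> v) \<longlonglongrightarrow> 0"
proof -
  define t where "t N i = (\<Prod>j\<in>I - {i}. cutoff (real N * (c j - n j \<bullet> x))) *
      (real N * cutoff_deriv (real N * (c i - n i \<bullet> x))) * - (n i \<bullet> v)" for N i
  have eq: "polygon_cutoff_grad I n c (real N) x \<bullet> v = (\<Sum>i\<in>I. t N i)" for N
    by (simp add: polygon_cutoff_grad_def inner_sum_left t_def)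
  have b: "\<bar>t N i\<bar> \<le> C * (real N * (c i - n i \<bullet> x) * cutoff_deriv (real N * (c i - n i \<bullet> x)))"
    if "i \<in> I" for N i
  proof -
    have P: "0 \<le> (\<Prod>j\<in>I - {i}. cutoff (real N * (c j - n j \<bullet> x)))"
      "(\<Prod>j\<in>I - {i}. cutoff (real N * (c j - n j \<bullet> x))) \<le> 1"
      by (auto intro!: prod_nonneg prod_le_1 cutoff_bounds)
    have "\<bar>t N i\<bar> = (\<Prod>j\<in>I - {i}. cutoff (real N * (c j - n j \<bullet> x))) *
        ((real N * cutoff_deriv (real N * (c i - n i \<bullet> x))) * \<bar>n i \<bullet> v\<bar>)"
      using P cutoff_deriv_nonneg by (simp add: t_def abs_mult)
    also have "\<dots> \<le> 1 * ((real N * cutoff_deriv (real N * (c i - n i \<bullet> x))) * (C * (c i - n i \<bullet> x)))"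
      using P tang[OF that] cutoff_deriv_nonneg by (intro mult_mono) auto
    finally show ?thesis by (simp add: mult_ac)
  qed
  have "\<bar>\<Sum>i\<in>I. t N i\<bar> \<le> (\<Sum>i\<in>I. 4 * C)" for N
  proof (rule order_trans[OF sum_abs], rule sum_mono)
    fix i assume "i \<in> I"
    from b[OF this, of N] mult_left_mono[OF cutoff_deriv_bound[of "real N * (c i - n i \<bullet> x)"] \<open>0 \<le> C\<close>]
    show "\<bar>t N i\<bar> \<le> 4 * C" by linarith
  qed
  then show "\<bar>polygon_cutoff_grad I n c (real N) x \<bullet> v\<bar> \<le> real (card I) * (4 * C)"
    unfolding eq by simp
  have "(\<lambda>N. t N i) \<longlonglongrightarrow> 0" if "i \<in> I" for i
  proof (rule Lim_null_comparison)
    show "\<forall>\<^sub>F N in sequentially. norm (t N i) \<le>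
        C * (real N * (c i - n i \<bullet> x) * cutoff_deriv (real N * (c i - n i \<bullet> x)))"
      using b[OF that] by simp
    have "c i - n i \<bullet> x > 0" using assms that by (auto simp: polygon_def)
    then have "filterlim (\<lambda>N. real N * (c i - n i \<bullet> x)) at_top sequentially" by real_asymp
    from tendsto_mult_right_zero[OF filterlim_compose[OF cutoff_deriv_tendsto this]]
    show "(\<lambda>N. C * (real N * (c i - n i \<bullet> x) * cutoff_deriv (real N * (c i - n i \<bullet> x)))) \<longlonglongrightarrow> 0" .
  qed
  then have "(\<lambda>N. \<Sum>i\<in>I. t N i) \<longlonglongrightarrow> (\<Sum>i\<in>I. 0)"
    by (intro tendsto_sum)
  then show "(\<lambda>N. polygon_cutoff_grad I n c (real N) x \<bullet> v) \<longlonglongrightarrow> 0"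
    unfolding eq by simp
qed


text \<open>Since the normal component of \<open>X\<close> is dominated by the distance to the side, the cutoff gradient of
  size \<open>N\<close> contributes only a bounded term that tends to zero pointwise.\<close>

lemma Green_polygon:
  fixes X :: "'a::euclidean_space \<Rightarrow> 'a"
  assumes H: "H1 (polygon I n c) u g" and I: "finite I" "I \<noteq> {}" and bd: "bounded (polygon I n c)"
    and X: "\<And>b x. b \<in> Basis \<Longrightarrow> GDERIV (\<lambda>x. X x \<bullet> b) x :> DX b x"
    and DX: "\<And>b. b \<in> Basis \<Longrightarrow> continuous_on UNIV (DX b)"
    and C: "0 \<le> C" "\<And>i x. i \<in> I \<Longrightarrow> x \<in> polygon I n c \<Longrightarrow> \<bar>n i \<bullet> X x\<bar> \<le> C * (c i - n i \<bullet> x)"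
  shows "(LINT x|lebesgue_on (polygon I n c). g x \<bullet> X x) =
    - (LINT x|lebesgue_on (polygon I n c). u x * (\<Sum>b\<in>Basis. DX b x \<bullet> b))"
proof -
  define \<Omega> where "\<Omega> = polygon I n c"
  define \<eta> where "\<eta> N = polygon_cutoff I n c (real N)" for N
  define d\<eta> where "d\<eta> N = polygon_cutoff_grad I n c (real N)" for N
  define dv where "dv x = (\<Sum>b\<in>Basis. DX b x \<bullet> b)" for x
  have leb: "\<Omega> \<in> sets lebesgue" unfolding \<Omega>_def using I(1) by (rule polygon_sets)
  have bd': "bounded \<Omega>" using bd by (simp add: \<Omega>_def)
  have u: "square_integrable \<Omega> u" and g: "square_integrable \<Omega> g"
    using H by (auto simp: H1_def \<Omega>_def)
  have cXb: "continuous_on UNIV (\<lambda>x. X x \<bullet> b)" if "b \<in> Basis" for b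
    using X[OF that] by (rule continuous_on_GDERIV)
  have cX: "continuous_on UNIV X"
    by (rule continuous_on_componentwise[THEN iffD2]) (simp add: cXb)
  have c\<eta>: "continuous_on UNIV (\<eta> N)" "continuous_on UNIV (d\<eta> N)" for N
    unfolding \<eta>_def d\<eta>_def
    by (rule continuous_on_GDERIV[OF GDERIV_polygon_cutoff[OF I(1)]], rule continuous_polygon_cutoff_grad)
  have cdv: "continuous_on UNIV dv"
    unfolding dv_def by (intro continuous_intros DX)
  note sq = square_integrable_continuous[OF bd' leb]
  have step: "(LINT x|lebesgue_on \<Omega>. u x * (\<eta> N x * dv x + d\<eta> N x \<bullet> X x)) =
      - (LINT x|lebesgue_on \<Omega>. \<eta> N x * (g x \<bullet> X x))" if "N > 0" for N
  proof -
    have "real N > 0" using that by simp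
    from polygon_cutoff_support[OF I(1) bd I(2) this, folded \<Omega>_def \<eta>_def]
    obtain K where K: "compact K" "K \<subseteq> \<Omega>" "\<And>x. x \<notin> K \<Longrightarrow> \<eta> N x = 0" by blast
    \<comment> \<open>The weak gradient is tested with the scalar functions
      \<open>\<eta> N x * (X x \<bullet> b)\<close>, and only the \<open>b\<close>-component of the
      resulting vector identity is kept; summing over \<open>b\<close> produces the divergence of
      \<open>X\<close>.\<close>
    have comp: "(LINT x|lebesgue_on \<Omega>. u x * (\<eta> N x * (DX b x \<bullet> b) + (X x \<bullet> b) * (d\<eta> N x \<bullet> b))) =
       - (LINT x|lebesgue_on \<Omega>. (\<eta> N x * (X x \<bullet> b)) * (g x \<bullet> b))"
      and ib: "integrable (lebesgue_on \<Omega>) (\<lambda>x. u x * (\<eta> N x * (DX b x \<bullet> b) + (X x \<bullet> b) * (d\<eta> N x \<bullet> b)))"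
      and ib': "integrable (lebesgue_on \<Omega>) (\<lambda>x. (\<eta> N x * (X x \<bullet> b)) * (g x \<bullet> b))"
      if b: "b \<in> Basis" for b
    proof -
      let ?D = "\<lambda>x. \<eta> N x *\<^sub>R DX b x + (X x \<bullet> b) *\<^sub>R d\<eta> N x"
      have cD: "continuous_on UNIV ?D"
        by (intro continuous_intros c\<eta> cXb DX b cX)
      have "GDERIV (\<lambda>x. \<eta> N x * (X x \<bullet> b)) x :> ?D x" for x
        unfolding \<eta>_def d\<eta>_def by (intro GDERIV_mult GDERIV_polygon_cutoff I X b)
      then have "test_function \<Omega> (\<lambda>x. \<eta> N x * (X x \<bullet> b)) ?D"
        using cD K unfolding test_function_def by auto
      then have "(LINT x|lebesgue_on \<Omega>. u x *\<^sub>R ?D x) =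
          - (LINT x|lebesgue_on \<Omega>. (\<eta> N x * (X x \<bullet> b)) *\<^sub>R g x)"
        using H unfolding H1_def \<Omega>_def by blast
      then have eq: "(LINT x|lebesgue_on \<Omega>. u x *\<^sub>R ?D x) \<bullet> b =
          - (LINT x|lebesgue_on \<Omega>. (\<eta> N x * (X x \<bullet> b)) *\<^sub>R g x) \<bullet> b" by simp
      have i1: "integrable (lebesgue_on \<Omega>) (\<lambda>x. u x *\<^sub>R ?D x)"
        using square_integrable_scaleR_integrable[OF u sq[OF cD]] .
      have i2: "integrable (lebesgue_on \<Omega>) (\<lambda>x. (\<eta> N x * (X x \<bullet> b)) *\<^sub>R g x)"
        by (intro square_integrable_scaleR_integrable sq g continuous_intros c\<eta> cXb b)
      have "(LINT x|lebesgue_on \<Omega>. u x *\<^sub>R ?D x \<bullet> b) = - (LINT x|lebesgue_on \<Omega>. (\<eta> N x * (X x \<bullet> b)) *\<^sub>R g x \<bullet> b)"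
        using eq by (simp only: integral_inner_left[OF i1] integral_inner_left[OF i2] inner_minus_left)
      then show "(LINT x|lebesgue_on \<Omega>. u x * (\<eta> N x * (DX b x \<bullet> b) + (X x \<bullet> b) * (d\<eta> N x \<bullet> b))) =
         - (LINT x|lebesgue_on \<Omega>. (\<eta> N x * (X x \<bullet> b)) * (g x \<bullet> b))"
        by (simp add: inner_add_left)
      have "integrable (lebesgue_on \<Omega>) (\<lambda>x. u x *\<^sub>R ?D x \<bullet> b)"
        using i1 by (rule integrable_inner_left)
      then show "integrable (lebesgue_on \<Omega>) (\<lambda>x. u x * (\<eta> N x * (DX b x \<bullet> b) + (X x \<bullet> b) * (d\<eta> N x \<bullet> b)))"
        by (simp add: inner_add_left)
      have "integrable (lebesgue_on \<Omega>) (\<lambda>x. (\<eta> N x * (X x \<bullet> b)) *\<^sub>R g x \<bullet> b)"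
        using i2 by (rule integrable_inner_left)
      then show "integrable (lebesgue_on \<Omega>) (\<lambda>x. (\<eta> N x * (X x \<bullet> b)) * (g x \<bullet> b))"
        by simp
    qed
    have "(LINT x|lebesgue_on \<Omega>. u x * (\<eta> N x * dv x + d\<eta> N x \<bullet> X x)) =
       (LINT x|lebesgue_on \<Omega>. (\<Sum>b\<in>Basis. u x * (\<eta> N x * (DX b x \<bullet> b) + (X x \<bullet> b) * (d\<eta> N x \<bullet> b))))"
    proof (rule Bochner_Integration.integral_cong[OF refl])
      fix x
      show "u x * (\<eta> N x * dv x + d\<eta> N x \<bullet> X x) =
          (\<Sum>b\<in>Basis. u x * (\<eta> N x * (DX b x \<bullet> b) + (X x \<bullet> b) * (d\<eta> N x \<bullet> b)))"
        unfolding dv_def euclidean_inner[of "d\<eta> N x" "X x"] sum_distrib_left sum.distrib[symmetric]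
        by (simp add: mult.commute)
    qed
    also have "\<dots> = (\<Sum>b\<in>Basis. LINT x|lebesgue_on \<Omega>. u x * (\<eta> N x * (DX b x \<bullet> b) + (X x \<bullet> b) * (d\<eta> N x \<bullet> b)))"
      by (intro Bochner_Integration.integral_sum ib)
    also have "\<dots> = - (\<Sum>b\<in>Basis. LINT x|lebesgue_on \<Omega>. (\<eta> N x * (X x \<bullet> b)) * (g x \<bullet> b))"
      by (simp add: comp sum_negf)
    also have "\<dots> = - (LINT x|lebesgue_on \<Omega>. (\<Sum>b\<in>Basis. (\<eta> N x * (X x \<bullet> b)) * (g x \<bullet> b)))"
      by (subst Bochner_Integration.integral_sum) (auto intro: ib')
    also have "\<dots> = - (LINT x|lebesgue_on \<Omega>. \<eta> N x * (g x \<bullet> X x))"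
    proof (rule arg_cong[where f = uminus], rule Bochner_Integration.integral_cong[OF refl])
      fix x
      show "(\<Sum>b\<in>Basis. (\<eta> N x * (X x \<bullet> b)) * (g x \<bullet> b)) = \<eta> N x * (g x \<bullet> X x)"
        unfolding euclidean_inner[of "g x" "X x"] sum_distrib_left by (simp add: mult_ac)
    qed
    finally show ?thesis .
  qed
  \<comment> \<open>A bound, uniform in \<open>N\<close>, for the cutoff gradient against
    \<open>X\<close>; it supplies the dominating function below.\<close>
  define B where "B = real (card I) * (4 * C)"
  have d\<eta>: "\<bar>d\<eta> N x \<bullet> X x\<bar> \<le> B" "(\<lambda>N. d\<eta> N x \<bullet> X x) \<longlonglongrightarrow> 0" if "x \<in> \<Omega>" for x N
    unfolding d\<eta>_def B_def using that C(1) C(2)[of _ x] unfolding \<Omega>_def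
    by (auto intro!: polygon_cutoff_grad_tangent[where C = C] I)
  have \<eta>: "(\<lambda>N. \<eta> N x) \<longlonglongrightarrow> 1" if "x \<in> \<Omega>" for x
    using polygon_cutoff_tendsto that unfolding \<eta>_def \<Omega>_def by blast
  have \<eta>01: "0 \<le> \<eta> N x" "\<eta> N x \<le> 1" for N x
    unfolding \<eta>_def by (rule polygon_cutoff_bounds)+
  have "(\<lambda>N. LINT x|lebesgue_on \<Omega>. u x * (\<eta> N x * dv x + d\<eta> N x \<bullet> X x)) \<longlonglongrightarrow>
      (LINT x|lebesgue_on \<Omega>. u x * dv x)"
  proof (rule integral_dominated_convergence[where w = "\<lambda>x. \<bar>u x * dv x\<bar> + \<bar>u x * B\<bar>"])
    have iu: "integrable (lebesgue_on \<Omega>) (\<lambda>x. u x * v x)" if "continuous_on UNIV v" for v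
      using square_integrable_mult[OF u sq[OF that]] .
    have "continuous_on UNIV (\<lambda>x. \<eta> N x * dv x + d\<eta> N x \<bullet> X x)" for N
      by (intro continuous_intros c\<eta> cdv cX)
    from borel_measurable_integrable[OF iu[OF this]]
    show "\<And>N. (\<lambda>x. u x * (\<eta> N x * dv x + d\<eta> N x \<bullet> X x)) \<in> borel_measurable (lebesgue_on \<Omega>)" .
    show "(\<lambda>x. u x * dv x) \<in> borel_measurable (lebesgue_on \<Omega>)"
      by (rule borel_measurable_integrable[OF iu[OF cdv]])
    show "integrable (lebesgue_on \<Omega>) (\<lambda>x. \<bar>u x * dv x\<bar> + \<bar>u x * B\<bar>)"
      by (intro Bochner_Integration.integrable_add integrable_abs iu cdv continuous_on_const)
    show "AE x in lebesgue_on \<Omega>. (\<lambda>N. u x * (\<eta> N x * dv x + d\<eta> N x \<bullet> X x)) \<longlonglongrightarrow> u x * dv x"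
    proof (rule AE_I2)
      fix x assume "x \<in> space (lebesgue_on \<Omega>)"
      then have "x \<in> \<Omega>" by simp
      then have "(\<lambda>N. u x * (\<eta> N x * dv x + d\<eta> N x \<bullet> X x)) \<longlonglongrightarrow> u x * (1 * dv x + 0)"
        by (intro tendsto_intros \<eta> d\<eta>)
      then show "(\<lambda>N. u x * (\<eta> N x * dv x + d\<eta> N x \<bullet> X x)) \<longlonglongrightarrow> u x * dv x" by simp
    qed
    show "AE x in lebesgue_on \<Omega>. norm (u x * (\<eta> N x * dv x + d\<eta> N x \<bullet> X x)) \<le> \<bar>u x * dv x\<bar> + \<bar>u x * B\<bar>" for N
    proof (rule AE_I2)
      fix x assume "x \<in> space (lebesgue_on \<Omega>)"
      then have x: "x \<in> \<Omega>" by simp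
      have "\<bar>\<eta> N x * dv x + d\<eta> N x \<bullet> X x\<bar> \<le> \<bar>dv x\<bar> + \<bar>B\<bar>"
        using d\<eta>(1)[OF x, of N] mult_right_mono[OF \<eta>01(2)[of N x] abs_ge_zero[of "dv x"]] \<eta>01(1)[of N x]
        by (auto simp: abs_mult intro!: order_trans[OF abs_triangle_ineq] add_mono)
      from mult_left_mono[OF this abs_ge_zero[of "u x"]]
      show "norm (u x * (\<eta> N x * dv x + d\<eta> N x \<bullet> X x)) \<le> \<bar>u x * dv x\<bar> + \<bar>u x * B\<bar>"
        by (simp add: abs_mult distrib_left) (simp add: abs_mult[symmetric] distrib_left)
    qed
  qed
  moreover have "(\<lambda>N. - (LINT x|lebesgue_on \<Omega>. \<eta> N x * (g x \<bullet> X x))) \<longlonglongrightarrow>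
      - (LINT x|lebesgue_on \<Omega>. g x \<bullet> X x)"
  proof (rule tendsto_minus, rule integral_dominated_convergence[where w = "\<lambda>x. \<bar>g x \<bullet> X x\<bar>"])
    have gX: "integrable (lebesgue_on \<Omega>) (\<lambda>x. g x \<bullet> v x)" if "continuous_on UNIV v" for v
      using square_integrable_inner[OF g sq[OF that]] .
    show "(\<lambda>x. g x \<bullet> X x) \<in> borel_measurable (lebesgue_on \<Omega>)"
      "integrable (lebesgue_on \<Omega>) (\<lambda>x. \<bar>g x \<bullet> X x\<bar>)"
      using gX[OF cX] by auto
    have "integrable (lebesgue_on \<Omega>) (\<lambda>x. g x \<bullet> (\<eta> N x *\<^sub>R X x))" for N
      by (intro gX continuous_intros c\<eta> cX)
    then show "(\<lambda>x. \<eta> N x * (g x \<bullet> X x)) \<in> borel_measurable (lebesgue_on \<Omega>)" for N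
      by auto
    show "AE x in lebesgue_on \<Omega>. (\<lambda>N. \<eta> N x * (g x \<bullet> X x)) \<longlonglongrightarrow> g x \<bullet> X x"
    proof (rule AE_I2)
      fix x assume "x \<in> space (lebesgue_on \<Omega>)"
      then have "(\<lambda>N. \<eta> N x * (g x \<bullet> X x)) \<longlonglongrightarrow> 1 * (g x \<bullet> X x)"
        by (intro tendsto_intros \<eta>) auto
      then show "(\<lambda>N. \<eta> N x * (g x \<bullet> X x)) \<longlonglongrightarrow> g x \<bullet> X x" by simp
    qed
    show "AE x in lebesgue_on \<Omega>. norm (\<eta> N x * (g x \<bullet> X x)) \<le> \<bar>g x \<bullet> X x\<bar>" for N
      using \<eta>01 by (auto simp: abs_mult mult_left_le_one_le)
  qed
  then have "(\<lambda>N. LINT x|lebesgue_on \<Omega>. u x * (\<eta> N x * dv x + d\<eta> N x \<bullet> X x)) \<longlonglongrightarrow>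
      - (LINT x|lebesgue_on \<Omega>. g x \<bullet> X x)"
    by (rule Lim_transform_eventually)
       (rule eventually_mono[OF eventually_gt_at_top[of 0]], simp add: step)
  ultimately have "(LINT x|lebesgue_on \<Omega>. u x * dv x) = - (LINT x|lebesgue_on \<Omega>. g x \<bullet> X x)"
    by (rule LIMSEQ_unique)
  then show ?thesis
    by (simp add: \<Omega>_def dv_def)
qed

section \<open>Neumann modes of a polygon and the Poincare inequality\<close>

text \<open>\<open>H b\<close> is the gradient of the component \<open>D x \<bullet> b\<close>, so
  the last clause says that the Laplacian of \<open>f\<close> is \<open>- l * f\<close>. The global
  Lipschitz bound on the gradient later turns a vanishing normal derivative into linear decay at a
  side.\<close>

definition helmholtz :: "real \<Rightarrow> ('a::euclidean_space \<Rightarrow> real) \<Rightarrow> ('a \<Rightarrow> 'a) \<Rightarrow> bool" where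
  "helmholtz l f D \<longleftrightarrow>
     (\<forall>x. GDERIV f x :> D x) \<and> (\<exists>L\<ge>0. \<forall>x y. norm (D x - D y) \<le> L * norm (x - y)) \<and>
     (\<exists>H. (\<forall>b\<in>Basis. (\<forall>x. GDERIV (\<lambda>x. D x \<bullet> b) x :> H b x) \<and> continuous_on UNIV (H b)) \<and>
          (\<forall>x. (\<Sum>b\<in>Basis. H b x \<bullet> b) = - l * f x))"

lemma GDERIV_cos_affine: "GDERIV (\<lambda>x. r * cos (k \<bullet> x + b)) x :> - (r * sin (k \<bullet> x + b)) *\<^sub>R k"
  and GDERIV_sin_affine: "GDERIV (\<lambda>x. r * sin (k \<bullet> x + b)) x :> (r * cos (k \<bullet> x + b)) *\<^sub>R k"
  unfolding gderiv_def by (auto intro!: derivative_eq_intros simp: inner_commute algebra_simps)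

lemma abs_sin_diff_le: "\<bar>sin x - sin y\<bar> \<le> \<bar>x - y\<bar>" for x y :: real
proof -
  have "norm (sin x - sin y) \<le> 1 * norm (x - y)"
    by (rule field_differentiable_bound[of UNIV sin cos]) auto
  then show ?thesis by simp
qed

lemma helmholtz_wave:
  "helmholtz (k \<bullet> k) (\<lambda>x. r * cos (k \<bullet> x + b)) (\<lambda>x. - (r * sin (k \<bullet> x + b)) *\<^sub>R k)"
  unfolding helmholtz_def
proof (intro conjI allI)
  show "GDERIV (\<lambda>x. r * cos (k \<bullet> x + b)) x :> - (r * sin (k \<bullet> x + b)) *\<^sub>R k" for x
    by (rule GDERIV_cos_affine)
  show "\<exists>L\<ge>0. \<forall>x y. norm (- (r * sin (k \<bullet> x + b)) *\<^sub>R k - - (r * sin (k \<bullet> y + b)) *\<^sub>R k) \<le> L * norm (x - y)"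
  proof (intro exI[of _ "\<bar>r\<bar> * norm k * norm k"] conjI allI)
    fix x y
    have "norm (- (r * sin (k \<bullet> x + b)) *\<^sub>R k - - (r * sin (k \<bullet> y + b)) *\<^sub>R k) =
        \<bar>r\<bar> * norm k * \<bar>sin (k \<bullet> x + b) - sin (k \<bullet> y + b)\<bar>"
      unfolding scaleR_left.diff[symmetric] norm_scaleR
      by (simp add: abs_mult[symmetric] algebra_simps abs_minus_commute)
    also have "\<dots> \<le> \<bar>r\<bar> * norm k * \<bar>k \<bullet> (x - y)\<bar>"
      using abs_sin_diff_le[of "k \<bullet> x + b" "k \<bullet> y + b"]
      by (intro mult_left_mono) (auto simp: inner_diff_right)
    also have "\<dots> \<le> \<bar>r\<bar> * norm k * (norm k * norm (x - y))"
      by (intro mult_left_mono Cauchy_Schwarz_ineq2) auto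
    finally show "norm (- (r * sin (k \<bullet> x + b)) *\<^sub>R k - - (r * sin (k \<bullet> y + b)) *\<^sub>R k) \<le>
        \<bar>r\<bar> * norm k * norm k * norm (x - y)" by (simp add: mult_ac)
  qed auto
  show "\<exists>H. (\<forall>c\<in>Basis. (\<forall>x. GDERIV (\<lambda>x. - (r * sin (k \<bullet> x + b)) *\<^sub>R k \<bullet> c) x :> H c x) \<and> continuous_on UNIV (H c)) \<and>
      (\<forall>x. (\<Sum>c\<in>Basis. H c x \<bullet> c) = - (k \<bullet> k) * (r * cos (k \<bullet> x + b)))"
  proof (intro exI[of _ "\<lambda>c x. (- (k \<bullet> c) * r * cos (k \<bullet> x + b)) *\<^sub>R k"] conjI ballI allI)
    fix c x :: 'a
    have "GDERIV (\<lambda>x. (- (k \<bullet> c) * r) * sin (k \<bullet> x + b)) x :> ((- (k \<bullet> c) * r) * cos (k \<bullet> x + b)) *\<^sub>R k"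
      by (rule GDERIV_sin_affine)
    then show "GDERIV (\<lambda>x. - (r * sin (k \<bullet> x + b)) *\<^sub>R k \<bullet> c) x :> (- (k \<bullet> c) * r * cos (k \<bullet> x + b)) *\<^sub>R k"
      by (simp add: mult_ac)
  next
    show "continuous_on UNIV (\<lambda>x. (- (k \<bullet> c) * r * cos (k \<bullet> x + b)) *\<^sub>R k)" for c
      by (intro continuous_intros)
  next
    fix x :: 'a
    have "(\<Sum>c\<in>Basis. (- (k \<bullet> c) * r * cos (k \<bullet> x + b)) *\<^sub>R k \<bullet> c) =
        - (r * cos (k \<bullet> x + b)) * (\<Sum>c\<in>Basis. (k \<bullet> c) * (k \<bullet> c))"
      unfolding sum_distrib_left by (intro sum.cong) auto
    then show "(\<Sum>c\<in>Basis. (- (k \<bullet> c) * r * cos (k \<bullet> x + b)) *\<^sub>R k \<bullet> c) = - (k \<bullet> k) * (r * cos (k \<bullet> x + b))"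
      by (simp add: euclidean_inner[of k k])
  qed
qed

lemma helmholtz_hessian:
  assumes "helmholtz l f D"
  obtains H where "\<And>b x. b \<in> Basis \<Longrightarrow> GDERIV (\<lambda>x. D x \<bullet> b) x :> H b x"
    "\<And>b. b \<in> Basis \<Longrightarrow> continuous_on UNIV (H b)" "\<And>x. (\<Sum>b\<in>Basis. H b x \<bullet> b) = - l * f x"
proof -
  obtain H where "\<forall>b\<in>Basis. (\<forall>x. GDERIV (\<lambda>x. D x \<bullet> b) x :> H b x) \<and> continuous_on UNIV (H b)"
    "\<forall>x. (\<Sum>b\<in>Basis. H b x \<bullet> b) = - l * f x"
    using assms unfolding helmholtz_def by blast
  then show ?thesis by (intro that[of H]) auto
qed

lemma helmholtz_add:
  assumes "helmholtz l f D" "helmholtz l g E"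
  shows "helmholtz l (\<lambda>x. f x + g x) (\<lambda>x. D x + E x)"
proof -
  obtain L M where L: "L \<ge> 0" "\<And>x y. norm (D x - D y) \<le> L * norm (x - y)"
    and M: "M \<ge> 0" "\<And>x y. norm (E x - E y) \<le> M * norm (x - y)"
    using assms unfolding helmholtz_def by blast
  obtain H where H: "\<And>b x. b \<in> Basis \<Longrightarrow> GDERIV (\<lambda>x. D x \<bullet> b) x :> H b x"
      "\<And>b. b \<in> Basis \<Longrightarrow> continuous_on UNIV (H b)" "\<And>x. (\<Sum>b\<in>Basis. H b x \<bullet> b) = - l * f x"
    by (rule helmholtz_hessian[OF assms(1)]) blast
  obtain K where K: "\<And>b x. b \<in> Basis \<Longrightarrow> GDERIV (\<lambda>x. E x \<bullet> b) x :> K b x"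
      "\<And>b. b \<in> Basis \<Longrightarrow> continuous_on UNIV (K b)" "\<And>x. (\<Sum>b\<in>Basis. K b x \<bullet> b) = - l * g x"
    by (rule helmholtz_hessian[OF assms(2)]) blast
  show ?thesis
    unfolding helmholtz_def
  proof (intro conjI allI)
    show "GDERIV (\<lambda>x. f x + g x) x :> D x + E x" for x
      using assms unfolding helmholtz_def by (intro GDERIV_add) auto
    show "\<exists>L\<ge>0. \<forall>x y. norm (D x + E x - (D y + E y)) \<le> L * norm (x - y)"
    proof (intro exI[of _ "L + M"] conjI allI)
      fix x y
      show "norm (D x + E x - (D y + E y)) \<le> (L + M) * norm (x - y)"
        using L(2)[of x y] M(2)[of x y] norm_triangle_ineq[of "D x - D y" "E x - E y"]
        by (simp add: algebra_simps)
    qed (use L M in auto)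
    show "\<exists>H. (\<forall>b\<in>Basis. (\<forall>x. GDERIV (\<lambda>x. (D x + E x) \<bullet> b) x :> H b x) \<and> continuous_on UNIV (H b)) \<and>
        (\<forall>x. (\<Sum>b\<in>Basis. H b x \<bullet> b) = - l * (f x + g x))"
    proof (intro exI[of _ "\<lambda>b x. H b x + K b x"] conjI ballI allI)
      fix b x :: 'a assume b: "b \<in> Basis"
      show "GDERIV (\<lambda>x. (D x + E x) \<bullet> b) x :> H b x + K b x"
        unfolding inner_add_left by (intro GDERIV_add H K b)
    next
      fix b :: 'a assume b: "b \<in> Basis"
      show "continuous_on UNIV (\<lambda>x. H b x + K b x)"
        by (intro continuous_intros H K b)
    next
      fix x
      show "(\<Sum>b\<in>Basis. (H b x + K b x) \<bullet> b) = - l * (f x + g x)"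
        by (simp add: inner_add_left sum.distrib H K algebra_simps)
    qed
  qed
qed

lemma helmholtz_continuous:
  assumes "helmholtz l f D"
  shows "continuous_on A f" "continuous_on A D"
proof -
  show "continuous_on A f"
    using assms unfolding helmholtz_def by (blast intro: continuous_on_GDERIV)
  obtain L where L: "L \<ge> 0" "\<And>x y. norm (D x - D y) \<le> L * norm (x - y)"
    using assms unfolding helmholtz_def by blast
  then have "L-lipschitz_on A D"
    by (intro lipschitz_onI) (auto simp: dist_norm)
  then show "continuous_on A D" by (rule lipschitz_on_continuous_on)
qed

section \<open>Reflections in the sides and Neumann modes\<close>

definition mirror :: "'a::euclidean_space \<Rightarrow> real \<Rightarrow> 'a \<Rightarrow> 'a" where
  "mirror n c x = x - (2 * (n \<bullet> x - c) / (n \<bullet> n)) *\<^sub>R n"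

text \<open>The normal derivative is odd across the mirror, so it is controlled by the distance to it.\<close>

lemma helmholtz_mirror:
  assumes h: "helmholtz l f D" and n: "n \<noteq> 0" and f: "\<And>x. f (mirror n c x) = f x"
  shows "\<exists>C\<ge>0. \<forall>x. \<bar>n \<bullet> D x\<bar> \<le> C * \<bar>c - n \<bullet> x\<bar>"
proof -
  obtain L where L: "L \<ge> 0" "\<And>x y. norm (D x - D y) \<le> L * norm (x - y)"
    and G: "\<And>x. GDERIV f x :> D x"
    using h unfolding helmholtz_def by blast
  have nn: "n \<bullet> n > 0" using n by simp
  \<comment> \<open>Differentiate the invariance of \<open>f\<close>; the linear part
    \<open>R\<close> of the reflection sends \<open>n\<close> to \<open>- n\<close>.\<close>
  have odd: "n \<bullet> D x = - (n \<bullet> D (mirror n c x))" for x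
  proof -
    define R where "R h = h - (2 * (n \<bullet> h) / (n \<bullet> n)) *\<^sub>R n" for h
    have "(mirror n c has_derivative R) (at x)"
      unfolding mirror_def[abs_def] R_def[abs_def]
      using n by (auto intro!: derivative_eq_intros)
    from has_derivative_compose[OF this G[of "mirror n c x", unfolded gderiv_def]]
    have "(f has_derivative (\<lambda>h. R h \<bullet> D (mirror n c x))) (at x)"
      by (simp add: f)
    from has_derivative_unique[OF this G[of x, unfolded gderiv_def]]
    have "R n \<bullet> D (mirror n c x) = n \<bullet> D x" by (rule fun_cong)
    moreover have "R n = - n"
      using nn by (simp add: R_def scaleR_2)
    ultimately show ?thesis by simp
  qed
  have "\<bar>n \<bullet> D x\<bar> \<le> L * \<bar>c - n \<bullet> x\<bar>" for x
  proof -
    have "2 * \<bar>n \<bullet> D x\<bar> = \<bar>n \<bullet> (D x - D (mirror n c x))\<bar>"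
      using odd[of x] by (simp add: inner_diff_right)
    also have "\<dots> \<le> norm n * (L * norm (x - mirror n c x))"
      by (intro order_trans[OF Cauchy_Schwarz_ineq2] mult_left_mono L) auto
    also have "norm (x - mirror n c x) = 2 * \<bar>n \<bullet> x - c\<bar> / norm n"
    proof -
      have "\<bar>2 * (n \<bullet> x) - 2 * c\<bar> = 2 * \<bar>n \<bullet> x - c\<bar>"
        using abs_mult[of 2 "n \<bullet> x - c"] by (simp add: algebra_simps)
      then show ?thesis
        using n by (simp add: mirror_def abs_mult dot_square_norm power2_eq_square)
    qed
    finally show ?thesis
      using n by (simp add: abs_minus_commute)
  qed
  then show ?thesis using L by blast
qed

text \<open>Invariance under reflection in every side line stands in for the Neumann condition. It
  makes the normal derivative vanish at a linear rate, which is the form that integration by parts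
  requires.\<close>

definition polygon_mode ::
  "'i set \<Rightarrow> ('i \<Rightarrow> 'a) \<Rightarrow> ('i \<Rightarrow> real) \<Rightarrow> real \<Rightarrow> ('a::euclidean_space \<Rightarrow> real) \<Rightarrow> ('a \<Rightarrow> 'a) \<Rightarrow> bool" where
  "polygon_mode I n c l f D \<longleftrightarrow> helmholtz l f D \<and> (\<forall>i\<in>I. \<forall>x. f (mirror (n i) (c i) x) = f x)"

lemma polygon_mode_H1:
  assumes "polygon_mode I n c l f D" "finite I" "bounded (polygon I n c)"
  shows "H1 (polygon I n c) f D"
proof (rule H1_smooth)
  have h: "helmholtz l f D" using assms(1) by (simp add: polygon_mode_def)
  then show "GDERIV f x :> D x" for x by (simp add: helmholtz_def)
  show "continuous_on UNIV D" using h by (rule helmholtz_continuous)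
qed (use assms open_polygon in auto)

text \<open>Integration by parts with the field \<open>D\<close>, whose divergence is
  \<open>- l * f\<close>. As \<open>u\<close> ranges over all of \<open>H1\<close>, this is the weak
  Neumann equation for \<open>f\<close>.\<close>

lemma polygon_mode_Green:
  assumes m: "polygon_mode I n c l f D" and I: "finite I" "I \<noteq> {}" "\<And>i. i \<in> I \<Longrightarrow> n i \<noteq> 0"
    and bd: "bounded (polygon I n c)" and u: "H1 (polygon I n c) u g"
  shows "(LINT x|lebesgue_on (polygon I n c). g x \<bullet> D x) = l * (LINT x|lebesgue_on (polygon I n c). u x * f x)"
proof -
  obtain H where H: "\<And>b x. b \<in> Basis \<Longrightarrow> GDERIV (\<lambda>x. D x \<bullet> b) x :> H b x"
      "\<And>b. b \<in> Basis \<Longrightarrow> continuous_on UNIV (H b)" "\<And>x. (\<Sum>b\<in>Basis. H b x \<bullet> b) = - l * f x"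
    using helmholtz_hessian[of l f D] m unfolding polygon_mode_def by blast
  have "\<forall>i\<in>I. \<exists>C\<ge>0. \<forall>x. \<bar>n i \<bullet> D x\<bar> \<le> C * \<bar>c i - n i \<bullet> x\<bar>"
    using m I(3) helmholtz_mirror unfolding polygon_mode_def by blast
  then obtain C where C: "\<And>i. i \<in> I \<Longrightarrow> C i \<ge> 0" "\<And>i x. i \<in> I \<Longrightarrow> \<bar>n i \<bullet> D x\<bar> \<le> C i * \<bar>c i - n i \<bullet> x\<bar>"
    by metis
  have "(LINT x|lebesgue_on (polygon I n c). g x \<bullet> D x) =
      - (LINT x|lebesgue_on (polygon I n c). u x * (\<Sum>b\<in>Basis. H b x \<bullet> b))"
  \<comment> \<open>One constant has to serve all sides, hence the sum of the individual
    ones.\<close>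
  proof (rule Green_polygon[OF u I(1,2) bd, where C = "sum C I"])
    show "0 \<le> sum C I" using C by (intro sum_nonneg)
    fix i x assume i: "i \<in> I" and "x \<in> polygon I n c"
    then have "0 < c i - n i \<bullet> x" by (simp add: polygon_def)
    then have "\<bar>n i \<bullet> D x\<bar> \<le> C i * (c i - n i \<bullet> x)"
      using C(2)[OF i, of x] by simp
    also have "\<dots> \<le> sum C I * (c i - n i \<bullet> x)"
      using \<open>0 < c i - n i \<bullet> x\<close> i C I by (intro mult_right_mono member_le_sum) auto
    finally show "\<bar>n i \<bullet> D x\<bar> \<le> sum C I * (c i - n i \<bullet> x)" .
  qed (use H in auto)
  also have "\<dots> = - (LINT x|lebesgue_on (polygon I n c). - l * (u x * f x))"
    by (simp add: H(3) mult_ac)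
  also have "\<dots> = l * (LINT x|lebesgue_on (polygon I n c). u x * f x)"
    by (simp only: integral_mult_right_zero)
  finally show ?thesis .
qed

lemma polygon_mode_eigenfunction:
  assumes m: "polygon_mode I n c l f D" and I: "finite I" "I \<noteq> {}" "\<And>i. i \<in> I \<Longrightarrow> n i \<noteq> 0"
    and bd: "bounded (polygon I n c)"
  shows "(\<lambda>x. if x \<in> polygon I n c then f x else 0) \<in> neumann_eigenspace (polygon I n c) l"
proof -
  let ?f = "\<lambda>x. if x \<in> polygon I n c then f x else 0"
  have "continuous_on (polygon I n c) ?f"
    using m helmholtz_continuous(1) unfolding polygon_mode_def by (subst continuous_on_cong[OF refl, of _ _ f]) auto
  moreover have "H1 (polygon I n c) ?f D"
    using polygon_mode_H1[OF m I(1) bd] by (rule H1_cong) simp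
  moreover have "(LINT x|lebesgue_on (polygon I n c). D x \<bullet> h x) =
      l * (LINT x|lebesgue_on (polygon I n c). ?f x * \<phi> x)" if "H1 (polygon I n c) \<phi> h" for \<phi> h
  proof -
    have "(LINT x|lebesgue_on (polygon I n c). ?f x * \<phi> x) = (LINT x|lebesgue_on (polygon I n c). \<phi> x * f x)"
      by (intro Bochner_Integration.integral_cong) auto
    then show ?thesis
      using polygon_mode_Green[OF m I bd that] by (simp add: inner_commute)
  qed
  ultimately show ?thesis
    unfolding neumann_eigenspace_def by auto
qed

lemma polygon_mode_orthogonal:
  assumes m: "polygon_mode I n c l f D" "polygon_mode I n c k h E" "l \<noteq> k"
    and I: "finite I" "I \<noteq> {}" "\<And>i. i \<in> I \<Longrightarrow> n i \<noteq> 0" and bd: "bounded (polygon I n c)"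
  shows "(LINT x|lebesgue_on (polygon I n c). f x * h x) = 0"
proof -
  have "l * (LINT x|lebesgue_on (polygon I n c). f x * h x) = k * (LINT x|lebesgue_on (polygon I n c). f x * h x)"
    using polygon_mode_Green[OF m(1) I bd polygon_mode_H1[OF m(2) I(1) bd]]
      polygon_mode_Green[OF m(2) I bd polygon_mode_H1[OF m(1) I(1) bd]]
    by (simp only: inner_commute[of "E _"] mult.commute[of "h _"])
  then show ?thesis using m(3) by simp
qed

text \<open>By orthogonality \<open>k j\<close> may be replaced by \<open>sqrt (k i) * sqrt (k j)\<close>, and the sum becomes a square norm.\<close>

lemma weighted_gram_nonneg:
  fixes f :: "'i \<Rightarrow> 'a::euclidean_space \<Rightarrow> real"
  assumes I: "finite I" and f: "\<And>i. i \<in> I \<Longrightarrow> square_integrable \<Omega> (f i)" and k: "\<And>i. i \<in> I \<Longrightarrow> k i \<ge> 0"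
    and orth: "\<And>i j. i \<in> I \<Longrightarrow> j \<in> I \<Longrightarrow> k i \<noteq> k j \<Longrightarrow> (LINT x|lebesgue_on \<Omega>. f i x * f j x) = 0"
  shows "0 \<le> (\<Sum>i\<in>I. \<Sum>j\<in>I. k j * (LINT x|lebesgue_on \<Omega>. f i x * f j x))"
proof -
  have "(\<Sum>i\<in>I. \<Sum>j\<in>I. k j * (LINT x|lebesgue_on \<Omega>. f i x * f j x)) =
      (\<Sum>i\<in>I. \<Sum>j\<in>I. sqrt (k i) * sqrt (k j) * (LINT x|lebesgue_on \<Omega>. f i x * f j x))"
  proof (intro sum.cong refl)
    fix i j assume ij: "i \<in> I" "j \<in> I"
    show "k j * (LINT x|lebesgue_on \<Omega>. f i x * f j x) =
        sqrt (k i) * sqrt (k j) * (LINT x|lebesgue_on \<Omega>. f i x * f j x)"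
      using orth[OF ij] k ij by (cases "k i = k j") auto
  qed
  also have "\<dots> = (\<Sum>i\<in>I. \<Sum>j\<in>I. (LINT x|lebesgue_on \<Omega>. (sqrt (k i) * f i x) * (sqrt (k j) * f j x)))"
    by (intro sum.cong refl) (simp only: integral_mult_right_zero[symmetric], simp only: mult_ac)
  also have "\<dots> = (LINT x|lebesgue_on \<Omega>. (\<Sum>i\<in>I. \<Sum>j\<in>I. (sqrt (k i) * f i x) * (sqrt (k j) * f j x)))"
    using f by (simp add: Bochner_Integration.integral_sum square_integrable_mult square_integrable_cmult)
  also have "\<dots> = (LINT x|lebesgue_on \<Omega>. (\<Sum>i\<in>I. sqrt (k i) * f i x)\<^sup>2)"
    by (simp add: power2_eq_square sum_product)
  also have "\<dots> \<ge> 0" by (intro integral_nonneg_AE) auto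
  finally show ?thesis .
qed


text \<open>The target is continuous only inside the polygon and may be unbounded near the boundary,
  out of reach of uniform approximation. Cutting it off gives a continuous function on the whole
  space, and the squared error is dominated by \<open>(u x)\<^sup>2\<close>.\<close>

lemma polygon_cutoff_dense:
  fixes u :: "'a::euclidean_space \<Rightarrow> real"
  assumes u: "square_integrable (polygon I n c) u" "continuous_on (polygon I n c) u"
    and I: "finite I" "I \<noteq> {}" and bd: "bounded (polygon I n c)" and e: "e > 0"
  obtains v where "continuous_on UNIV v"
    "(LINT x|lebesgue_on (polygon I n c). (u x - v x)\<^sup>2) < e"
proof -
  define \<Omega> where "\<Omega> = polygon I n c"
  define w where "w N x = (if x \<in> \<Omega> then polygon_cutoff I n c (real N) x * u x else 0)" for N x
  have ccut: "continuous_on A (polygon_cutoff I n c (real N))" for N A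
    by (rule continuous_on_GDERIV[OF GDERIV_polygon_cutoff[OF I(1)]])
  have cont: "continuous_on UNIV (w N)" if "N > 0" for N
  proof -
    have "real N > 0" using that by simp
    from polygon_cutoff_support[OF I(1) bd I(2) this]
    obtain K where K: "compact K" "K \<subseteq> \<Omega>" "\<And>x. x \<notin> K \<Longrightarrow> polygon_cutoff I n c (real N) x = 0"
      unfolding \<Omega>_def by blast
    have "continuous_on \<Omega> (\<lambda>x. polygon_cutoff I n c (real N) x * u x)"
      using u(2) by (intro continuous_intros ccut) (simp add: \<Omega>_def)
    then have "continuous_on \<Omega> (w N)"
      by (rule continuous_on_eq) (simp add: w_def)
    moreover have "continuous_on (- K) (w N)"
      by (rule continuous_on_eq[OF continuous_on_const[of _ 0]]) (simp add: w_def K(3))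
    moreover have "open \<Omega>" "open (- K)"
      using open_polygon[OF I(1)] K(1) by (auto simp: \<Omega>_def compact_imp_closed)
    ultimately have "continuous_on (\<Omega> \<union> - K) (w N)"
      by (intro continuous_on_open_Un)
    moreover have "\<Omega> \<union> - K = UNIV" using K(2) by auto
    ultimately show ?thesis by simp
  qed
  have leb: "\<Omega> \<in> sets lebesgue" unfolding \<Omega>_def by (rule polygon_sets[OF I(1)])
  have u2: "integrable (lebesgue_on \<Omega>) (\<lambda>x. (u x)\<^sup>2)" and um: "u \<in> borel_measurable (lebesgue_on \<Omega>)"
    using u(1) by (auto simp: square_integrable_def \<Omega>_def)
  have "(\<lambda>N. LINT x|lebesgue_on \<Omega>. (u x - w (Suc N) x)\<^sup>2) \<longlonglongrightarrow> (LINT x|lebesgue_on \<Omega>. 0)"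
  proof (rule integral_dominated_convergence[where w = "\<lambda>x. (u x)\<^sup>2"])
    have "w (Suc N) \<in> borel_measurable (lebesgue_on \<Omega>)" for N
      using cont[of "Suc N"] bd leb by (intro borel_measurable_integrable integrable_lebesgue_on_continuous) (auto simp: \<Omega>_def)
    then show "(\<lambda>x. (u x - w (Suc N) x)\<^sup>2) \<in> borel_measurable (lebesgue_on \<Omega>)" for N
      using um by measurable
    show "AE x in lebesgue_on \<Omega>. (\<lambda>N. (u x - w (Suc N) x)\<^sup>2) \<longlonglongrightarrow> 0"
    proof (rule AE_I2)
      fix x assume "x \<in> space (lebesgue_on \<Omega>)"
      then have x: "x \<in> \<Omega>" by simp
      then have "(\<lambda>N. polygon_cutoff I n c (real N) x) \<longlonglongrightarrow> 1"
        unfolding \<Omega>_def by (rule polygon_cutoff_tendsto)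
      then have "(\<lambda>N. (u x - polygon_cutoff I n c (real N) x * u x)\<^sup>2) \<longlonglongrightarrow> (u x - 1 * u x)\<^sup>2"
        by (intro tendsto_intros)
      then have "(\<lambda>N. (u x - w N x)\<^sup>2) \<longlonglongrightarrow> 0"
        using x by (simp add: w_def)
      then show "(\<lambda>N. (u x - w (Suc N) x)\<^sup>2) \<longlonglongrightarrow> 0"
        by (rule LIMSEQ_Suc)
    qed
    show "AE x in lebesgue_on \<Omega>. norm ((u x - w (Suc N) x)\<^sup>2) \<le> (u x)\<^sup>2" for N
    proof (rule AE_I2)
      fix x assume "x \<in> space (lebesgue_on \<Omega>)"
      then have "u x - w (Suc N) x = (1 - polygon_cutoff I n c (real (Suc N)) x) * u x"
        by (simp add: w_def algebra_simps)
      moreover have "(1 - polygon_cutoff I n c (real (Suc N)) x)\<^sup>2 \<le> 1"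
        using polygon_cutoff_bounds[of I n c "real (Suc N)" x] by (intro power_le_one) auto
      ultimately show "norm ((u x - w (Suc N) x)\<^sup>2) \<le> (u x)\<^sup>2"
        by (simp add: power_mult_distrib mult_left_le_one_le)
    qed
  qed (use u2 in auto)
  then have "\<forall>\<^sub>F N in sequentially. (LINT x|lebesgue_on \<Omega>. (u x - w (Suc N) x)\<^sup>2) < e"
    using e by (simp add: order_tendstoD)
  then obtain N where "(LINT x|lebesgue_on \<Omega>. (u x - w (Suc N) x)\<^sup>2) < e"
    by (auto simp: eventually_sequentially)
  then show ?thesis
    using that[of "w (Suc N)"] cont[of "Suc N"] by (simp add: \<Omega>_def)
qed

text \<open>For \<open>p = \<Sum>a. r a * a\<close> in the span of the modes, the field \<open>W = \<Sum>a. (r a / l a) * grad a\<close> satisfies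
  \<open>\<integral>g \<bullet> W = \<integral>u p\<close> and \<open>L \<integral>|W|\<^sup>2 \<le> \<integral>p\<^sup>2\<close>; expanding \<open>|g - W|\<^sup>2 \<ge> 0\<close> and letting \<open>p\<close> tend to \<open>L u\<close> gives
  the claim. Constant modes have \<open>l a = 0\<close> and drop out of \<open>W\<close> because \<open>r a / 0 = 0\<close>.\<close>

theorem Poincare_polygon:
  fixes u :: "'a::euclidean_space \<Rightarrow> real"
  assumes I: "finite I" "I \<noteq> {}" "\<And>i. i \<in> I \<Longrightarrow> n i \<noteq> 0" and bd: "bounded (polygon I n c)"
    and L: "L > 0"
    and M: "\<And>f. f \<in> M \<Longrightarrow> \<exists>l D. polygon_mode I n c l f D \<and> (l \<ge> L \<or> l = 0 \<and> (\<exists>k. \<forall>x. f x = k))"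
    and dense: "\<And>v e. continuous_on (closure (polygon I n c)) v \<Longrightarrow> e > 0 \<Longrightarrow>
        \<exists>p\<in>funs.span M. \<forall>x\<in>closure (polygon I n c). \<bar>v x - p x\<bar> < e"
    and u: "H1 (polygon I n c) u g" "continuous_on (polygon I n c) u"
    and mean: "(LINT x|lebesgue_on (polygon I n c). u x) = 0"
  shows "L * (LINT x|lebesgue_on (polygon I n c). (u x)\<^sup>2) \<le> (LINT x|lebesgue_on (polygon I n c). (norm (g x))\<^sup>2)"
proof -
  define \<Omega> where "\<Omega> = polygon I n c"
  define J where "J f = (LINT x|lebesgue_on \<Omega>. f x)" for f :: "'a \<Rightarrow> real"
  have leb: "\<Omega> \<in> sets lebesgue" unfolding \<Omega>_def by (rule polygon_sets[OF I(1)])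
  have bd': "bounded \<Omega>" using bd by (simp add: \<Omega>_def)
  have su: "square_integrable \<Omega> u" and sg: "square_integrable \<Omega> g"
    using u by (auto simp: H1_def \<Omega>_def)
  obtain l D where m: "\<And>f. f \<in> M \<Longrightarrow> polygon_mode I n c (l f) f (D f)"
    and l: "\<And>f. f \<in> M \<Longrightarrow> l f \<ge> L \<or> l f = 0 \<and> (\<exists>k. \<forall>x. f x = k)"
    using M by metis
  have key: "2 * J (\<lambda>x. u x * p x) \<le> J (\<lambda>x. (norm (g x))\<^sup>2) + J (\<lambda>x. (p x)\<^sup>2) / L"
    and sp: "square_integrable \<Omega> p" if p: "p \<in> funs.span M" for p
  proof -
    obtain t r where t: "finite t" "t \<subseteq> M" and p_eq: "p = (\<Sum>a\<in>t. (\<lambda>x. r a * a x))"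
      using p unfolding funs.span_explicit by blast
    have p_eq: "p x = (\<Sum>a\<in>t. r a * a x)" for x
      unfolding p_eq by (induction t rule: infinite_finite_induct) auto
    define f where "f a x = r a * a x" for a :: "'a \<Rightarrow> real" and x
    have sa: "square_integrable \<Omega> a" "square_integrable \<Omega> (D a)" if "a \<in> t" for a
      using m[of a] that t(2) polygon_mode_H1[OF _ I(1) bd] unfolding H1_def \<Omega>_def by blast+
    then have sf: "square_integrable \<Omega> (f a)" if "a \<in> t" for a
      using that unfolding f_def[abs_def] by (intro square_integrable_cmult)
    show sp: "square_integrable \<Omega> p"
      using square_integrable_sum[OF t(1) sf] by (simp add: p_eq[abs_def] f_def)
    define W where "W x = (\<Sum>a\<in>t. (r a / l a) *\<^sub>R D a x)" for x
    have sW: "square_integrable \<Omega> W"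
      unfolding W_def[abs_def] by (intro square_integrable_sum t square_integrable_scaleR sa)
    define G where "G a b = J (\<lambda>x. f a x * f b x)" for a b
    have green: "J (\<lambda>x. h x \<bullet> D a x) = l a * J (\<lambda>x. v x * a x)" if "H1 \<Omega> v h" "a \<in> t" for v h a
      using polygon_mode_Green[OF m I bd, of a] that t(2) unfolding J_def \<Omega>_def by blast
    have gW: "J (\<lambda>x. g x \<bullet> W x) = J (\<lambda>x. u x * p x)"
    proof -
      have "J (\<lambda>x. g x \<bullet> W x) = J (\<lambda>x. \<Sum>a\<in>t. (r a / l a) * (g x \<bullet> D a x))"
        by (simp add: W_def inner_sum_right)
      also have "\<dots> = (\<Sum>a\<in>t. (r a / l a) * J (\<lambda>x. g x \<bullet> D a x))"
        unfolding J_def by (subst Bochner_Integration.integral_sum)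
          (auto intro!: square_integrable_inner sg sa integrable_mult_right)
      also have "\<dots> = (\<Sum>a\<in>t. r a * J (\<lambda>x. u x * a x))"
      proof (rule sum.cong[OF refl])
        fix a assume a: "a \<in> t"
        have "J (\<lambda>x. g x \<bullet> D a x) = l a * J (\<lambda>x. u x * a x)"
          using u(1) a by (intro green) (simp_all add: \<Omega>_def)
        \<comment> \<open>Here the mean zero hypothesis enters: a constant mode pairs to 0 with
          \<open>u\<close>, so its absence from \<open>W\<close> does no harm.\<close>
        moreover have "J (\<lambda>x. u x * a x) = 0" if "l a = 0"
        proof -
          have "a \<in> M" using a t(2) by blast
          then have "\<exists>k. \<forall>x. a x = k" using l[of a] L that by simp
          then obtain k where k: "\<And>x. a x = k" by blast
          show ?thesis unfolding k using mean by (simp add: J_def \<Omega>_def)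
        qed
        ultimately show "r a / l a * J (\<lambda>x. g x \<bullet> D a x) = r a * J (\<lambda>x. u x * a x)"
          by (cases "l a = 0") auto
      qed
      also have "\<dots> = J (\<lambda>x. \<Sum>a\<in>t. r a * (u x * a x))"
        unfolding J_def by (subst Bochner_Integration.integral_sum)
          (auto intro!: square_integrable_mult su sa integrable_mult_right)
      also have "\<dots> = J (\<lambda>x. u x * p x)"
        by (simp add: p_eq sum_distrib_left mult_ac)
      finally show ?thesis .
    qed
    have orth: "G a b = 0" if "a \<in> t" "b \<in> t" "l a \<noteq> l b" for a b
    proof -
      have "J (\<lambda>x. a x * b x) = 0"
        using polygon_mode_orthogonal[OF m m that(3) I bd] that t(2) unfolding J_def \<Omega>_def by blast
      moreover have "G a b = r a * r b * J (\<lambda>x. a x * b x)"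
        unfolding G_def f_def J_def integral_mult_right_zero[symmetric] by (simp add: mult_ac)
      ultimately show ?thesis by simp
    qed
    have WW: "J (\<lambda>x. W x \<bullet> W x) = (\<Sum>a\<in>t. \<Sum>b\<in>t. G a b / l b)"
    proof -
      have "J (\<lambda>x. W x \<bullet> W x) = J (\<lambda>x. \<Sum>a\<in>t. \<Sum>b\<in>t. (r a / l a) * (r b / l b) * (D b x \<bullet> D a x))"
        by (simp add: W_def inner_sum_right inner_sum_left sum_distrib_left mult_ac)
      also have "\<dots> = (\<Sum>a\<in>t. \<Sum>b\<in>t. (r a / l a) * (r b / l b) * J (\<lambda>x. D b x \<bullet> D a x))"
        unfolding J_def
        by (simp add: Bochner_Integration.integral_sum square_integrable_inner sa)
      also have "\<dots> = (\<Sum>a\<in>t. \<Sum>b\<in>t. G a b / l b)"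
      proof (intro sum.cong refl)
        fix a b assume ab: "a \<in> t" "b \<in> t"
        have "H1 \<Omega> b (D b)"
          using polygon_mode_H1[OF m I(1) bd, of b] ab t(2) by (auto simp: \<Omega>_def)
        then have 1: "J (\<lambda>x. D b x \<bullet> D a x) = l a * J (\<lambda>x. b x * a x)"
          using ab by (intro green)
        have 2: "G a b = r a * r b * J (\<lambda>x. b x * a x)"
          unfolding G_def f_def J_def integral_mult_right_zero[symmetric] by (simp add: mult_ac)
        show "(r a / l a) * (r b / l b) * J (\<lambda>x. D b x \<bullet> D a x) = G a b / l b"
        \<comment> \<open>For \<open>l a = 0\<close> the left side is 0 by division by zero. The
          right side is 0 by the same convention if \<open>l b = 0\<close>, and by orthogonality
          otherwise.\<close>
        proof (cases "l a = 0")
          case True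
          then show ?thesis using orth[OF ab] by (cases "l b = 0") auto
        next
          case False
          then show ?thesis by (simp add: 1 2)
        qed
      qed
      finally show ?thesis .
    qed
    have pp: "J (\<lambda>x. (p x)\<^sup>2) = (\<Sum>a\<in>t. \<Sum>b\<in>t. G a b)"
    proof -
      have "J (\<lambda>x. (p x)\<^sup>2) = J (\<lambda>x. \<Sum>a\<in>t. \<Sum>b\<in>t. f a x * f b x)"
        by (simp add: p_eq f_def power2_eq_square sum_product)
      also have "\<dots> = (\<Sum>a\<in>t. \<Sum>b\<in>t. G a b)"
        unfolding J_def G_def
        by (simp add: Bochner_Integration.integral_sum square_integrable_mult sf)
      finally show ?thesis .
    qed
    have "0 \<le> (\<Sum>a\<in>t. \<Sum>b\<in>t. (1 - L / l b) * G a b)"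
      unfolding G_def J_def
    proof (rule weighted_gram_nonneg[OF t(1) sf])
      \<comment> \<open>A constant mode has \<open>L / l b = 0\<close> and hence weight 1; for the
        others \<open>l b \<ge> L\<close>.\<close>
      show "0 \<le> 1 - L / l b" if "b \<in> t" for b
        using l[of b] that t(2) L by (auto simp: divide_le_eq_1)
      show "(LINT x|lebesgue_on \<Omega>. f a x * f b x) = 0" if "a \<in> t" "b \<in> t" "1 - L / l a \<noteq> 1 - L / l b" for a b
        using orth[of a b] that unfolding G_def J_def by auto
    qed
    also have "\<dots> = J (\<lambda>x. (p x)\<^sup>2) - L * J (\<lambda>x. W x \<bullet> W x)"
      by (simp add: pp WW algebra_simps sum_subtractf sum_distrib_left)
    finally have "J (\<lambda>x. W x \<bullet> W x) \<le> J (\<lambda>x. (p x)\<^sup>2) / L"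
      using L by (simp add: field_simps)
    moreover have "0 \<le> J (\<lambda>x. (norm (g x - W x))\<^sup>2)"
      unfolding J_def by (intro integral_nonneg_AE) auto
    moreover have "J (\<lambda>x. (norm (g x - W x))\<^sup>2) = J (\<lambda>x. (norm (g x))\<^sup>2 - 2 * (g x \<bullet> W x) + W x \<bullet> W x)"
      by (simp add: power2_norm_eq_inner inner_diff_left inner_diff_right inner_commute algebra_simps)
    moreover have "\<dots> = J (\<lambda>x. (norm (g x))\<^sup>2) - 2 * J (\<lambda>x. g x \<bullet> W x) + J (\<lambda>x. W x \<bullet> W x)"
      using square_integrable_inner[OF sg sW] square_integrable_inner[OF sW sW] sg
      unfolding J_def by (simp add: square_integrable_def)
    ultimately show "2 * J (\<lambda>x. u x * p x) \<le> J (\<lambda>x. (norm (g x))\<^sup>2) + J (\<lambda>x. (p x)\<^sup>2) / L"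
      using gW by linarith
  qed
  define V where "V = measure lebesgue \<Omega>"
  have V: "J (\<lambda>x. k) = V * k" for k
    using leb by (simp add: J_def V_def measure_restrict_space space_restrict_space)
  have "L * J (\<lambda>x. (u x)\<^sup>2) \<le> J (\<lambda>x. (norm (g x))\<^sup>2) + e" if e: "e > 0" for e
  proof -
    \<comment> \<open>The approximation costs \<open>2 * d\<close> through \<open>v\<close> and
      \<open>2 * d\<close> through \<open>p\<close>; the final division by \<open>L\<close> turns
      \<open>4 * d\<close> into \<open>e\<close>.\<close>
    define d where "d = e * L / 4"
    have d: "d > 0" using e L by (simp add: d_def)
    obtain v where v: "continuous_on UNIV v" "J (\<lambda>x. (L * u x - v x)\<^sup>2) < d"
      using polygon_cutoff_dense[of I n c "\<lambda>x. L * u x" d] su u(2) I bd d square_integrable_cmult[OF su, of L]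
      unfolding J_def \<Omega>_def by (metis continuous_on_mult_left)
    \<comment> \<open>Chosen so that the constant \<open>s\<^sup>2\<close> integrates to at most
      \<open>d\<close>; the added 1 keeps the denominator positive.\<close>
    define s where "s = sqrt (d / (V + 1))"
    have V0: "V \<ge> 0" by (simp add: V_def)
    have s: "s > 0" "V * s\<^sup>2 \<le> d"
      using d V0 by (auto simp: s_def field_simps)
    obtain p where p: "p \<in> funs.span M" "\<And>x. x \<in> closure \<Omega> \<Longrightarrow> \<bar>v x - p x\<bar> < s"
      using dense[of v s] v(1) s(1) unfolding \<Omega>_def by (meson continuous_on_subset subset_UNIV)
    have sv: "square_integrable \<Omega> v"
      using square_integrable_continuous[OF bd' leb v(1)] .
    have slu: "square_integrable \<Omega> (\<lambda>x. L * u x)" by (rule square_integrable_cmult[OF su])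
    have i: "integrable (lebesgue_on \<Omega>) (\<lambda>x. (a x)\<^sup>2)" if "square_integrable \<Omega> a" for a :: "'a \<Rightarrow> real"
      using that by (simp add: square_integrable_def)
    have small: "J (\<lambda>x. (L * u x - p x)\<^sup>2) \<le> 4 * d"
    proof -
      have "J (\<lambda>x. (L * u x - p x)\<^sup>2) \<le> J (\<lambda>x. 2 * (L * u x - v x)\<^sup>2 + 2 * s\<^sup>2)"
        unfolding J_def
      proof (rule integral_mono)
        show "integrable (lebesgue_on \<Omega>) (\<lambda>x. (L * u x - p x)\<^sup>2)"
          by (intro i square_integrable_diff slu sp p)
        show "integrable (lebesgue_on \<Omega>) (\<lambda>x. 2 * (L * u x - v x)\<^sup>2 + 2 * s\<^sup>2)"
          by (intro Bochner_Integration.integrable_add integrable_mult_right i square_integrable_diff slu sv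
              integrable_lebesgue_on_continuous bd' leb continuous_on_const)
        fix x assume "x \<in> space (lebesgue_on \<Omega>)"
        then have "\<bar>v x - p x\<bar> \<le> s" using p(2)[of x] closure_subset by fastforce
        then have "(v x - p x)\<^sup>2 \<le> s\<^sup>2" by (rule abs_le_square_iff[THEN iffD1, of _ s, simplified abs_of_pos[OF s(1)]])
        moreover have "(L * u x - p x)\<^sup>2 \<le> 2 * (L * u x - v x)\<^sup>2 + 2 * (v x - p x)\<^sup>2"
        proof -
          have "2 * (L * u x - v x)\<^sup>2 + 2 * (v x - p x)\<^sup>2 - (L * u x - p x)\<^sup>2 = ((L * u x - v x) - (v x - p x))\<^sup>2"
            by (simp add: power2_eq_square algebra_simps)
          then show ?thesis by (metis diff_ge_0_iff_ge zero_le_power2)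
        qed
        ultimately show "(L * u x - p x)\<^sup>2 \<le> 2 * (L * u x - v x)\<^sup>2 + 2 * s\<^sup>2" by linarith
      qed
      also have "\<dots> = 2 * J (\<lambda>x. (L * u x - v x)\<^sup>2) + J (\<lambda>x. 2 * s\<^sup>2)"
        unfolding J_def using i[OF square_integrable_diff[OF slu sv]]
        by (subst Bochner_Integration.integral_add)
           (auto intro!: integrable_lebesgue_on_continuous bd' leb)
      also have "\<dots> \<le> 4 * d" using v(2) s(2) unfolding V by simp
      finally show ?thesis .
    qed
    have "J (\<lambda>x. (L * u x - p x)\<^sup>2) = J (\<lambda>x. L\<^sup>2 * (u x)\<^sup>2 - 2 * L * (u x * p x) + (p x)\<^sup>2)"
      by (simp add: power2_eq_square algebra_simps)
    also have "\<dots> = L\<^sup>2 * J (\<lambda>x. (u x)\<^sup>2) - 2 * L * J (\<lambda>x. u x * p x) + J (\<lambda>x. (p x)\<^sup>2)"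
      unfolding J_def using i[OF su] i[OF sp[OF p(1)]] square_integrable_mult[OF su sp[OF p(1)]] by simp
    finally have "L\<^sup>2 * J (\<lambda>x. (u x)\<^sup>2) \<le> 2 * L * J (\<lambda>x. u x * p x) - J (\<lambda>x. (p x)\<^sup>2) + 4 * d"
      using small by linarith
    then have "L\<^sup>2 * J (\<lambda>x. (u x)\<^sup>2) / L \<le> (2 * L * J (\<lambda>x. u x * p x) - J (\<lambda>x. (p x)\<^sup>2) + 4 * d) / L"
      using L by (intro divide_right_mono) auto
    then have "L * J (\<lambda>x. (u x)\<^sup>2) \<le> 2 * J (\<lambda>x. u x * p x) - J (\<lambda>x. (p x)\<^sup>2) / L + e"
      using L by (simp add: power2_eq_square add_divide_distrib diff_divide_distrib d_def)
    with key[OF p(1)] show ?thesis by linarith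
  qed
  then show ?thesis
    unfolding J_def \<Omega>_def by (rule field_le_epsilon)
qed

section \<open>Lattice waves on the equilateral triangle\<close>

lemma inner_vector_2: "vector [a, b] \<bullet> (x::real^2) = a * x$1 + b * x$2"
  by (simp add: inner_vec_def sum_2)

text \<open>The parameter \<open>s = \<plusminus>1\<close> selects the right or left half of the rhombus. The three angles sum to zero,
  and on the sides of the half \<open>a3 = a1\<close>, \<open>a1 = a2\<close> or \<open>a2 = a3 + 2 \<pi>\<close>: the closed half is the alcove
  \<open>a3 \<le> a1 \<le> a2 \<le> a3 + 2 \<pi>\<close>, and reflections in its sides permute the angles modulo \<open>2 \<pi>\<close>.\<close>

definition angle1 :: "real \<Rightarrow> real^2 \<Rightarrow> real" where
  "angle1 s x = 4 * pi / 3 * x$2"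

definition angle2 :: "real \<Rightarrow> real^2 \<Rightarrow> real" where
  "angle2 s x = pi - 2 * pi / sqrt 3 * s * x$1 - 2 * pi / 3 * x$2"

definition angle3 :: "real \<Rightarrow> real^2 \<Rightarrow> real" where
  "angle3 s x = 2 * pi / sqrt 3 * s * x$1 - 2 * pi / 3 * x$2 - pi"

text \<open>Since the angles sum to zero, adding the same integer to all three frequencies leaves
  the wave unchanged. This redundancy lets the reflections act by permuting frequencies.\<close>

definition lattice_wave :: "real \<Rightarrow> int \<Rightarrow> int \<Rightarrow> int \<Rightarrow> real^2 \<Rightarrow> complex" where
  "lattice_wave s k1 k2 k3 x = cis (k1 * angle1 s x + k2 * angle2 s x + k3 * angle3 s x)"

text \<open>All six permutations are summed, repetitions included, so that the product formula has
  no special cases.\<close>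

definition orbit_sum :: "real \<Rightarrow> int \<Rightarrow> int \<Rightarrow> int \<Rightarrow> real^2 \<Rightarrow> complex" where
  "orbit_sum s k1 k2 k3 x =
     lattice_wave s k1 k2 k3 x + lattice_wave s k2 k3 k1 x + lattice_wave s k3 k1 k2 x +
     lattice_wave s k2 k1 k3 x + lattice_wave s k1 k3 k2 x + lattice_wave s k3 k2 k1 x"

text \<open>The complex coefficient covers both real families: \<open>c = 1\<close> gives the real
  part and \<open>c = - \<i>\<close> the imaginary part of the orbit sum.\<close>

definition orbit_mode :: "real \<Rightarrow> complex \<Rightarrow> int \<Rightarrow> int \<Rightarrow> int \<Rightarrow> real^2 \<Rightarrow> real" where
  "orbit_mode s c k1 k2 k3 x = Re (c * orbit_sum s k1 k2 k3 x)"

text \<open>The squared length of the wave vector. The integer form is half the sum of the squared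
  differences of the frequencies, the norm form of the hexagonal lattice.\<close>

definition mode_eigenvalue :: "int \<Rightarrow> int \<Rightarrow> int \<Rightarrow> real" where
  "mode_eigenvalue k1 k2 k3 =
     16 * pi\<^sup>2 / 9 * of_int (k1 * k1 + k2 * k2 + k3 * k3 - k1 * k2 - k2 * k3 - k3 * k1)"

section \<open>The algebra of orbit sums\<close>

lemma lattice_wave_add:
  "lattice_wave s (k1 + l1) (k2 + l2) (k3 + l3) x = lattice_wave s k1 k2 k3 x * lattice_wave s l1 l2 l3 x"
  by (simp add: lattice_wave_def cis_mult algebra_simps)

text \<open>Of the 36 products of waves, each orbit sum on the right collects the six with the same
  relative permutation of the two triples.\<close>

lemma orbit_sum_mult:
  "orbit_sum s k1 k2 k3 x * orbit_sum s l1 l2 l3 x =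
     orbit_sum s (k1 + l1) (k2 + l2) (k3 + l3) x + orbit_sum s (k1 + l2) (k2 + l3) (k3 + l1) x +
     orbit_sum s (k1 + l3) (k2 + l1) (k3 + l2) x + orbit_sum s (k1 + l2) (k2 + l1) (k3 + l3) x +
     orbit_sum s (k1 + l1) (k2 + l3) (k3 + l2) x + orbit_sum s (k1 + l3) (k2 + l2) (k3 + l1) x"
  unfolding orbit_sum_def lattice_wave_add by (simp only: distrib_left distrib_right add_ac)

lemma cnj_orbit_sum: "cnj (orbit_sum s k1 k2 k3 x) = orbit_sum s (- k1) (- k2) (- k3) x"
  by (simp add: orbit_sum_def lattice_wave_def cis_cnj algebra_simps)

text \<open>\<open>Re z * Re w\<close> is half of \<open>Re (z * w) + Re (z * cnj w)\<close>, and
  conjugation negates the frequencies of an orbit sum. Products of modes therefore stay in their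
  span.\<close>

lemma orbit_mode_mult:
  "orbit_mode s c k1 k2 k3 x * orbit_mode s d l1 l2 l3 x =
     (\<Sum>(a, m1, m2, m3)\<leftarrow>[(c * d / 2, l1, l2, l3), (c * cnj d / 2, - l1, - l2, - l3)].
       orbit_mode s a (k1 + m1) (k2 + m2) (k3 + m3) x + orbit_mode s a (k1 + m2) (k2 + m3) (k3 + m1) x +
       orbit_mode s a (k1 + m3) (k2 + m1) (k3 + m2) x + orbit_mode s a (k1 + m2) (k2 + m1) (k3 + m3) x +
       orbit_mode s a (k1 + m1) (k2 + m3) (k3 + m2) x + orbit_mode s a (k1 + m3) (k2 + m2) (k3 + m1) x)"
proof -
  have "Re z * Re w = Re (z * w / 2) + Re (z * cnj w / 2)" for z w
    by (simp add: field_simps)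
  from this[of "c * orbit_sum s k1 k2 k3 x" "d * orbit_sum s l1 l2 l3 x"]
  have "orbit_mode s c k1 k2 k3 x * orbit_mode s d l1 l2 l3 x =
      Re (c * d / 2 * (orbit_sum s k1 k2 k3 x * orbit_sum s l1 l2 l3 x)) +
      Re (c * cnj d / 2 * (orbit_sum s k1 k2 k3 x * orbit_sum s (- l1) (- l2) (- l3) x))"
    by (simp only: orbit_mode_def complex_cnj_mult cnj_orbit_sum) (simp only: mult_ac times_divide_eq_right times_divide_eq_left)
  then show ?thesis
    unfolding orbit_sum_mult
    by (simp only: distrib_left plus_complex.sel orbit_mode_def[symmetric] list.map sum_list.Cons sum_list.Nil prod.case add_0_right)
qed

section \<open>Orbit modes as Neumann modes of a half rhombus\<close>

lemma helmholtz_lattice_wave: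
  assumes s: "s = 1 \<or> s = -1"
  shows "\<exists>D. helmholtz (mode_eigenvalue k1 k2 k3) (\<lambda>x. Re (c * lattice_wave s k1 k2 k3 x)) D"
proof -
  \<comment> \<open>\<open>K\<close> and \<open>b\<close> are the linear and the constant part of
    the phase; \<open>K \<bullet> K\<close> will be the eigenvalue.\<close>
  define K :: "real^2" where
    "K = vector [(k3 - k2) * (2 * pi / sqrt 3 * s), k1 * (4 * pi / 3) - (k2 + k3) * (2 * pi / 3)]"
  define b where "b = (k2 - k3) * pi"
  have arg: "k1 * angle1 s x + k2 * angle2 s x + k3 * angle3 s x = K \<bullet> x + b" for x
    by (simp add: K_def b_def inner_vector_2 angle1_def angle2_def angle3_def algebra_simps)
  have c: "c = cmod c * cis (Arg c)"
    using rcis_cmod_Arg[of c] by (simp add: rcis_def)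
  have eq: "Re (c * lattice_wave s k1 k2 k3 x) = cmod c * cos (K \<bullet> x + (b + Arg c))" for x
    unfolding lattice_wave_def arg by (subst c) (simp add: mult.assoc cis_mult add_ac del: rcis_cmod_Arg)
  have ss: "s * s = 1" using s by auto
  have "K \<bullet> K = ((k3 - k2) * (2 * pi / sqrt 3 * s))\<^sup>2 + (k1 * (4 * pi / 3) - (k2 + k3) * (2 * pi / 3))\<^sup>2"
    by (simp add: K_def inner_vector_2 power2_eq_square)
  also have "\<dots> = (k3 - k2)\<^sup>2 * (4 * pi\<^sup>2 / 3) + (2 * k1 - (k2 + k3))\<^sup>2 * (4 * pi\<^sup>2 / 9)"
    using ss by (simp add: power_mult_distrib power_divide power2_eq_square[of s]) (simp add: power2_eq_square field_simps)
  also have "\<dots> = mode_eigenvalue k1 k2 k3"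
    by (simp add: mode_eigenvalue_def power2_eq_square field_simps)
  finally have "K \<bullet> K = mode_eigenvalue k1 k2 k3" .
  with helmholtz_wave[of K "cmod c" "b + Arg c"] show ?thesis
    unfolding eq by auto
qed

lemma helmholtz_orbit_mode:
  assumes s: "s = 1 \<or> s = -1"
  shows "\<exists>D. helmholtz (mode_eigenvalue k1 k2 k3) (orbit_mode s c k1 k2 k3) D"
proof -
  have sym: "mode_eigenvalue k2 k3 k1 = mode_eigenvalue k1 k2 k3" "mode_eigenvalue k3 k1 k2 = mode_eigenvalue k1 k2 k3"
    "mode_eigenvalue k2 k1 k3 = mode_eigenvalue k1 k2 k3" "mode_eigenvalue k1 k3 k2 = mode_eigenvalue k1 k2 k3"
    "mode_eigenvalue k3 k2 k1 = mode_eigenvalue k1 k2 k3"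
    by (simp_all add: mode_eigenvalue_def algebra_simps)
  have add: "\<exists>D. helmholtz l (\<lambda>x. f x + g x) D" if "\<exists>D. helmholtz l f D" "\<exists>D. helmholtz l g D"
    for l and f g :: "real^2 \<Rightarrow> real"
    using that helmholtz_add by blast
  note w = helmholtz_lattice_wave[OF s, of _ _ _ c]
  show ?thesis
    unfolding orbit_mode_def[abs_def] orbit_sum_def distrib_left plus_complex.sel
    by (intro add w w[of k2 k3 k1, unfolded sym] w[of k3 k1 k2, unfolded sym] w[of k2 k1 k3, unfolded sym]
        w[of k1 k3 k2, unfolded sym] w[of k3 k2 k1, unfolded sym])
qed

text \<open>The form takes integer values and is half a sum of squares: either it is at least 1, or
  all differences of frequencies vanish. The spectral gap is thus the value 1 of the form.\<close>

lemma mode_eigenvalue_cases: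
  "mode_eigenvalue k1 k2 k3 \<ge> 16 * pi\<^sup>2 / 9 \<or> k1 = k2 \<and> k2 = k3"
proof -
  define q where "q = k1 * k1 + k2 * k2 + k3 * k3 - k1 * k2 - k2 * k3 - k3 * k1"
  have q2: "2 * q = (k1 - k2)\<^sup>2 + (k2 - k3)\<^sup>2 + (k3 - k1)\<^sup>2"
    by (simp add: q_def power2_eq_square algebra_simps)
  show ?thesis
  proof (cases "q \<ge> 1")
    case True
    then have "16 * pi\<^sup>2 / 9 * 1 \<le> 16 * pi\<^sup>2 / 9 * of_int q"
      by (intro mult_left_mono) auto
    then show ?thesis by (simp add: mode_eigenvalue_def q_def)
  next
    case False
    then have "(k1 - k2)\<^sup>2 + (k2 - k3)\<^sup>2 + (k3 - k1)\<^sup>2 \<le> 0" using q2 by linarith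
    then have "(k1 - k2)\<^sup>2 = 0" "(k2 - k3)\<^sup>2 = 0"
      using zero_le_power2[of "k1 - k2"] zero_le_power2[of "k2 - k3"] zero_le_power2[of "k3 - k1"] by linarith+
    then show ?thesis by simp
  qed
qed

lemma orbit_mode_const: "orbit_mode s c k k k x = 6 * Re c"
proof -
  have "k * angle1 s x + k * angle2 s x + k * angle3 s x = 0"
    by (simp add: angle1_def angle2_def angle3_def algebra_simps)
  then show ?thesis
    by (simp add: orbit_mode_def orbit_sum_def lattice_wave_def)
qed

text \<open>Side 0 is the short diagonal, along which the rhombus is cut; sides 1 and 2 are the
  rhombus sides in the half-plane \<open>s * x$1 > 0\<close>.\<close>

definition triangle_normal :: "real \<Rightarrow> nat \<Rightarrow> real^2" where
  "triangle_normal s i = (if i = 0 then vector [- s, 0] else if i = 1 then vector [s / sqrt 3, 1]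
     else vector [s / sqrt 3, -1])"

definition triangle_offset :: "nat \<Rightarrow> real" where
  "triangle_offset i = (if i = 0 then 0 else 1 / 2)"

definition rhombus_half :: "real \<Rightarrow> (real^2) set" where
  "rhombus_half s = polygon {0, 1, 2} (triangle_normal s) triangle_offset"

lemma sqrt_3_mult_sqrt_3: "sqrt 3 * (sqrt 3 * z) = 3 * z"
  by (simp add: mult.assoc[symmetric])

lemma mirror_coordinates:
  fixes x :: "real^2"
  shows "mirror (vector [a, b]) c x =
     vector [x$1 - 2 * (a * x$1 + b * x$2 - c) / (a * a + b * b) * a, x$2 - 2 * (a * x$1 + b * x$2 - c) / (a * a + b * b) * b]"
  by (simp add: vec_eq_iff forall_2 mirror_def inner_vector_2)

lemma angles_mirror_0:
  assumes s: "s = 1 \<or> s = -1"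
  shows "angle1 s (mirror (vector [- s, 0]) 0 x) = angle1 s x"
    "angle2 s (mirror (vector [- s, 0]) 0 x) = angle3 s x + 2 * pi"
    "angle3 s (mirror (vector [- s, 0]) 0 x) = angle2 s x - 2 * pi"
  using s by (auto simp: mirror_coordinates angle1_def angle2_def angle3_def)

lemma angles_mirror_1:
  assumes s: "s = 1 \<or> s = -1"
  shows "angle1 s (mirror (vector [s / sqrt 3, 1]) (1 / 2) x) = angle2 s x"
    "angle2 s (mirror (vector [s / sqrt 3, 1]) (1 / 2) x) = angle1 s x"
    "angle3 s (mirror (vector [s / sqrt 3, 1]) (1 / 2) x) = angle3 s x"
  using s by (auto simp: mirror_coordinates angle1_def angle2_def angle3_def field_simps sqrt_3_mult_sqrt_3)

lemma angles_mirror_2: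
  assumes s: "s = 1 \<or> s = -1"
  shows "angle1 s (mirror (vector [s / sqrt 3, -1]) (1 / 2) x) = angle3 s x"
    "angle2 s (mirror (vector [s / sqrt 3, -1]) (1 / 2) x) = angle2 s x"
    "angle3 s (mirror (vector [s / sqrt 3, -1]) (1 / 2) x) = angle1 s x"
  using s by (auto simp: mirror_coordinates angle1_def angle2_def angle3_def field_simps sqrt_3_mult_sqrt_3)

text \<open>Exchanging two angles amounts to exchanging two frequencies. For the short diagonal
  there are also shifts by \<open>2 * pi\<close>, invisible to \<open>cis\<close> because the
  frequencies are integers.\<close>

lemma lattice_wave_mirror:
  assumes s: "s = 1 \<or> s = -1"
  shows "lattice_wave s k1 k2 k3 (mirror (vector [- s, 0]) 0 x) = lattice_wave s k1 k3 k2 x"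
    "lattice_wave s k1 k2 k3 (mirror (vector [s / sqrt 3, 1]) (1 / 2) x) = lattice_wave s k2 k1 k3 x"
    "lattice_wave s k1 k2 k3 (mirror (vector [s / sqrt 3, -1]) (1 / 2) x) = lattice_wave s k3 k2 k1 x"
proof -
  have "k1 * angle1 s x + k2 * (angle3 s x + 2 * pi) + k3 * (angle2 s x - 2 * pi) =
      (k1 * angle1 s x + k3 * angle2 s x + k2 * angle3 s x) + 2 * pi * of_int (k2 - k3)"
    by (simp add: algebra_simps)
  moreover have "cis (2 * pi * of_int (k2 - k3)) = 1"
    by (rule cis_multiple_2pi) simp
  ultimately show "lattice_wave s k1 k2 k3 (mirror (vector [- s, 0]) 0 x) = lattice_wave s k1 k3 k2 x"
    by (simp only: lattice_wave_def angles_mirror_0[OF s] cis_mult[symmetric]) simp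
qed (simp_all only: lattice_wave_def angles_mirror_1[OF s] angles_mirror_2[OF s] add_ac)

lemma orbit_mode_mirror:
  assumes s: "s = 1 \<or> s = -1"
  shows "orbit_mode s c k1 k2 k3 (mirror (vector [- s, 0]) 0 x) = orbit_mode s c k1 k2 k3 x"
    "orbit_mode s c k1 k2 k3 (mirror (vector [s / sqrt 3, 1]) (1 / 2) x) = orbit_mode s c k1 k2 k3 x"
    "orbit_mode s c k1 k2 k3 (mirror (vector [s / sqrt 3, -1]) (1 / 2) x) = orbit_mode s c k1 k2 k3 x"
  by (simp_all only: orbit_mode_def orbit_sum_def lattice_wave_mirror[OF s] add_ac)

lemma rhombus_half_mode:
  assumes s: "s = 1 \<or> s = -1"
  shows "\<exists>D. polygon_mode {0, 1, 2} (triangle_normal s) triangle_offset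
      (mode_eigenvalue k1 k2 k3) (orbit_mode s c k1 k2 k3) D"
  using helmholtz_orbit_mode[OF s, of k1 k2 k3 c] orbit_mode_mirror[OF s, of c k1 k2 k3]
  by (auto simp: polygon_mode_def triangle_normal_def triangle_offset_def)


text \<open>Permutations and translations by \<open>2 * pi\<close> times integer vectors of sum zero
  form the affine reflection group, and its closed alcove meets each orbit only once. The proof
  bounds the translations and checks the finitely many cases.\<close>

lemma alcove_translate:
  fixes a1 a2 a3 b1 b2 b3 c1 c2 c3 :: real and n1 n2 n3 :: int
  assumes a: "a1 + a2 + a3 = 0" "a3 \<le> a1" "a1 \<le> a2" "a2 \<le> a3 + 2 * pi"
    and b: "b1 + b2 + b3 = 0" "b3 \<le> b1" "b1 \<le> b2" "b2 \<le> b3 + 2 * pi"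
    and c: "b1 = c1 + 2 * pi * n1" "b2 = c2 + 2 * pi * n2" "b3 = c3 + 2 * pi * n3"
    and perm: "(c1, c2, c3) \<in> {(a1, a2, a3), (a1, a3, a2), (a2, a1, a3), (a2, a3, a1), (a3, a1, a2), (a3, a2, a1)}"
  shows "a1 = b1 \<and> a2 = b2 \<and> a3 = b3"
proof -
  have pos: "pi > 0" by simp
  have sum: "c1 + c2 + c3 = 0" using perm a(1) by auto
  have "2 * pi * of_int (n1 + n2 + n3) = 0"
    using b(1) c sum by (simp add: algebra_simps)
  then have n: "n1 + n2 + n3 = 0" by simp
  \<comment> \<open>The extreme values occur at vertices of the alcove. Two such angles differ by at
    most \<open>8 * pi / 3\<close>, less than \<open>4 * pi\<close>, so a translation number is at
    most 1 in modulus.\<close>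
  have cb: "- (4 * pi / 3) \<le> c1" "c1 \<le> 4 * pi / 3" "- (4 * pi / 3) \<le> c2" "c2 \<le> 4 * pi / 3"
    "- (4 * pi / 3) \<le> c3" "c3 \<le> 4 * pi / 3"
    using perm a by auto
  have small: "n \<in> {-1, 0, 1}" if "y = x + 2 * pi * of_int n" "- (4 * pi / 3) \<le> x" "x \<le> 4 * pi / 3"
    "- (4 * pi / 3) \<le> y" "y \<le> 4 * pi / 3" for x y :: real and n :: int
  proof -
    have "pi * of_int n < pi * 2" "pi * (- 2) < pi * of_int n" using that pos by linarith+
    then have "of_int n < (2::real)" "(- 2::real) < of_int n"
      using pos by (simp_all only: mult_less_cancel_left_pos)
    then have "n < 2" "-2 < n" by linarith+
    then show ?thesis by auto
  qed
  have n1: "n1 \<in> {-1, 0, 1}" and n2: "n2 \<in> {-1, 0, 1}"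
    using small[OF c(1) cb(1,2)] small[OF c(2) cb(3,4)] b by auto
  have n3: "n3 = - n1 - n2" using n by linarith
  \<comment> \<open>Six permutations and nine choices of \<open>n1\<close>, \<open>n2\<close>
    remain, each a linear problem.\<close>
  show ?thesis
    using perm n1 n2 unfolding insert_iff empty_iff prod.inject
    by (elim disjE conjE FalseE; use a b c pos n3 in simp; linarith)
qed

lemma cis_eq_cisD:
  assumes "cis b = cis a"
  obtains n :: int where "b = a + 2 * pi * n"
  using assms sin_cos_eq_iff[of b a] by (auto simp: complex_eq_iff)

text \<open>The sum determines the other symmetric functions of three unit complex numbers with
  product 1, hence the three numbers themselves up to order.\<close>

lemma sum_cis_inj_on_alcove:
  fixes a1 a2 a3 b1 b2 b3 :: real
  assumes a: "a1 + a2 + a3 = 0" "a3 \<le> a1" "a1 \<le> a2" "a2 \<le> a3 + 2 * pi"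
    and b: "b1 + b2 + b3 = 0" "b3 \<le> b1" "b1 \<le> b2" "b2 \<le> b3 + 2 * pi"
    and eq: "cis a1 + cis a2 + cis a3 = cis b1 + cis b2 + cis b3"
  shows "a1 = b1 \<and> a2 = b2 \<and> a3 = b3"
proof -
  have prod: "cis x * cis y * cis z = 1" if "x + y + z = 0" for x y z
    using that by (simp add: cis_mult)
  \<comment> \<open>Because the angles sum to zero, the product of two of the numbers is the
    conjugate of the third.\<close>
  have pairs: "cis x * cis y + cis y * cis z + cis z * cis x = cnj (cis x + cis y + cis z)"
    if "x + y + z = 0" for x y z
  proof -
    have "x + y = - z" "y + z = - x" "z + x = - y" using that by linarith+
    then show ?thesis unfolding cis_mult by (simp only: complex_cnj_add cis_cnj add_ac)
  qed
  define p where "p = cis a1" define q where "q = cis a2" define r where "r = cis a3"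
  define p' where "p' = cis b1" define q' where "q' = cis b2" define r' where "r' = cis b3"
  have e1: "p + q + r = p' + q' + r'" using eq by (simp add: p_def q_def r_def p'_def q'_def r'_def)
  have e2: "p * q + q * r + r * p = p' * q' + q' * r' + r' * p'"
    unfolding p_def q_def r_def p'_def q'_def r'_def pairs[OF a(1)] pairs[OF b(1)] eq ..
  have e3: "p * q * r = p' * q' * r'"
    unfolding p_def q_def r_def p'_def q'_def r'_def prod[OF a(1)] prod[OF b(1)] ..
  have two: "x' = x \<and> y' = y \<or> x' = y \<and> y' = x" if "x + y = x' + y'" "x * y = x' * y'" for x y x' y' :: complex
  proof -
    have "(x' - x) * (x' - y) = x' * x' - (x + y) * x' + x * y" by (simp add: algebra_simps)
    also have "\<dots> = 0" unfolding that by (simp add: algebra_simps)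
    finally show ?thesis using that(1) by auto
  qed
  have nz: "p' \<noteq> 0" by (simp add: p'_def)
  \<comment> \<open>\<open>p'\<close> is a root of the cubic with roots \<open>p\<close>,
    \<open>q\<close>, \<open>r\<close>; once it is matched and cancelled, \<open>two\<close> matches
    the remaining pair.\<close>
  have "(p' - p) * (p' - q) * (p' - r) = p' * p' * p' - (p + q + r) * p' * p' + (p * q + q * r + r * p) * p' - p * q * r"
    by (simp add: algebra_simps)
  also have "\<dots> = 0" unfolding e1 e2 e3 by (simp add: algebra_simps)
  finally consider "p' = p" | "p' = q" | "p' = r" by auto
  then have "(p', q', r') \<in> {(p, q, r), (p, r, q), (q, p, r), (q, r, p), (r, p, q), (r, q, p)}"
  proof cases
    case 1
    have "q + r = q' + r'" "q * r = q' * r'"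
      using e1 e3 nz 1 by (auto simp: mult.assoc)
    from two[OF this] 1 show ?thesis by auto
  next
    case 2
    have "p + r = q' + r'" using e1 2 by (simp add: algebra_simps)
    moreover have "p' * (p * r) = p' * (q' * r')" using e3 2 by (simp add: mult_ac)
    ultimately have "p + r = q' + r'" "p * r = q' * r'" using nz by auto
    from two[OF this] 2 show ?thesis by auto
  next
    case 3
    have "p + q = q' + r'" using e1 3 by (simp add: algebra_simps)
    moreover have "p' * (p * q) = p' * (q' * r')" using e3 3 by (simp add: mult_ac)
    ultimately have "p + q = q' + r'" "p * q = q' * r'" using nz by auto
    from two[OF this] 3 show ?thesis by auto
  qed
  then obtain c1 c2 c3 where c: "(c1, c2, c3) \<in> {(a1, a2, a3), (a1, a3, a2), (a2, a1, a3), (a2, a3, a1), (a3, a1, a2), (a3, a2, a1)}"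
    "p' = cis c1" "q' = cis c2" "r' = cis c3"
    unfolding p_def q_def r_def by blast
  obtain n1 where n1: "b1 = c1 + 2 * pi * of_int n1"
    using c(2) unfolding p'_def by (rule cis_eq_cisD)
  obtain n2 where n2: "b2 = c2 + 2 * pi * of_int n2"
    using c(3) unfolding q'_def by (rule cis_eq_cisD)
  obtain n3 where n3: "b3 = c3 + 2 * pi * of_int n3"
    using c(4) unfolding r'_def by (rule cis_eq_cisD)
  show ?thesis
    by (rule alcove_translate[OF a b n1 n2 n3 c(1)])
qed

section \<open>Density of the orbit modes on the closed triangle\<close>

lemma rhombus_half_iff:
  "x \<in> rhombus_half s \<longleftrightarrow> 0 < s * x$1 \<and> s / sqrt 3 * x$1 + x$2 < 1 / 2 \<and> s / sqrt 3 * x$1 - x$2 < 1 / 2"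
  by (auto simp: rhombus_half_def polygon_def triangle_normal_def triangle_offset_def inner_vector_2)

lemma closure_rhombus_half:
  assumes "x \<in> closure (rhombus_half s)"
  shows "0 \<le> s * x$1" "s / sqrt 3 * x$1 + x$2 \<le> 1 / 2" "s / sqrt 3 * x$1 - x$2 \<le> 1 / 2"
proof -
  let ?C = "{x. vector [- s, 0] \<bullet> x \<le> 0} \<inter> {x. vector [s / sqrt 3, 1] \<bullet> x \<le> 1 / 2} \<inter>
      {x::real^2. vector [s / sqrt 3, -1] \<bullet> x \<le> 1 / 2}"
  have "closure (rhombus_half s) \<subseteq> ?C"
    by (intro closure_minimal closed_Int closed_halfspace_le) (auto simp: rhombus_half_iff inner_vector_2)
  then have "x \<in> ?C" using assms by blast
  then show "0 \<le> s * x$1" "s / sqrt 3 * x$1 + x$2 \<le> 1 / 2" "s / sqrt 3 * x$1 - x$2 \<le> 1 / 2"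
    by (simp_all add: inner_vector_2)
qed

lemma bounded_rhombus_half:
  assumes s: "s = 1 \<or> s = -1"
  shows "bounded (rhombus_half s)"
proof (rule bounded_subset[OF bounded_cball])
  show "rhombus_half s \<subseteq> cball 0 2"
  proof
    fix x assume "x \<in> rhombus_half s"
    then have x: "0 < s * x$1" "s / sqrt 3 * x$1 + x$2 < 1 / 2" "s / sqrt 3 * x$1 - x$2 < 1 / 2"
      by (auto simp: rhombus_half_iff)
    have "s / sqrt 3 * x$1 = (s * x$1) / sqrt 3" by simp
    moreover have "0 < (s * x$1) / sqrt 3" using x(1) by simp
    ultimately have "\<bar>x$2\<bar> \<le> 1" "(s * x$1) / sqrt 3 < 1 / 2" using x(2,3) by linarith+
    moreover from this(2) have "s * x$1 < sqrt 3 / 2" by (simp add: field_simps)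
    moreover have "sqrt 3 \<le> 2" by (rule real_le_lsqrt) auto
    moreover have "\<bar>x$1\<bar> = s * x$1" using s x(1) by auto
    ultimately have "\<bar>x$1\<bar> + \<bar>x$2\<bar> \<le> 2" by linarith
    then show "x \<in> cball 0 2"
      using norm_le_l1_cart[of x] by (simp add: sum_2)
  qed
qed

lemma angles_alcove:
  assumes "x \<in> closure (rhombus_half s)"
  shows "angle1 s x + angle2 s x + angle3 s x = 0" "angle3 s x \<le> angle1 s x" "angle1 s x \<le> angle2 s x"
    "angle2 s x \<le> angle3 s x + 2 * pi"
proof -
  note c = closure_rhombus_half[OF assms]
  show "angle1 s x + angle2 s x + angle3 s x = 0"
    by (simp add: angle1_def angle2_def angle3_def algebra_simps)
  have "angle1 s x - angle3 s x = 2 * pi * (1 / 2 - (s / sqrt 3 * x$1 - x$2))"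
    by (simp add: angle1_def angle3_def algebra_simps)
  moreover have "0 \<le> 2 * pi * (1 / 2 - (s / sqrt 3 * x$1 - x$2))" using c by simp
  ultimately show "angle3 s x \<le> angle1 s x" by linarith
  have "angle2 s x - angle1 s x = 2 * pi * (1 / 2 - (s / sqrt 3 * x$1 + x$2))"
    by (simp add: angle1_def angle2_def algebra_simps)
  moreover have "0 \<le> 2 * pi * (1 / 2 - (s / sqrt 3 * x$1 + x$2))" using c by simp
  ultimately show "angle1 s x \<le> angle2 s x" by linarith
  have "angle3 s x + 2 * pi - angle2 s x = 4 * pi / sqrt 3 * (s * x$1)"
    by (simp add: angle2_def angle3_def algebra_simps)
  moreover have "0 \<le> 4 * pi / sqrt 3 * (s * x$1)" using mult_nonneg_nonneg[OF _ c(1), of "4 * pi / sqrt 3"] by simp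
  ultimately show "angle2 s x \<le> angle3 s x + 2 * pi" by linarith
qed

text \<open>Each permutation of \<open>(1, 0, 0)\<close> occurs twice, whence the factor 2.\<close>

lemma orbit_sum_100: "orbit_sum s 1 0 0 x = 2 * (cis (angle1 s x) + cis (angle2 s x) + cis (angle3 s x))"
  by (simp add: orbit_sum_def lattice_wave_def)

text \<open>This single complex function already separates points for Stone-Weierstrass: its value
  determines the angles, and two of them determine the point.\<close>

lemma orbit_sum_inj_on:
  assumes s: "s = 1 \<or> s = -1" and x: "x \<in> closure (rhombus_half s)" and y: "y \<in> closure (rhombus_half s)"
    and eq: "orbit_sum s 1 0 0 x = orbit_sum s 1 0 0 y"
  shows "x = y"
proof -
  have "angle1 s x = angle1 s y \<and> angle2 s x = angle2 s y \<and> angle3 s x = angle3 s y"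
  proof (rule sum_cis_inj_on_alcove[OF angles_alcove[OF x] angles_alcove[OF y]])
    show "cis (angle1 s x) + cis (angle2 s x) + cis (angle3 s x) = cis (angle1 s y) + cis (angle2 s y) + cis (angle3 s y)"
      using eq unfolding orbit_sum_100 by (simp only: mult_cancel_left) simp
  qed
  then show ?thesis
    using s by (auto simp: vec_eq_iff forall_2 angle1_def angle2_def)
qed

definition orbit_modes :: "real \<Rightarrow> (real^2 \<Rightarrow> real) set" where
  "orbit_modes s = {orbit_mode s c k1 k2 k3 | c k1 k2 k3. True}"

lemma orbit_modes_mult_span:
  assumes "f \<in> orbit_modes s" "g \<in> orbit_modes s"
  shows "(\<lambda>x. f x * g x) \<in> funs.span (orbit_modes s)"
proof -
  have base: "(\<lambda>x. orbit_mode s c k1 k2 k3 x) \<in> funs.span (orbit_modes s)" for c k1 k2 k3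
    by (rule funs.span_base) (auto simp: orbit_modes_def)
  have add: "(\<lambda>x. f x + g x) \<in> funs.span (orbit_modes s)"
    if "f \<in> funs.span (orbit_modes s)" "g \<in> funs.span (orbit_modes s)" for f g
    using funs.span_add[OF that] by (simp add: plus_fun_def)
  obtain c k1 k2 k3 d l1 l2 l3 where "f = orbit_mode s c k1 k2 k3" "g = orbit_mode s d l1 l2 l3"
    using assms unfolding orbit_modes_def by blast
  then show ?thesis
    by (simp only: orbit_mode_mult list.map sum_list.Cons sum_list.Nil prod.case add_0_right)
       (intro add base)
qed

text \<open>Closedness passes from generators to the span in one factor at a time, since the
  admissible first factors for a fixed \<open>h\<close> form a subspace.\<close>

lemma span_mult_closed:
  assumes G: "\<And>f g. f \<in> G \<Longrightarrow> g \<in> G \<Longrightarrow> (\<lambda>x. f x * g x) \<in> funs.span G"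
    and f: "f \<in> funs.span G" and g: "g \<in> funs.span G"
  shows "(\<lambda>x. f x * g x) \<in> funs.span G"
proof -
  have sub: "funs.subspace {f. (\<lambda>x. f x * h x) \<in> funs.span G}" for h
  proof (rule funs.subspaceI)
    show "0 \<in> {f. (\<lambda>x. f x * h x) \<in> funs.span G}"
      using funs.span_zero[of G] by (simp add: zero_fun_def)
    fix a b assume "a \<in> {f. (\<lambda>x. f x * h x) \<in> funs.span G}" "b \<in> {f. (\<lambda>x. f x * h x) \<in> funs.span G}"
    then show "a + b \<in> {f. (\<lambda>x. f x * h x) \<in> funs.span G}"
      using funs.span_add[of "\<lambda>x. a x * h x" G "\<lambda>x. b x * h x"] by (simp add: plus_fun_def distrib_right)
  next
    fix c a assume "a \<in> {f. (\<lambda>x. f x * h x) \<in> funs.span G}"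
    then show "(\<lambda>x. c * a x) \<in> {f. (\<lambda>x. f x * h x) \<in> funs.span G}"
      using funs.span_scale[of "\<lambda>x. a x * h x" G c] by (simp add: mult.assoc)
  qed
  have 1: "(\<lambda>x. f x * h x) \<in> funs.span G" if "h \<in> G" for h
    using funs.span_induct[OF f sub, of h] G that by simp
  have "(\<lambda>x. g x * f x) \<in> funs.span G"
    by (rule funs.span_induct[OF g sub, of f]) (simp add: 1 mult.commute[of _ "f _"])
  then show ?thesis by (simp add: mult.commute)
qed

lemma orbit_modes_dense:
  assumes s: "s = 1 \<or> s = -1" and v: "continuous_on (closure (rhombus_half s)) v" and e: "e > 0"
  shows "\<exists>p\<in>funs.span (orbit_modes s). \<forall>x\<in>closure (rhombus_half s). \<bar>v x - p x\<bar> < e"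
proof -
  let ?P = "\<lambda>f. f \<in> funs.span (orbit_modes s)"
  have "\<exists>g. ?P g \<and> (\<forall>x\<in>closure (rhombus_half s). \<bar>v x - g x\<bar> < e)"
  proof (rule Stone_Weierstrass_HOL[OF _ _ _ _ _ _ v e])
    show "compact (closure (rhombus_half s))" using bounded_rhombus_half[OF s] by simp
    show "?P (\<lambda>x. c)" for c
    proof -
      \<comment> \<open>The six waves of zero frequency sum to 6, hence the division.\<close>
      have "orbit_mode s (of_real (c / 6)) 0 0 0 \<in> funs.span (orbit_modes s)"
        by (rule funs.span_base) (auto simp: orbit_modes_def)
      moreover have "orbit_mode s (of_real (c / 6)) 0 0 0 = (\<lambda>x. c)"
        by (auto simp: orbit_mode_const)
      ultimately show ?thesis by simp
    qed
    show "continuous_on (closure (rhombus_half s)) f" if "?P f" for f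
    proof (rule funs.span_induct[OF that])
      show "funs.subspace {f. continuous_on (closure (rhombus_half s)) f}"
        by (rule funs.subspaceI) (auto simp: zero_fun_def plus_fun_def intro!: continuous_intros)
      fix f assume "f \<in> orbit_modes s"
      then show "continuous_on (closure (rhombus_half s)) f"
        using helmholtz_orbit_mode[OF s] helmholtz_continuous(1) unfolding orbit_modes_def by blast
    qed
    show "?P (\<lambda>x. f x + g x)" if "?P f \<and> ?P g" for f g
      using that funs.span_add by (fastforce simp: plus_fun_def)
    show "?P (\<lambda>x. f x * g x)" if "?P f \<and> ?P g" for f g
      using that span_mult_closed orbit_modes_mult_span by blast
    fix x y assume xy: "x \<in> closure (rhombus_half s) \<and> y \<in> closure (rhombus_half s) \<and> x \<noteq> y"
    have m: "?P (orbit_mode s c 1 0 0)" for c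
      by (rule funs.span_base) (auto simp: orbit_modes_def)
    have "orbit_sum s 1 0 0 x \<noteq> orbit_sum s 1 0 0 y" using orbit_sum_inj_on[OF s] xy by blast
    then have "orbit_mode s 1 1 0 0 x \<noteq> orbit_mode s 1 1 0 0 y \<or> orbit_mode s (- \<i>) 1 0 0 x \<noteq> orbit_mode s (- \<i>) 1 0 0 y"
      by (auto simp: orbit_mode_def complex_eq_iff)
    then show "\<exists>f. ?P f \<and> f x \<noteq> f y" using m by blast
  qed
  then show ?thesis by blast
qed

theorem Poincare_rhombus_half:
  assumes s: "s = 1 \<or> s = -1" and u: "H1 (rhombus_half s) u g" "continuous_on (rhombus_half s) u"
    and mean: "(LINT x|lebesgue_on (rhombus_half s). u x) = 0"
  shows "16 * pi\<^sup>2 / 9 * (LINT x|lebesgue_on (rhombus_half s). (u x)\<^sup>2) \<le> (LINT x|lebesgue_on (rhombus_half s). (norm (g x))\<^sup>2)"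
  unfolding rhombus_half_def
proof (rule Poincare_polygon[where M = "orbit_modes s"])
  show "triangle_normal s i \<noteq> 0" if "i \<in> {0, 1, 2}" for i
    using s by (auto simp: triangle_normal_def vec_eq_iff forall_2)
  show "\<exists>l D. polygon_mode {0, 1, 2} (triangle_normal s) triangle_offset l f D \<and>
      (16 * pi\<^sup>2 / 9 \<le> l \<or> l = 0 \<and> (\<exists>k. \<forall>x. f x = k))" if f0: "f \<in> orbit_modes s" for f
  proof -
    obtain c k1 k2 k3 where f: "f = orbit_mode s c k1 k2 k3"
      using f0 unfolding orbit_modes_def by blast
    obtain D where D: "polygon_mode {0, 1, 2} (triangle_normal s) triangle_offset (mode_eigenvalue k1 k2 k3) f D"
      using rhombus_half_mode[OF s] f by blast
    have "16 * pi\<^sup>2 / 9 \<le> mode_eigenvalue k1 k2 k3 \<or> mode_eigenvalue k1 k2 k3 = 0 \<and> (\<exists>k. \<forall>x. f x = k)"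
      using mode_eigenvalue_cases[of k1 k2 k3] by (auto simp: f orbit_mode_const mode_eigenvalue_def)
    with D show ?thesis by blast
  qed
qed (use u mean orbit_modes_dense[OF s] bounded_rhombus_half[OF s] in \<open>auto simp: rhombus_half_def\<close>)

section \<open>The rhombus and its third eigenvalue\<close>

text \<open>A point of the intersection is a convex combination of the horizontal vertex on its own
  side and a point of the short diagonal.\<close>

lemma convex_hull_rhombus:
  "convex hull {vector [sqrt 3 / 2, 0], vector [- (sqrt 3 / 2), 0], vector [0, 1 / 2], vector [0, - (1 / 2)]} =
     {x :: real^2. vector [1 / sqrt 3, 1] \<bullet> x \<le> 1 / 2} \<inter> {x. vector [1 / sqrt 3, -1] \<bullet> x \<le> 1 / 2} \<inter>
     {x. vector [- 1 / sqrt 3, 1] \<bullet> x \<le> 1 / 2} \<inter> {x. vector [- 1 / sqrt 3, -1] \<bullet> x \<le> 1 / 2}"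
  (is "convex hull ?S = ?Q")
proof
  show "convex hull ?S \<subseteq> ?Q"
    by (intro hull_minimal convex_Int convex_halfspace_le) (auto simp: inner_vector_2)
  show "?Q \<subseteq> convex hull ?S"
  proof
    fix x :: "real^2" assume x: "x \<in> ?Q"
    define H where "H = convex hull ?S"
    have cH: "convex H" by (simp add: H_def)
    have mem: "vector [sqrt 3 / 2, 0] \<in> H" "vector [- (sqrt 3 / 2), 0] \<in> H"
      "vector [0, 1 / 2] \<in> H" "vector [0, - (1 / 2)] \<in> H"
      by (auto simp: H_def hull_inc)
    \<comment> \<open>Scaled so that the rhombus becomes
      \<open>\<bar>u\<bar> + \<bar>2 * x$2\<bar> \<le> 1\<close>; the weights will be
      \<open>\<bar>u\<bar>\<close> and \<open>1 - \<bar>u\<bar>\<close>.\<close>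
    define u where "u = x$1 * (2 / sqrt 3)"
    have x1: "x$1 = u * (sqrt 3 / 2)" by (simp add: u_def)
    have uv: "\<bar>u\<bar> + \<bar>2 * x$2\<bar> \<le> 1"
      using x by (auto simp: inner_vector_2 u_def)
    have P: "vector [sgn u * (sqrt 3 / 2), 0] \<in> H" if "u \<noteq> 0"
      using that mem by (cases "u > 0") auto
    have R: "vector [0, t / 2] \<in> H" if "\<bar>t\<bar> \<le> 1" for t
    proof -
      have "((1 + t) / 2) *\<^sub>R vector [0, 1 / 2] + ((1 - t) / 2) *\<^sub>R vector [0, - (1 / 2)] \<in> H"
        using that by (intro convexD[OF cH mem(3,4)]) (auto simp: field_simps)
      also have "((1 + t) / 2) *\<^sub>R vector [0, 1 / 2] + ((1 - t) / 2) *\<^sub>R vector [0, - (1 / 2)] = (vector [0, t / 2] :: real^2)"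
        by (simp add: vec_eq_iff forall_2 field_simps)
      finally show ?thesis .
    qed
    have "x \<in> H"
    \<comment> \<open>The separate values are those where \<open>sgn u\<close> selects no vertex and
      where the denominator \<open>1 - \<bar>u\<bar>\<close> of \<open>t\<close> vanishes.\<close>
    proof (cases "\<bar>u\<bar> = 0 \<or> \<bar>u\<bar> = 1")
      case True
      then show ?thesis
      proof
        assume "\<bar>u\<bar> = 0"
        then have "x = vector [0, 2 * x$2 / 2]" by (simp add: vec_eq_iff forall_2 x1)
        then show ?thesis using R[of "2 * x$2"] uv by simp
      next
        assume u1: "\<bar>u\<bar> = 1"
        then have "x = vector [sgn u * (sqrt 3 / 2), 0]"
          using uv by (auto simp: vec_eq_iff forall_2 x1 abs_if sgn_if split: if_splits)
        then show ?thesis using P u1 by auto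
      qed
    next
      case False
      then have u: "0 < \<bar>u\<bar>" "\<bar>u\<bar> < 1" using uv by auto
      define t where "t = 2 * x$2 / (1 - \<bar>u\<bar>)"
      have "\<bar>t\<bar> \<le> 1" using uv u by (simp add: t_def abs_divide)
      from convexD[OF cH P R[OF this], of "\<bar>u\<bar>" "1 - \<bar>u\<bar>"]
      have "\<bar>u\<bar> *\<^sub>R vector [sgn u * (sqrt 3 / 2), 0] + (1 - \<bar>u\<bar>) *\<^sub>R vector [0, t / 2] \<in> H"
        using u by auto
      also have "\<bar>u\<bar> *\<^sub>R vector [sgn u * (sqrt 3 / 2), 0] + (1 - \<bar>u\<bar>) *\<^sub>R vector [0, t / 2] = x"
        using u by (simp add: vec_eq_iff forall_2 t_def x1 mult.assoc[symmetric] abs_mult_sgn)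
      finally show ?thesis .
    qed
    then show "x \<in> convex hull ?S" by (simp add: H_def)
  qed
qed

definition rhombus_normal :: "real \<times> real \<Rightarrow> real^2" where
  "rhombus_normal = (\<lambda>(a, b). vector [a / sqrt 3, b])"

lemma equilateral_rhombus_iff:
  "x \<in> equilateral_rhombus \<longleftrightarrow> \<bar>x$1\<bar> / sqrt 3 + \<bar>x$2\<bar> < 1 / 2"
proof -
  have nz: "vector [a, b] \<noteq> (0 :: real^2)" if "b \<noteq> 0" for a b :: real
    using that by (simp add: vec_eq_iff forall_2)
  define w where "w = x$1 / sqrt 3"
  have "\<bar>x$1\<bar> / sqrt 3 = \<bar>w\<bar>" by (simp add: w_def abs_divide)
  moreover have "x \<in> equilateral_rhombus \<longleftrightarrow>
      w + x$2 < 1 / 2 \<and> w - x$2 < 1 / 2 \<and> - w + x$2 < 1 / 2 \<and> - w - x$2 < 1 / 2"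
  proof -
    have int: "interior {x. vector [a, b] \<bullet> x \<le> 1 / 2} = {x. vector [a, b] \<bullet> (x::real^2) < 1 / 2}"
      if "b \<noteq> 0" for a b :: real
      using nz[OF that] by (rule interior_halfspace_le)
    have int1: "interior {x. vector [a, 1] \<bullet> x \<le> 1 / 2} = {x. vector [a, 1] \<bullet> (x::real^2) < 1 / 2}"
      and int2: "interior {x. vector [a, -1] \<bullet> x \<le> 1 / 2} = {x. vector [a, -1] \<bullet> (x::real^2) < 1 / 2}"
      for a :: real
      by (rule int, simp)+
    show ?thesis
      unfolding equilateral_rhombus_def convex_hull_rhombus interior_Int int1 int2
      by (simp add: inner_vector_2 w_def conj_assoc)
  qed
  ultimately show ?thesis by (simp only:) arith
qed

lemma equilateral_rhombus_polygon:
  "equilateral_rhombus = polygon ({1, -1} \<times> {1, -1}) rhombus_normal (\<lambda>_. 1 / 2)"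
proof (rule set_eqI)
  fix x :: "real^2"
  define w where "w = x$1 / sqrt 3"
  have "\<bar>x$1\<bar> / sqrt 3 = \<bar>w\<bar>" by (simp add: w_def abs_divide)
  moreover have "x \<in> polygon ({1, -1} \<times> {1, -1}) rhombus_normal (\<lambda>_. 1 / 2) \<longleftrightarrow>
      w + x$2 < 1 / 2 \<and> w - x$2 < 1 / 2 \<and> - w + x$2 < 1 / 2 \<and> - w - x$2 < 1 / 2"
    by (auto simp: polygon_def rhombus_normal_def inner_vector_2 w_def)
  ultimately show "x \<in> equilateral_rhombus \<longleftrightarrow> x \<in> polygon ({1, -1} \<times> {1, -1}) rhombus_normal (\<lambda>_. 1 / 2)"
    by (simp only: equilateral_rhombus_iff) arith
qed

lemma bounded_equilateral_rhombus: "bounded equilateral_rhombus"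
  unfolding equilateral_rhombus_def by (intro bounded_interior bounded_convex_hull) auto

lemma open_equilateral_rhombus: "open equilateral_rhombus"
  by (simp add: equilateral_rhombus_def)

lemma sets_equilateral_rhombus: "equilateral_rhombus \<in> sets lebesgue"
  using open_equilateral_rhombus by simp

lemma rhombus_half_subset:
  assumes "s = 1 \<or> s = -1"
  shows "rhombus_half s \<subseteq> equilateral_rhombus"
  using assms by (auto simp: rhombus_half_iff equilateral_rhombus_iff abs_if)

lemma sets_rhombus_half: "rhombus_half s \<in> sets lebesgue"
  unfolding rhombus_half_def by (intro polygon_sets) auto

lemma rhombus_split:
  assumes "x \<in> equilateral_rhombus" "x$1 \<noteq> 0"
  shows "indicat_real equilateral_rhombus x = indicat_real (rhombus_half 1) x + indicat_real (rhombus_half (-1)) x"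
  using assms by (auto simp: rhombus_half_iff equilateral_rhombus_iff indicator_def abs_if split: if_splits)

text \<open>The two halves miss only points of the short diagonal, a null set.\<close>

lemma integral_rhombus_split:
  assumes f: "integrable (lebesgue_on equilateral_rhombus) f"
  shows "(LINT x|lebesgue_on equilateral_rhombus. f x) =
    (LINT x|lebesgue_on (rhombus_half 1). f x) + (LINT x|lebesgue_on (rhombus_half (-1)). f x :: real)"
proof -
  have i: "integrable lebesgue (\<lambda>x. indicat_real (rhombus_half s) x *\<^sub>R f x)" if "s = 1 \<or> s = -1" for s
    using f set_integrable_subset[of lebesgue equilateral_rhombus f "rhombus_half s"] rhombus_half_subset[OF that]
      sets_rhombus_half sets_equilateral_rhombus
    by (simp add: integrable_restrict_space set_integrable_def)
  have iR: "integrable lebesgue (\<lambda>x. indicat_real equilateral_rhombus x *\<^sub>R f x)"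
    using f sets_equilateral_rhombus by (simp add: integrable_restrict_space)
  have "AE x in lebesgue. x \<notin> {x::real^2. x$1 = 0}"
    using negligible_standard_hyperplane_cart[of 1] by (intro AE_not_in) (simp add: negligible_iff_null_sets)
  then have "AE x in lebesgue. indicat_real equilateral_rhombus x *\<^sub>R f x =
      indicat_real (rhombus_half 1) x *\<^sub>R f x + indicat_real (rhombus_half (-1)) x *\<^sub>R f x"
  proof (rule AE_mp, intro AE_I2 impI)
    fix x :: "real^2" assume x: "x \<notin> {x. x$1 = 0}"
    show "indicat_real equilateral_rhombus x *\<^sub>R f x =
      indicat_real (rhombus_half 1) x *\<^sub>R f x + indicat_real (rhombus_half (-1)) x *\<^sub>R f x"
    proof (cases "x \<in> equilateral_rhombus")
      case True
      have "x$1 \<noteq> 0" using x by simp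
      show ?thesis unfolding rhombus_split[OF True \<open>x$1 \<noteq> 0\<close>] real_scaleR_def by (rule distrib_right)
    next
      case False
      then have "x \<notin> rhombus_half 1" "x \<notin> rhombus_half (-1)"
        using rhombus_half_subset[of 1] rhombus_half_subset[of "-1"] by auto
      then show ?thesis using False by simp
    qed
  qed
  then have "(LINT x|lebesgue. indicat_real equilateral_rhombus x *\<^sub>R f x) =
      (LINT x|lebesgue. indicat_real (rhombus_half 1) x *\<^sub>R f x + indicat_real (rhombus_half (-1)) x *\<^sub>R f x)"
    using iR i by (intro integral_cong_AE) auto
  then show ?thesis
    using i sets_rhombus_half sets_equilateral_rhombus by (simp add: integral_restrict_space)
qed

section \<open>Rayleigh quotients and the lower bound for the third eigenvalue\<close>

lemma H1_sum:
  assumes "finite I" "\<And>i. i \<in> I \<Longrightarrow> H1 \<Omega> (f i) (g i)" "bounded \<Omega>" "\<Omega> \<in> sets lebesgue"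
  shows "H1 \<Omega> (\<lambda>x. \<Sum>i\<in>I. c i * f i x) (\<lambda>x. \<Sum>i\<in>I. c i *\<^sub>R g i x)"
  unfolding H1_def
proof (intro conjI allI impI)
  have sf: "square_integrable \<Omega> (f i)" and sg: "square_integrable \<Omega> (g i)" if "i \<in> I" for i
    using assms(2)[OF that] by (auto simp: H1_def)
  show "square_integrable \<Omega> (\<lambda>x. \<Sum>i\<in>I. c i * f i x)"
    by (intro square_integrable_sum square_integrable_cmult sf assms)
  show "square_integrable \<Omega> (\<lambda>x. \<Sum>i\<in>I. c i *\<^sub>R g i x)"
    by (intro square_integrable_sum square_integrable_scaleR sg assms)
  fix \<phi> D\<phi> assume T: "test_function \<Omega> \<phi> D\<phi>"
  have "continuous_on UNIV \<phi>" "continuous_on UNIV D\<phi>"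
    using T continuous_on_GDERIV unfolding test_function_def by blast+
  then have s\<phi>: "square_integrable \<Omega> \<phi>" "square_integrable \<Omega> D\<phi>"
    using assms by (auto intro: square_integrable_continuous)
  have "(LINT x|lebesgue_on \<Omega>. (\<Sum>i\<in>I. c i * f i x) *\<^sub>R D\<phi> x) =
      (LINT x|lebesgue_on \<Omega>. (\<Sum>i\<in>I. c i *\<^sub>R (f i x *\<^sub>R D\<phi> x)))"
    by (simp add: scaleR_sum_left)
  also have "\<dots> = (\<Sum>i\<in>I. c i *\<^sub>R (LINT x|lebesgue_on \<Omega>. f i x *\<^sub>R D\<phi> x))"
    using sf s\<phi> by (simp add: Bochner_Integration.integral_sum square_integrable_scaleR_integrable del: scaleR_scaleR)
  also have "\<dots> = - (\<Sum>i\<in>I. c i *\<^sub>R (LINT x|lebesgue_on \<Omega>. \<phi> x *\<^sub>R g i x))"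
    using assms(2) T unfolding H1_def by (simp add: sum_negf[symmetric])
  also have "(\<Sum>i\<in>I. c i *\<^sub>R (LINT x|lebesgue_on \<Omega>. \<phi> x *\<^sub>R g i x)) =
      (LINT x|lebesgue_on \<Omega>. (\<Sum>i\<in>I. c i *\<^sub>R (\<phi> x *\<^sub>R g i x)))"
    using sg s\<phi> by (simp add: Bochner_Integration.integral_sum square_integrable_scaleR_integrable del: scaleR_scaleR)
  also have "\<dots> = (LINT x|lebesgue_on \<Omega>. \<phi> x *\<^sub>R (\<Sum>i\<in>I. c i *\<^sub>R g i x))"
    by (simp add: scaleR_sum_right mult.commute)
  finally show "(LINT x|lebesgue_on \<Omega>. (\<Sum>i\<in>I. c i * f i x) *\<^sub>R D\<phi> x) =
      - (LINT x|lebesgue_on \<Omega>. \<phi> x *\<^sub>R (\<Sum>i\<in>I. c i *\<^sub>R g i x))" .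
qed

text \<open>The set where \<open>u\<close> is nonzero is open by continuity and also negligible,
  hence empty.\<close>

lemma continuous_integral_square_zero:
  fixes u :: "'a::euclidean_space \<Rightarrow> real"
  assumes "open \<Omega>" "continuous_on \<Omega> u" "square_integrable \<Omega> u"
    and 0: "(LINT x|lebesgue_on \<Omega>. (u x)\<^sup>2) \<le> 0" and x: "x \<in> \<Omega>"
  shows "u x = 0"
proof (rule ccontr)
  assume "u x \<noteq> 0"
  have leb: "\<Omega> \<in> sets lebesgue" using assms(1) by simp
  have i: "integrable (lebesgue_on \<Omega>) (\<lambda>x. (u x)\<^sup>2)"
    using assms(3) by (simp add: square_integrable_def)
  have "(LINT x|lebesgue_on \<Omega>. (u x)\<^sup>2) = 0"
  proof (rule antisym[OF 0])
    show "0 \<le> (LINT x|lebesgue_on \<Omega>. (u x)\<^sup>2)" by (intro integral_nonneg_AE) auto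
  qed
  then have "AE x in lebesgue_on \<Omega>. (u x)\<^sup>2 = 0"
    using integral_nonneg_eq_0_iff_AE[OF i] by simp
  then have "AE x in lebesgue. x \<in> \<Omega> \<longrightarrow> u x = 0"
    using leb by (simp add: AE_restrict_space_iff)
  moreover define N where "N = {x\<in>\<Omega>. u x \<noteq> 0}"
  have N: "open N"
  proof -
    have "N = \<Omega> \<inter> u -` (- {0})" by (auto simp: N_def)
    then show ?thesis using assms(1,2) by (simp add: continuous_open_preimage open_Compl)
  qed
  ultimately have "N \<in> null_sets lebesgue"
    using N by (subst (asm) AE_iff_null) (auto simp: N_def)
  then have "negligible N" by (simp add: negligible_iff_null_sets)
  then have "N = {}" using N open_not_negligible by blast
  then show False using x \<open>u x \<noteq> 0\<close> by (auto simp: N_def)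
qed

text \<open>Test the weak equation with \<open>u\<close> itself: a negative \<open>\<nu>\<close>
  would force the integral of its square to vanish.\<close>

lemma neumann_eigenvalue_nonneg:
  assumes "open \<Omega>" "u \<in> neumann_eigenspace \<Omega> \<nu>" "u \<noteq> 0"
  shows "0 \<le> \<nu>"
proof (rule ccontr)
  assume neg: "\<not> 0 \<le> \<nu>"
  obtain g where g: "H1 \<Omega> u g" "continuous_on \<Omega> u" "\<And>x. x \<notin> \<Omega> \<Longrightarrow> u x = 0"
    "(LINT x|lebesgue_on \<Omega>. g x \<bullet> g x) = \<nu> * (LINT x|lebesgue_on \<Omega>. u x * u x)"
    using assms(2) unfolding neumann_eigenspace_def by blast
  have "0 \<le> (LINT x|lebesgue_on \<Omega>. g x \<bullet> g x)" by (intro integral_nonneg_AE) auto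
  then have "(LINT x|lebesgue_on \<Omega>. (u x)\<^sup>2) \<le> 0"
    using g(4) neg by (simp add: power2_eq_square zero_le_mult_iff)
  then have "u x = 0" for x
    using continuous_integral_square_zero[OF assms(1) g(2)] g(1,3) by (cases "x \<in> \<Omega>") (auto simp: H1_def)
  then show False using assms(3) by (auto simp: zero_fun_def)
qed

text \<open>Symmetry of the weak equation makes members of \<open>B\<close> with different
  eigenvalues orthogonal, so \<open>weighted_gram_nonneg\<close> with the weights
  \<open>\<xi> - \<nu> b\<close> compares the two quadratic forms even when eigenvalues
  repeat.\<close>

lemma Rayleigh_span:
  fixes B :: "('a::euclidean_space \<Rightarrow> real) set"
  assumes B: "finite B" and \<Omega>: "bounded \<Omega>" "\<Omega> \<in> sets lebesgue"
    and E: "\<And>b. b \<in> B \<Longrightarrow> b \<in> neumann_eigenspace \<Omega> (\<nu> b) \<and> \<nu> b \<le> \<xi>"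
  obtains g where "H1 \<Omega> (\<lambda>x. \<Sum>b\<in>B. c b * b x) g"
    "(LINT x|lebesgue_on \<Omega>. (norm (g x))\<^sup>2) \<le> \<xi> * (LINT x|lebesgue_on \<Omega>. (\<Sum>b\<in>B. c b * b x)\<^sup>2)"
proof -
  have "\<forall>b\<in>B. \<exists>g. H1 \<Omega> b g \<and> (\<forall>\<phi> h. H1 \<Omega> \<phi> h \<longrightarrow>
      (LINT x|lebesgue_on \<Omega>. g x \<bullet> h x) = \<nu> b * (LINT x|lebesgue_on \<Omega>. b x * \<phi> x))"
    using E unfolding neumann_eigenspace_def by blast
  then obtain g where g: "\<And>b. b \<in> B \<Longrightarrow> H1 \<Omega> b (g b)"
    and weak: "\<And>b \<phi> h. b \<in> B \<Longrightarrow> H1 \<Omega> \<phi> h \<Longrightarrow>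
      (LINT x|lebesgue_on \<Omega>. g b x \<bullet> h x) = \<nu> b * (LINT x|lebesgue_on \<Omega>. b x * \<phi> x)"
    by metis
  have sb: "square_integrable \<Omega> b" and sg: "square_integrable \<Omega> (g b)" if "b \<in> B" for b
    using g[OF that] by (auto simp: H1_def)
  define I where "I a b = (LINT x|lebesgue_on \<Omega>. a x * b x)" for a b :: "'a \<Rightarrow> real"
  have I_sym: "I a b = I b a" for a b by (simp add: I_def mult.commute)
  have gg: "(LINT x|lebesgue_on \<Omega>. g a x \<bullet> g b x) = \<nu> a * I a b" if "a \<in> B" "b \<in> B" for a b
    using weak[OF that(1) g[OF that(2)]] by (simp add: I_def)
  have gg': "(LINT x|lebesgue_on \<Omega>. g a x \<bullet> g b x) = \<nu> b * I a b" if "a \<in> B" "b \<in> B" for a b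
    using gg[OF that(2,1)] by (simp add: inner_commute I_sym)
  have orth: "I a b = 0" if "a \<in> B" "b \<in> B" "\<nu> a \<noteq> \<nu> b" for a b
    using gg[OF that(1,2)] gg'[OF that(1,2)] that(3) by auto
  define f where "f a x = c a * a x" for a :: "'a \<Rightarrow> real" and x
  have sf: "square_integrable \<Omega> (f b)" if "b \<in> B" for b
    unfolding f_def[abs_def] by (intro square_integrable_cmult sb that)
  have If: "(LINT x|lebesgue_on \<Omega>. f a x * f b x) = c a * c b * I a b" for a b
    unfolding f_def I_def integral_mult_right_zero[symmetric] by (simp add: mult_ac)
  have uu: "(LINT x|lebesgue_on \<Omega>. (\<Sum>b\<in>B. c b * b x)\<^sup>2) = (\<Sum>a\<in>B. \<Sum>b\<in>B. c a * c b * I a b)"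
  proof -
    have "(LINT x|lebesgue_on \<Omega>. (\<Sum>b\<in>B. c b * b x)\<^sup>2) = (LINT x|lebesgue_on \<Omega>. (\<Sum>a\<in>B. \<Sum>b\<in>B. f a x * f b x))"
      by (simp add: f_def power2_eq_square sum_product)
    also have "\<dots> = (\<Sum>a\<in>B. \<Sum>b\<in>B. c a * c b * I a b)"
      by (simp add: Bochner_Integration.integral_sum square_integrable_mult sf If)
    finally show ?thesis .
  qed
  have GG: "(LINT x|lebesgue_on \<Omega>. (norm (\<Sum>b\<in>B. c b *\<^sub>R g b x))\<^sup>2) = (\<Sum>a\<in>B. \<Sum>b\<in>B. \<nu> b * (c a * c b * I a b))"
  proof -
    have "(LINT x|lebesgue_on \<Omega>. (norm (\<Sum>b\<in>B. c b *\<^sub>R g b x))\<^sup>2) =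
        (LINT x|lebesgue_on \<Omega>. (\<Sum>a\<in>B. \<Sum>b\<in>B. c a * c b * (g b x \<bullet> g a x)))"
    proof (rule Bochner_Integration.integral_cong[OF refl])
      fix x
      show "(norm (\<Sum>b\<in>B. c b *\<^sub>R g b x))\<^sup>2 = (\<Sum>a\<in>B. \<Sum>b\<in>B. c a * c b * (g b x \<bullet> g a x))"
        unfolding power2_norm_eq_inner inner_sum_left inner_sum_right inner_scaleR_left inner_scaleR_right
        by (intro sum.cong refl) (simp only: sum_distrib_left inner_commute mult_ac)
    qed
    also have "\<dots> = (\<Sum>a\<in>B. \<Sum>b\<in>B. c a * c b * (LINT x|lebesgue_on \<Omega>. g b x \<bullet> g a x))"
      by (simp add: Bochner_Integration.integral_sum square_integrable_inner sg)
    also have "\<dots> = (\<Sum>a\<in>B. \<Sum>b\<in>B. \<nu> b * (c a * c b * I a b))"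
      by (intro sum.cong refl) (simp add: gg I_sym)
    finally show ?thesis .
  qed
  have "0 \<le> (\<Sum>a\<in>B. \<Sum>b\<in>B. (\<xi> - \<nu> b) * (LINT x|lebesgue_on \<Omega>. f a x * f b x))"
    by (rule weighted_gram_nonneg[OF B sf]) (use E orth in \<open>auto simp: If\<close>)
  also have "\<dots> = \<xi> * (\<Sum>a\<in>B. \<Sum>b\<in>B. c a * c b * I a b) - (\<Sum>a\<in>B. \<Sum>b\<in>B. \<nu> b * (c a * c b * I a b))"
    by (simp add: If left_diff_distrib sum_subtractf sum_distrib_left)
  finally have "(LINT x|lebesgue_on \<Omega>. (norm (\<Sum>b\<in>B. c b *\<^sub>R g b x))\<^sup>2) \<le> \<xi> * (LINT x|lebesgue_on \<Omega>. (\<Sum>b\<in>B. c b * b x)\<^sup>2)"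
    unfolding uu GG by linarith
  with H1_sum[OF B g \<Omega>, where c = c] show ?thesis by (rule that)
qed

text \<open>Two linear conditions on three coefficients leave a nonzero solution. The conditions
  will be the vanishing means over the two halves.\<close>

lemma ex_nontrivial_orthogonal:
  fixes \<alpha> \<beta> :: "'b \<Rightarrow> real"
  assumes "card B = 3"
  obtains c where "\<exists>b\<in>B. c b \<noteq> 0" "(\<Sum>b\<in>B. c b * \<alpha> b) = 0" "(\<Sum>b\<in>B. c b * \<beta> b) = 0"
proof -
  obtain b1 b2 b3 where b: "B = {b1, b2, b3}" "b1 \<noteq> b2" "b2 \<noteq> b3" "b1 \<noteq> b3"
    using assms by (auto simp: card_3_iff)
  define v w :: "real^3" where "v = vector [\<alpha> b1, \<alpha> b2, \<alpha> b3]" and "w = vector [\<beta> b1, \<beta> b2, \<beta> b3]"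
  have "dim {v, w} \<le> card {v, w}" by (intro dim_le_card') auto
  also have "\<dots> \<le> 2" by (simp add: card_insert_if)
  also have "\<dots> < DIM(real^3)" by simp
  finally have "dim {v, w} < DIM(real^3)" .
  from orthogonal_to_subspace_exists[OF this]
  obtain z where z: "z \<noteq> 0" "\<And>y. y \<in> span {v, w} \<Longrightarrow> orthogonal z y" by blast
  have "z \<bullet> v = 0" "z \<bullet> w = 0"
    using z(2)[of v] z(2)[of w] by (auto simp: orthogonal_def span_base)
  moreover have "z$1 \<noteq> 0 \<or> z$2 \<noteq> 0 \<or> z$3 \<noteq> 0" using z(1) by (simp add: vec_eq_iff forall_3)
  ultimately show ?thesis
    using b by (intro that[of "\<lambda>b. if b = b1 then z$1 else if b = b2 then z$2 else z$3"])
      (auto simp: v_def w_def inner_vec_def sum_3)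
qed

lemma sum_fun_apply: "(\<Sum>i\<in>I. f i) x = (\<Sum>i\<in>I. f i x)"
  by (induction I rule: infinite_finite_induct) auto

text \<open>For smaller \<open>\<xi>\<close>, the combination with mean zero on both halves would
  have Rayleigh quotient at most \<open>\<xi>\<close> by \<open>Rayleigh_span\<close>, while adding
  the two Poincare inequalities makes it at least \<open>16 * pi\<^sup>2 / 9\<close>. It would then
  vanish, against independence.\<close>

lemma three_eigenfunctions_bound:
  assumes B: "card B = 3" "funs.independent B"
    and E: "B \<subseteq> (\<Union>\<mu>\<in>{..\<xi>}. neumann_eigenspace equilateral_rhombus \<mu>)"
  shows "16 * pi\<^sup>2 / 9 \<le> \<xi>"
proof (rule ccontr)
  assume less: "\<not> 16 * pi\<^sup>2 / 9 \<le> \<xi>"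
  let ?R = equilateral_rhombus
  have fin: "finite B" using B(1) card.infinite by fastforce
  have "\<forall>b\<in>B. \<exists>\<mu>. b \<in> neumann_eigenspace ?R \<mu> \<and> \<mu> \<le> \<xi>" using E by blast
  then obtain \<nu> where \<nu>: "\<And>b. b \<in> B \<Longrightarrow> b \<in> neumann_eigenspace ?R (\<nu> b) \<and> \<nu> b \<le> \<xi>" by metis
  obtain c where c: "\<exists>b\<in>B. c b \<noteq> 0"
    "(\<Sum>b\<in>B. c b * (LINT x|lebesgue_on (rhombus_half 1). b x)) = 0"
    "(\<Sum>b\<in>B. c b * (LINT x|lebesgue_on (rhombus_half (-1)). b x)) = 0"
    using ex_nontrivial_orthogonal[OF B(1)] by blast
  define u where "u x = (\<Sum>b\<in>B. c b * b x)" for x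
  obtain g where g: "H1 ?R u g"
    "(LINT x|lebesgue_on ?R. (norm (g x))\<^sup>2) \<le> \<xi> * (LINT x|lebesgue_on ?R. (u x)\<^sup>2)"
    using Rayleigh_span[OF fin bounded_equilateral_rhombus sets_equilateral_rhombus \<nu>, of c]
    unfolding u_def[abs_def] by blast
  have b: "continuous_on ?R b" "\<And>x. x \<notin> ?R \<Longrightarrow> b x = 0" "square_integrable ?R b" if "b \<in> B" for b
    using \<nu>[OF that] unfolding neumann_eigenspace_def H1_def by blast+
  have cu: "continuous_on ?R u"
    unfolding u_def by (intro continuous_intros b)
  have tri: "16 * pi\<^sup>2 / 9 * (LINT x|lebesgue_on (rhombus_half s). (u x)\<^sup>2) \<le> (LINT x|lebesgue_on (rhombus_half s). (norm (g x))\<^sup>2)"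
    if s: "s = 1 \<or> s = -1" for s
  proof (rule Poincare_rhombus_half[OF s])
    show "H1 (rhombus_half s) u g"
      by (rule H1_mono[OF g(1) rhombus_half_subset[OF s] sets_rhombus_half sets_equilateral_rhombus])
    show "continuous_on (rhombus_half s) u"
      using cu rhombus_half_subset[OF s] by (rule continuous_on_subset)
    have i: "integrable (lebesgue_on (rhombus_half s)) b" if b0: "b \<in> B" for b
    proof -
      have "square_integrable (rhombus_half s) b"
        using square_integrable_mono[OF b(3)[OF b0] rhombus_half_subset[OF s] sets_rhombus_half sets_equilateral_rhombus] .
      moreover have "square_integrable (rhombus_half s) (\<lambda>x. 1::real)"
        using square_integrable_continuous[OF bounded_rhombus_half[OF s] sets_rhombus_half continuous_on_const] .
      ultimately show ?thesis using square_integrable_mult by fastforce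
    qed
    have "(LINT x|lebesgue_on (rhombus_half s). u x) = (\<Sum>b\<in>B. c b * (LINT x|lebesgue_on (rhombus_half s). b x))"
      unfolding u_def by (subst Bochner_Integration.integral_sum) (auto intro: i)
    then show "(LINT x|lebesgue_on (rhombus_half s). u x) = 0" using c(2,3) s by auto
  qed
  have i: "integrable (lebesgue_on ?R) (\<lambda>x. (u x)\<^sup>2)" "integrable (lebesgue_on ?R) (\<lambda>x. (norm (g x))\<^sup>2)"
    using g(1) by (auto simp: H1_def square_integrable_def)
  have "16 * pi\<^sup>2 / 9 * (LINT x|lebesgue_on ?R. (u x)\<^sup>2) \<le> (LINT x|lebesgue_on ?R. (norm (g x))\<^sup>2)"
    unfolding integral_rhombus_split[OF i(1)] integral_rhombus_split[OF i(2)]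
    using tri[of 1] tri[of "-1"] by (simp add: distrib_left)
  with g(2) have "(16 * pi\<^sup>2 / 9 - \<xi>) * (LINT x|lebesgue_on ?R. (u x)\<^sup>2) \<le> 0"
    by (simp add: left_diff_distrib)
  then have "(LINT x|lebesgue_on ?R. (u x)\<^sup>2) \<le> 0"
    using less by (simp add: mult_le_0_iff)
  moreover have "square_integrable ?R u" using g(1) by (simp add: H1_def)
  ultimately have "u x = 0" if "x \<in> ?R" for x
    using continuous_integral_square_zero[OF open_equilateral_rhombus cu] that by blast
  \<comment> \<open>Independence concerns total functions; off the rhombus the normalisation of
    eigenfunctions gives the zero.\<close>
  moreover have "u x = 0" if "x \<notin> ?R" for x
    unfolding u_def using b(2)[OF _ that] by (intro sum.neutral ballI) simp
  ultimately have "u x = 0" for x by blast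
  then have "(\<Sum>b\<in>B. (\<lambda>x. c b * b x)) = 0"
    by (simp add: fun_eq_iff zero_fun_def sum_fun_apply u_def)
  then show False
    using B(2) c(1) funs.dependent_finite[OF fin] by blast
qed

section \<open>Eigenfunctions, nodal domains and the theorem\<close>

text \<open>Changing \<open>s\<close> to \<open>- s\<close> exchanges \<open>angle2\<close> and
  \<open>angle3\<close> up to multiples of \<open>2 * pi\<close>. The lowest modes of the two halves
  are therefore the same functions, symmetric about all four sides of the rhombus.\<close>

lemma orbit_sum_100_uminus:
  assumes "s = 1 \<or> s = -1"
  shows "orbit_sum s 1 0 0 = orbit_sum 1 1 0 0"
proof
  fix x
  have "cis (angle2 (-1) x) = cis (angle3 1 x)" "cis (angle3 (-1) x) = cis (angle2 1 x)"
    by (auto simp: complex_eq_iff angle2_def angle3_def cos_diff cos_add sin_diff sin_add)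
  then show "orbit_sum s 1 0 0 x = orbit_sum 1 1 0 0 x"
    using assms by (auto simp: orbit_sum_100 angle1_def)
qed

definition rhombus_extension :: "(real^2 \<Rightarrow> real) \<Rightarrow> real^2 \<Rightarrow> real" where
  "rhombus_extension f x = (if x \<in> equilateral_rhombus then f x else 0)"

lemma rhombus_mode_eigenfunction:
  assumes D: "helmholtz l f D"
    and inv: "\<And>a b x. a \<in> {1, -1} \<Longrightarrow> b \<in> {1, -1} \<Longrightarrow> f (mirror (vector [a / sqrt 3, b]) (1 / 2) x) = f x"
  shows "rhombus_extension f \<in> neumann_eigenspace equilateral_rhombus l"
proof -
  have "polygon_mode ({1, -1} \<times> {1, -1}) rhombus_normal (\<lambda>_. 1 / 2) l f D"
    unfolding polygon_mode_def rhombus_normal_def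
  proof (intro conjI D ballI allI)
    fix i :: "real \<times> real" and x assume "i \<in> {1, -1} \<times> {1, -1}"
    then obtain a b where "i = (a, b)" "a \<in> {1, -1}" "b \<in> {1, -1}" by blast
    then show "f (mirror (case i of (a, b) \<Rightarrow> vector [a / sqrt 3, b]) (1 / 2) x) = f x"
      by (simp only: prod.case inv)
  qed
  then show ?thesis
    unfolding rhombus_extension_def[abs_def] equilateral_rhombus_polygon
    by (rule polygon_mode_eigenfunction)
      (use bounded_equilateral_rhombus in \<open>auto simp: equilateral_rhombus_polygon rhombus_normal_def vec_eq_iff forall_2\<close>)
qed

lemma rhombus_eigenfunction_orbit_mode:
  "rhombus_extension (orbit_mode 1 c 1 0 0) \<in> neumann_eigenspace equilateral_rhombus (16 * pi\<^sup>2 / 9)"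
proof -
  have ev: "mode_eigenvalue 1 0 0 = 16 * pi\<^sup>2 / 9" by (simp add: mode_eigenvalue_def)
  obtain D where D: "helmholtz (16 * pi\<^sup>2 / 9) (orbit_mode 1 c 1 0 0) D"
    using helmholtz_orbit_mode[of 1 1 0 0 c] unfolding ev by blast
  show ?thesis
  proof (rule rhombus_mode_eigenfunction[OF D])
    fix a b :: real and x assume a: "a \<in> {1, -1}" and b: "b \<in> {1, -1}"
    have a': "a = 1 \<or> a = -1" using a by auto
    \<comment> \<open>A side with horizontal sign \<open>a\<close> bounds the half with
      \<open>s = a\<close>, so the mode is read there and that half's reflection applies.\<close>
    have "orbit_mode a c 1 0 0 (mirror (vector [a / sqrt 3, b]) (1 / 2) x) = orbit_mode a c 1 0 0 x"
      using b orbit_mode_mirror(2,3)[OF a', of c 1 0 0 x] by auto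
    then show "orbit_mode 1 c 1 0 0 (mirror (vector [a / sqrt 3, b]) (1 / 2) x) = orbit_mode 1 c 1 0 0 x"
      by (simp add: orbit_mode_def orbit_sum_100_uminus[OF a'])
  qed
qed

lemma rhombus_eigenfunction_const:
  "rhombus_extension (\<lambda>_. 1) \<in> neumann_eigenspace equilateral_rhombus 0"
proof -
  \<comment> \<open>The constant 1 as the mode of zero frequency; \<open>1 / 6\<close> offsets its
    six equal waves.\<close>
  have "\<exists>D. helmholtz (mode_eigenvalue 0 0 0) (orbit_mode 1 (1 / 6) 0 0 0) D"
    by (rule helmholtz_orbit_mode) simp
  moreover have "orbit_mode 1 (1 / 6) 0 0 0 = (\<lambda>_. 1)"
    by (simp add: fun_eq_iff orbit_mode_const)
  moreover have "mode_eigenvalue 0 0 0 = 0" by (simp add: mode_eigenvalue_def)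
  ultimately obtain D where "helmholtz 0 (\<lambda>_::real^2. 1) D" by auto
  then show ?thesis by (rule rhombus_mode_eigenfunction) simp
qed

text \<open>The factor 1/2 undoes the doubling in \<open>orbit_sum_100\<close>, and
  \<open>- (\<i> / 2)\<close> selects the imaginary part, which is odd in
  \<open>x$2\<close>.\<close>

lemma orbit_mode_100:
  fixes x :: "real^2"
  defines "p \<equiv> 2 * pi / 3 * x$2" and "q \<equiv> 2 * pi / sqrt 3 * x$1"
  shows "orbit_mode 1 (1 / 2) 1 0 0 x = cos (2 * p) - 2 * cos q * cos p"
    and "orbit_mode 1 (- (\<i> / 2)) 1 0 0 x = sin (2 * p) + 2 * cos q * sin p"
proof -
  have a: "angle1 1 x = 2 * p" "angle2 1 x = pi - q - p" "angle3 1 x = q - p - pi"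
    by (simp_all add: angle1_def angle2_def angle3_def p_def q_def)
  show "orbit_mode 1 (1 / 2) 1 0 0 x = cos (2 * p) - 2 * cos q * cos p"
    unfolding orbit_mode_def orbit_sum_100 a
    by (simp add: cos_diff cos_add sin_diff)
  show "orbit_mode 1 (- (\<i> / 2)) 1 0 0 x = sin (2 * p) + 2 * cos q * sin p"
    unfolding orbit_mode_def orbit_sum_100 a
    by (simp add: cos_diff sin_add sin_diff field_simps)
qed

lemma rhombus_eigenfunctions_independent:
  defines "B \<equiv> {rhombus_extension (\<lambda>_. 1), rhombus_extension (orbit_mode 1 (1 / 2) 1 0 0),
      rhombus_extension (orbit_mode 1 (- (\<i> / 2)) 1 0 0)}"
  shows "card B = 3" "funs.independent B"
proof -
  define f1 where "f1 = rhombus_extension (\<lambda>_. 1)"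
  define f2 where "f2 = rhombus_extension (orbit_mode 1 (1 / 2) 1 0 0)"
  define f3 where "f3 = rhombus_extension (orbit_mode 1 (- (\<i> / 2)) 1 0 0)"
  have B: "B = {f1, f2, f3}" by (simp add: B_def f1_def f2_def f3_def)
  \<comment> \<open>At 0 and \<open>y\<close> the odd function vanishes while the even one takes the
    values -1 and 1, which eliminates the first two coefficients; at \<open>z\<close> the odd
    function is positive.\<close>
  define y z :: "real^2" where "y = vector [sqrt 3 / 4, 0]" and "z = vector [0, 1 / 4]"
  have R: "0 \<in> equilateral_rhombus" "y \<in> equilateral_rhombus" "z \<in> equilateral_rhombus"
    by (auto simp: equilateral_rhombus_iff y_def z_def)
  have v0: "f1 0 = 1" "f2 0 = -1" "f3 0 = 0"
    using R by (simp_all add: f1_def f2_def f3_def rhombus_extension_def orbit_mode_100)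
  have vy: "f1 y = 1" "f2 y = 1" "f3 y = 0"
    using R by (simp_all add: f1_def f2_def f3_def rhombus_extension_def orbit_mode_100)
      (simp_all add: y_def)
  have vz: "f3 z > 0"
  proof -
    have "sin (pi / 6) > 0" "sin (pi / 3) > 0" by (simp_all add: sin_30 sin_60)
    then show ?thesis
      using R by (simp add: f3_def rhombus_extension_def orbit_mode_100) (simp add: z_def add_pos_pos)
  qed
  have ne: "f1 \<noteq> f2" "f2 \<noteq> f3" "f1 \<noteq> f3" using v0 by auto
  then show "card B = 3" unfolding B by simp
  show "funs.independent B"
  proof
    assume "funs.dependent B"
    moreover have "finite B" by (simp add: B)
    ultimately obtain r where r: "\<exists>v\<in>B. r v \<noteq> 0" "(\<Sum>v\<in>B. (\<lambda>x. r v * v x)) = 0"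
      using funs.dependent_finite by blast
    have eq: "r f1 * f1 x + r f2 * f2 x + r f3 * f3 x = 0" for x
      using fun_cong[OF r(2), of x] ne unfolding sum_fun_apply B by (simp add: add.assoc)
    have "r f1 = 0" "r f2 = 0" using eq[of 0] eq[of y] v0 vy by auto
    moreover from this have "r f3 = 0" using eq[of z] vz by auto
    ultimately show False using r(1) B by auto
  qed
qed

section \<open>The first and the third listed eigenvalue\<close>

definition eigenvalue_bounds :: "(real \<Rightarrow> ('a \<Rightarrow> real) set) \<Rightarrow> nat \<Rightarrow> real set" where
  "eigenvalue_bounds E m =
     {\<xi>. \<exists>B. finite B \<and> card B = m \<and> funs.independent B \<and> B \<subseteq> (\<Union>\<mu>\<in>{..\<xi>}. E \<mu>)}"

lemma nth_eigenvalue_eq: "nth_eigenvalue E m = Inf (eigenvalue_bounds E m)"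
  by (simp add: nth_eigenvalue_def eigenvalue_bounds_def)

lemma eigenvalue_bounds_antimono:
  assumes "m \<le> k"
  shows "eigenvalue_bounds E k \<subseteq> eigenvalue_bounds E m"
proof
  fix \<xi> assume "\<xi> \<in> eigenvalue_bounds E k"
  then obtain B where B: "finite B" "card B = k" "funs.independent B" "B \<subseteq> (\<Union>\<mu>\<in>{..\<xi>}. E \<mu>)"
    unfolding eigenvalue_bounds_def by blast
  obtain C where C: "C \<subseteq> B" "card C = m" using assms B(2) obtain_subset_with_card_n by metis
  then have "finite C" "funs.independent C" "C \<subseteq> (\<Union>\<mu>\<in>{..\<xi>}. E \<mu>)"
    using B finite_subset funs.independent_mono by blast+
  then show "\<xi> \<in> eigenvalue_bounds E m" using C(2) unfolding eigenvalue_bounds_def by blast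
qed

text \<open>Passing to a single eigenfunction, nonzero by independence, reduces this to the sign of
  one eigenvalue. It keeps the infima in the list bounded below.\<close>

lemma eigenvalue_bounds_nonneg:
  assumes "open \<Omega>" "1 \<le> m" "\<xi> \<in> eigenvalue_bounds (neumann_eigenspace \<Omega>) m"
  shows "0 \<le> \<xi>"
proof -
  have "\<xi> \<in> eigenvalue_bounds (neumann_eigenspace \<Omega>) 1"
    using eigenvalue_bounds_antimono[OF assms(2)] assms(3) by blast
  then obtain B where "card B = 1" "funs.independent B" "B \<subseteq> (\<Union>\<mu>\<in>{..\<xi>}. neumann_eigenspace \<Omega> \<mu>)"
    unfolding eigenvalue_bounds_def by blast
  moreover from this obtain b where "B = {b}" by (auto simp: card_1_singleton_iff)
  ultimately obtain \<mu> where "b \<in> neumann_eigenspace \<Omega> \<mu>" "\<mu> \<le> \<xi>" "b \<noteq> 0"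
    using funs.dependent_zero by auto
  then show ?thesis using neumann_eigenvalue_nonneg[OF assms(1)] by force
qed

lemma first_eigenvalue_rhombus: "neumann_eigenvalue equilateral_rhombus 1 = 0"
  unfolding nth_eigenvalue_eq
proof (rule cInf_eq_minimum)
  have "0 \<in> equilateral_rhombus" by (simp add: equilateral_rhombus_iff)
  then have "rhombus_extension (\<lambda>_. 1) \<noteq> 0"
    by (auto simp: fun_eq_iff rhombus_extension_def)
  then have "funs.independent {rhombus_extension (\<lambda>_. 1)}"
    by simp
  then show "0 \<in> eigenvalue_bounds (neumann_eigenspace equilateral_rhombus) 1"
    using rhombus_eigenfunction_const unfolding eigenvalue_bounds_def
    by (intro CollectI exI[of _ "{rhombus_extension (\<lambda>_. 1)}"]) auto
qed (use eigenvalue_bounds_nonneg[OF open_equilateral_rhombus] in auto)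

lemma third_eigenvalue_rhombus: "neumann_eigenvalue equilateral_rhombus 3 = 16 * pi\<^sup>2 / 9"
  unfolding nth_eigenvalue_eq
proof (rule cInf_eq_minimum)
  let ?B = "{rhombus_extension (\<lambda>_. 1), rhombus_extension (orbit_mode 1 (1 / 2) 1 0 0),
      rhombus_extension (orbit_mode 1 (- (\<i> / 2)) 1 0 0)}"
  have "?B \<subseteq> (\<Union>\<mu>\<in>{..16 * pi\<^sup>2 / 9}. neumann_eigenspace equilateral_rhombus \<mu>)"
    using rhombus_eigenfunction_const rhombus_eigenfunction_orbit_mode by auto
  then show "16 * pi\<^sup>2 / 9 \<in> eigenvalue_bounds (neumann_eigenspace equilateral_rhombus) 3"
    using rhombus_eigenfunctions_independent unfolding eigenvalue_bounds_def
    by (intro CollectI exI[of _ ?B] conjI) auto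
next
  fix \<xi> assume "\<xi> \<in> eigenvalue_bounds (neumann_eigenspace equilateral_rhombus) 3"
  then show "16 * pi\<^sup>2 / 9 \<le> \<xi>"
    unfolding eigenvalue_bounds_def using three_eigenfunctions_bound by blast
qed

section \<open>The four nodal sectors\<close>

definition rhombus_sector :: "real \<times> real \<Rightarrow> (real^2) set" where
  "rhombus_sector = (\<lambda>(a, b). equilateral_rhombus \<inter> {x. vector [- a * sqrt 3, a] \<bullet> x < 0} \<inter>
     {x. vector [- b * sqrt 3, - b] \<bullet> x < 0})"

text \<open>\<open>a\<close> and \<open>b\<close> are the signs of the two linear forms that vanish
  on the nodal lines. The definition by half-spaces makes openness and convexity immediate.\<close>

lemma rhombus_sector_iff:
  "x \<in> rhombus_sector (a, b) \<longleftrightarrow>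
     x \<in> equilateral_rhombus \<and> 0 < a * (sqrt 3 * x$1 - x$2) \<and> 0 < b * (sqrt 3 * x$1 + x$2)"
  by (auto simp: rhombus_sector_def inner_vector_2 algebra_simps)

lemma rhombus_sector_nonempty:
  assumes "a \<in> {1, -1}" "b \<in> {1, -1}"
  shows "rhombus_sector (a, b) \<noteq> {}"
proof -
  \<comment> \<open>The solution of \<open>sqrt 3 * x$1 - x$2 = a / 4\<close> and
    \<open>sqrt 3 * x$1 + x$2 = b / 4\<close>.\<close>
  have "vector [(a + b) / (8 * sqrt 3), (b - a) / 8] \<in> rhombus_sector (a, b)"
    using assms by (auto simp: rhombus_sector_iff equilateral_rhombus_iff)
  then show ?thesis by blast
qed

lemma nodal_function_zero_iff:
  assumes x: "x \<in> equilateral_rhombus"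
  shows "1 + orbit_mode 1 (1 / 2) 1 0 0 x = 0 \<longleftrightarrow> sqrt 3 * x$1 - x$2 = 0 \<or> sqrt 3 * x$1 + x$2 = 0"
proof -
  define p where "p = 2 * pi / 3 * x$2"
  define q where "q = 2 * pi / sqrt 3 * x$1"
  have bd: "\<bar>x$1\<bar> / sqrt 3 + \<bar>x$2\<bar> < 1 / 2" using x by (simp add: equilateral_rhombus_iff)
  have "0 \<le> \<bar>x$1\<bar> / sqrt 3" by simp
  then have "\<bar>x$2\<bar> < 1 / 2" "\<bar>x$1\<bar> / sqrt 3 < 1 / 2" using bd by linarith+
  \<comment> \<open>Here the position inside the rhombus enters: \<open>cos p\<close> is positive
    and can be cancelled, and \<open>\<bar>p\<bar>\<close>, \<open>\<bar>q\<bar>\<close> lie where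
    \<open>cos\<close> is injective.\<close>
  then have "\<bar>p\<bar> < pi / 3" "\<bar>q\<bar> < pi"
    by (simp_all add: p_def q_def abs_mult field_simps)
  then have p: "\<bar>p\<bar> < pi / 2" and q: "\<bar>q\<bar> < pi" and p': "\<bar>p\<bar> \<le> pi" by linarith+
  have "1 + orbit_mode 1 (1 / 2) 1 0 0 x = 2 * cos p * (cos p - cos q)"
    unfolding orbit_mode_100(1) p_def[symmetric] q_def[symmetric] cos_double_cos
    by (simp add: power2_eq_square algebra_simps)
  moreover have "cos p > 0" using p by (intro cos_gt_zero_pi) auto
  ultimately have "1 + orbit_mode 1 (1 / 2) 1 0 0 x = 0 \<longleftrightarrow> cos \<bar>p\<bar> = cos \<bar>q\<bar>" by simp
  also have "\<dots> \<longleftrightarrow> \<bar>p\<bar> = \<bar>q\<bar>"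
  proof
    assume "cos \<bar>p\<bar> = cos \<bar>q\<bar>"
    then show "\<bar>p\<bar> = \<bar>q\<bar>"
      using cos_inj_pi[of "\<bar>p\<bar>" "\<bar>q\<bar>"] p' q by linarith
  qed (simp only:)
  also have "\<dots> \<longleftrightarrow> p = q \<or> p = - q" by (rule abs_eq_iff)
  also have "q = 2 * pi / 3 * (sqrt 3 * x$1)"
    by (simp add: q_def field_simps sqrt_3_mult_sqrt_3)
  also have "p = 2 * pi / 3 * (sqrt 3 * x$1) \<longleftrightarrow> sqrt 3 * x$1 - x$2 = 0"
    unfolding p_def mult_cancel_left by auto
  also have "p = - (2 * pi / 3 * (sqrt 3 * x$1)) \<longleftrightarrow> sqrt 3 * x$1 + x$2 = 0"
    unfolding p_def mult_minus_right[symmetric] mult_cancel_left by auto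
  finally show ?thesis .
qed

lemma nodal_count_rhombus:
  assumes v: "\<And>x. x \<in> equilateral_rhombus \<Longrightarrow> v x = 1 + orbit_mode 1 (1 / 2) 1 0 0 x"
  shows "nodal_count equilateral_rhombus v = 4"
proof -
  let ?R = equilateral_rhombus and ?I = "{1, -1} \<times> {1, -1 :: real}"
  define Z where "Z = {x\<in>?R. v x = 0}"
  have Z: "x \<in> Z \<longleftrightarrow> x \<in> ?R \<and> (sqrt 3 * x$1 - x$2 = 0 \<or> sqrt 3 * x$1 + x$2 = 0)" for x
    using v nodal_function_zero_iff by (auto simp: Z_def)
  \<comment> \<open>The nodal set is a closure in the plane. It stays on the two lines, so inside
    the rhombus it adds nothing to \<open>Z\<close>.\<close>
  have "closure Z \<subseteq> {x::real^2. vector [sqrt 3, -1] \<bullet> x = 0} \<union> {x. vector [sqrt 3, 1] \<bullet> x = 0}"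
    by (intro closure_minimal closed_Un closed_hyperplane) (auto simp: Z inner_vector_2)
  then have cl: "?R - closure Z = ?R - Z"
    using closure_subset[of Z] by (fastforce simp: Z inner_vector_2)
  have "components (?R - closure Z) = rhombus_sector ` ?I"
  proof (rule components_open_unique)
    show "pairwise disjnt (rhombus_sector ` ?I)"
      by (auto simp: pairwise_def disjnt_def rhombus_sector_iff)
    show "\<Union> (rhombus_sector ` ?I) = ?R - closure Z"
      unfolding cl by (auto simp: rhombus_sector_iff Z)
    fix X assume "X \<in> rhombus_sector ` ?I"
    then obtain a b where ab: "X = rhombus_sector (a, b)" "a \<in> {1, -1}" "b \<in> {1, -1}" by blast
    have "convex X"
      unfolding ab(1) rhombus_sector_def prod.case
      by (intro convex_Int convex_halfspace_lt) (simp add: equilateral_rhombus_def convex_interior)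
    moreover have "open X"
      unfolding ab(1) rhombus_sector_def prod.case
      by (intro open_Int open_halfspace_lt open_equilateral_rhombus)
    ultimately show "open X \<and> connected X \<and> X \<noteq> {}"
      using rhombus_sector_nonempty[OF ab(2,3)] ab(1) convex_connected by blast
  qed
  moreover have "card (rhombus_sector ` ?I) = 4"
  proof -
    \<comment> \<open>A common point of two sectors fixes both signs, and no sector is
      empty.\<close>
    have "inj_on rhombus_sector ?I"
    proof (rule inj_onI)
      fix i j assume i: "i \<in> ?I" and j: "j \<in> ?I" and eq: "rhombus_sector i = rhombus_sector j"
      obtain a b c d where ij: "i = (a, b)" "j = (c, d)" by (metis surj_pair)
      have abcd: "a = 1 \<or> a = -1" "b = 1 \<or> b = -1" "c = 1 \<or> c = -1" "d = 1 \<or> d = -1"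
        using i j by (auto simp: ij)
      obtain x where x: "x \<in> rhombus_sector (a, b)" using rhombus_sector_nonempty[of a b] abcd by blast
      then have "x \<in> rhombus_sector (c, d)" using eq by (simp add: ij)
      then have "a = c" "b = d"
        using x abcd unfolding rhombus_sector_iff by auto
      then show "i = j" by (simp add: ij)
    qed
    then show ?thesis by (simp add: card_image)
  qed
  ultimately show ?thesis
    by (simp add: nodal_count_def nodal_domains_def nodal_set_def Z_def numeral_eq_enat)
qed

text \<open>Supplies the components of the linear combination at all eigenvalues other than the
  first and the third.\<close>

lemma zero_in_neumann_eigenspace: "0 \<in> neumann_eigenspace \<Omega> \<nu>"
proof -
  have "H1 \<Omega> (0 :: 'a \<Rightarrow> real) (\<lambda>x. 0)"
    by (simp add: H1_def square_integrable_def zero_fun_def)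
  then show ?thesis
    unfolding neumann_eigenspace_def by (auto simp: zero_fun_def)
qed

text \<open>Nothing is known here about the existence of infinitely many eigenvalues, so \<open>neumann_eigenvalue \<Omega> j\<close>
  could be the junk value \<open>Inf {}\<close> for large \<open>j\<close>.\<close>

lemma finite_eigenvalues_le:
  assumes "open \<Omega>" "1 \<le> m"
  shows "finite {neumann_eigenvalue \<Omega> j | j. 1 \<le> j \<and> neumann_eigenvalue \<Omega> j \<le> neumann_eigenvalue \<Omega> m}"
    (is "finite ?S")
proof (rule finite_subset)
  let ?b = "eigenvalue_bounds (neumann_eigenspace \<Omega>)"
  show "?S \<subseteq> insert (Inf {}) (neumann_eigenvalue \<Omega> ` {..m})"
  proof
    fix y assume "y \<in> ?S"
    then obtain j where j: "1 \<le> j" "y = neumann_eigenvalue \<Omega> j" "y \<le> neumann_eigenvalue \<Omega> m" by blast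
    show "y \<in> insert (Inf {}) (neumann_eigenvalue \<Omega> ` {..m})"
    proof (cases "j \<le> m \<or> ?b j = {}")
      case True
      then show ?thesis using j by (auto simp: nth_eigenvalue_eq)
    next
      case False
      \<comment> \<open>Beyond index \<open>m\<close> a nonempty set of bounds gives a value at
        least the \<open>m\<close>-th one, so a listed value not above it must equal it.\<close>
      have "bdd_below (?b m)"
        using eigenvalue_bounds_nonneg[OF assms(1,2)] by (meson bdd_belowI)
      then have "Inf (?b m) \<le> Inf (?b j)"
        using False eigenvalue_bounds_antimono[of m j] by (intro cInf_superset_mono) auto
      then have "y = neumann_eigenvalue \<Omega> m" using j by (simp add: nth_eigenvalue_eq)
      then show ?thesis by blast
    qed
  qed
qed auto

theorem proposition2p11:
  "\<not> extended_courant equilateral_rhombus (neumann_eigenspace equilateral_rhombus) \<and>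
   (\<exists>v1 \<in> neumann_eigenspace equilateral_rhombus (neumann_eigenvalue equilateral_rhombus 1).
    \<exists>v3 \<in> neumann_eigenspace equilateral_rhombus (neumann_eigenvalue equilateral_rhombus 3).
      nodal_count equilateral_rhombus (v1 + v3) = 4)"
proof
  let ?R = equilateral_rhombus and ?E = "neumann_eigenspace equilateral_rhombus"
  define \<mu> where "\<mu> = nth_eigenvalue ?E"
  define v1 where "v1 = rhombus_extension (\<lambda>_. 1)"
  define v3 where "v3 = rhombus_extension (orbit_mode 1 (1 / 2) 1 0 0)"
  have \<mu>1: "\<mu> 1 = 0" and \<mu>3: "\<mu> 3 = 16 * pi\<^sup>2 / 9"
    unfolding \<mu>_def by (rule first_eigenvalue_rhombus third_eigenvalue_rhombus)+
  have v1: "v1 \<in> ?E (\<mu> 1)" and v3: "v3 \<in> ?E (\<mu> 3)"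
    unfolding \<mu>1 \<mu>3 v1_def v3_def
    by (rule rhombus_eigenfunction_const rhombus_eigenfunction_orbit_mode)+
  have four: "nodal_count ?R (v1 + v3) = 4"
    by (rule nodal_count_rhombus) (simp add: v1_def v3_def rhombus_extension_def)
  then show "\<exists>v1 \<in> ?E (neumann_eigenvalue ?R 1). \<exists>v3 \<in> ?E (neumann_eigenvalue ?R 3). nodal_count ?R (v1 + v3) = 4"
    using v1 v3 unfolding \<mu>_def by blast
  show "\<not> extended_courant ?R ?E"
  proof
    assume courant: "extended_courant ?R ?E"
    define S where "S = {\<mu> j | j. 1 \<le> j \<and> \<mu> j \<le> \<mu> 3}"
    define u where "u \<xi> = (if \<xi> = \<mu> 1 then v1 else if \<xi> = \<mu> 3 then v3 else 0)" for \<xi>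
    have ne: "\<mu> 1 \<noteq> \<mu> 3" unfolding \<mu>1 \<mu>3 by simp
    have "\<mu> 1 \<le> \<mu> 3" unfolding \<mu>1 \<mu>3 by simp
    then have mem: "\<mu> 1 \<in> S" "\<mu> 3 \<in> S" by (auto simp: S_def)
    have "\<forall>\<xi>\<in>S. u \<xi> \<in> ?E \<xi>"
      using v1 v3 zero_in_neumann_eigenspace by (auto simp: u_def)
    then have le: "nodal_count ?R (\<Sum>\<xi>\<in>S. u \<xi>) \<le> enat (min_index ?E (\<mu> 3))" and "min_index ?E (\<mu> 3) \<le> 3"
      using courant unfolding extended_courant_def Let_def S_def \<mu>_def by (auto dest!: spec[of _ 3] spec[of _ u])
    \<comment> \<open>A sum over an infinite set is 0 by convention; finiteness makes the sum reduce
      to its two nonzero terms.\<close>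
    have "finite S"
      using finite_eigenvalues_le[OF open_equilateral_rhombus, of 3] by (simp add: S_def \<mu>_def)
    then have "(\<Sum>\<xi>\<in>S. u \<xi>) = (\<Sum>\<xi>\<in>{\<mu> 1, \<mu> 3}. u \<xi>)"
      using mem by (intro sum.mono_neutral_right) (auto simp: u_def)
    also have "\<dots> = v1 + v3" using ne by (simp add: u_def)
    \<comment> \<open>The assumed property itself bounds the min-index by 3, so four nodal domains
      contradict it whatever the exact min-index is.\<close>
    finally have "enat 4 \<le> enat (min_index ?E (\<mu> 3))" using le four by (simp add: numeral_eq_enat)
    with \<open>min_index ?E (\<mu> 3) \<le> 3\<close> show False by simp
  qed
qed

end
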